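(* Let $N\geq 5$ and $0<\mu<N-4$, and let $C_{\mu,1},C_{\mu,2},2^{**},U_\mu,\mathcal{E}_\mu$ be as in the context. Then the space of solutions $v\in\mathcal{E}_\mu$ of the linearized problem $$\Delta^2 v+C_{\mu,1}\,\mathrm{div}\Big(\frac{\nabla v}{|x|^2}\Big)+C_{\mu,2}\frac{v}{|x|^4}=(2^{**}-1)U_\mu^{2^{**}-2}v\quad\text{in }\mathbb{R}^N\setminus\{0\}$$ has dimension $1$ and is spanned by $\frac{N-4}{2}U_\mu+x\cdot\nabla U_\mu$.
   Context: $2^{**}=\frac{2N}{N-4}$; $C_{\mu,1}=\frac{N^2-4N+8}{2(N-4)^2}\mu[2(N-4)-\mu]$; $C_{\mu,2}=\frac{N^2}{16(N-4)^2}\mu^2[2(N-4)-\mu]^2-\frac{N-2}{2}\mu[2(N-4)-\mu]$. $U_\mu(x)=K_{N,\mu}|x|^{-\frac{\mu}{2}}\big(1+|x|^{2(1-\frac{\mu}{N-4})}\big)^{-\frac{N-4}{2}}$ with $K_{N,\mu}=\big[(1-\frac{\mu}{N-4})^4(N-4)(N-2)N(N+2)\big]^{\frac{N-4}{8}}$. $\mathcal{D}^{2,2}_0(\mathbb{R}^N)=\{u\in L^{2^{**}}(\mathbb{R}^N):\Delta u\in L^2(\mathbb{R}^N)\}$; $\mathcal{E}_\mu$ is the set of $u\in\mathcal{D}^{2,2}_0(\mathbb{R}^N)$ with $\int|\Delta u|^2-C_{\mu,1}\int\frac{|\nabla u|^2}{|x|^2}+C_{\mu,2}\int\frac{u^2}{|x|^4}<\infty$,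 with inner product $\langle u,v\rangle_\mu=\int\Delta u\Delta v-C_{\mu,1}\int\frac{\nabla u\cdot\nabla v}{|x|^2}+C_{\mu,2}\int\frac{uv}{|x|^4}$ (integrals over $\mathbb{R}^N$). *)

theory Defs
  imports "HOL-Analysis.Analysis"
begin

definition pd :: "'n::finite \<Rightarrow> (real^'n \<Rightarrow> real) \<Rightarrow> real^'n \<Rightarrow> real" where
  "pd i f x = deriv (\<lambda>t. f (x + t *\<^sub>R axis i 1)) 0"

definition cgrad :: "(real^'n::finite \<Rightarrow> real) \<Rightarrow> real^'n \<Rightarrow> real^'n" where
  "cgrad f x = (\<chi> i. pd i f x)"

definition clap :: "(real^'n::finite \<Rightarrow> real) \<Rightarrow> real^'n \<Rightarrow> real" where
  "clap f x = (\<Sum>i\<in>UNIV. pd i (pd i f) x)"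

definition smooth :: "(real^'n::finite \<Rightarrow> real) \<Rightarrow> bool" where
  "smooth f \<longleftrightarrow> (\<forall>is :: 'n list. continuous_on UNIV (fold pd is f) \<and>
      (\<forall>i x. (\<lambda>t. fold pd is f (x + t *\<^sub>R axis i 1)) differentiable (at 0)))"

definition testfun :: "(real^'n::finite) set \<Rightarrow> (real^'n \<Rightarrow> real) \<Rightarrow> bool" where
  "testfun \<Omega> \<phi> \<longleftrightarrow> smooth \<phi> \<and> compact (closure {x. \<phi> x \<noteq> 0})
      \<and> closure {x. \<phi> x \<noteq> 0} \<subseteq> \<Omega>"

definition locint :: "(real^'n::finite \<Rightarrow> 'b::{banach,second_countable_topology}) \<Rightarrow> bool" where
  "locint f \<longleftrightarrow> f \<in> borel_measurable lborel \<and> (\<forall>K. compact K \<longrightarrow> set_integrable lborel K f)"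

definition weak_grad :: "(real^'n::finite \<Rightarrow> real) \<Rightarrow> (real^'n \<Rightarrow> real^'n) \<Rightarrow> bool" where
  "weak_grad u G \<longleftrightarrow> locint u \<and> locint G \<and>
     (\<forall>\<phi>. testfun UNIV \<phi> \<longrightarrow> (\<forall>i. (\<integral>x. u x * pd i \<phi> x \<partial>lborel) = - (\<integral>x. G x $ i * \<phi> x \<partial>lborel)))"

definition weak_lap :: "(real^'n::finite \<Rightarrow> real) \<Rightarrow> (real^'n \<Rightarrow> real) \<Rightarrow> bool" where
  "weak_lap u L \<longleftrightarrow> locint u \<and> locint L \<and>
     (\<forall>\<phi>. testfun UNIV \<phi> \<longrightarrow> (\<integral>x. u x * clap \<phi> x \<partial>lborel) = (\<integral>x. L x * \<phi> x \<partial>lborel))"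

definition Lp :: "real \<Rightarrow> (real^'n::finite \<Rightarrow> real) \<Rightarrow> bool" where
  "Lp p f \<longleftrightarrow> f \<in> borel_measurable lborel \<and> integrable lborel (\<lambda>x. \<bar>f x\<bar> powr p)"

definition two_ss :: "real \<Rightarrow> real" where "two_ss N = 2 * N / (N - 4)"

definition Cmu1 :: "real \<Rightarrow> real \<Rightarrow> real" where
  "Cmu1 N \<mu> = (N^2 - 4*N + 8) / (2 * (N - 4)^2) * \<mu> * (2*(N - 4) - \<mu>)"

definition Cmu2 :: "real \<Rightarrow> real \<Rightarrow> real" where
  "Cmu2 N \<mu> = N^2 / (16 * (N - 4)^2) * \<mu>^2 * (2*(N - 4) - \<mu>)^2 - (N - 2) / 2 * \<mu> * (2*(N - 4) - \<mu>)"

definition KNmu :: "real \<Rightarrow> real \<Rightarrow> real" where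
  "KNmu N \<mu> = ((1 - \<mu> / (N - 4))^4 * (N - 4) * (N - 2) * N * (N + 2)) powr ((N - 4) / 8)"

definition Umu :: "real \<Rightarrow> real \<Rightarrow> real^'n::finite \<Rightarrow> real" where
  "Umu N \<mu> x = KNmu N \<mu> * norm x powr (- \<mu> / 2)
      * (1 + norm x powr (2 * (1 - \<mu> / (N - 4)))) powr (- (N - 4) / 2)"

definition D22 :: "real \<Rightarrow> (real^'n::finite \<Rightarrow> real) \<Rightarrow> bool" where
  "D22 N u \<longleftrightarrow> Lp (two_ss N) u \<and> (\<exists>L. weak_lap u L \<and> Lp 2 L)"

text \<open>E_mu: the three integrals in the quadratic form are finite.\<close>
definition Emu :: "real \<Rightarrow> real \<Rightarrow> (real^'n::finite \<Rightarrow> real) \<Rightarrow> bool" where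
  "Emu N \<mu> u \<longleftrightarrow> D22 N u \<and> (\<exists>G. weak_grad u G \<and>
      integrable lborel (\<lambda>x. norm (G x)^2 / norm x^2)) \<and>
      integrable lborel (\<lambda>x. (u x)^2 / norm x^4)"

definition lin_sol :: "real \<Rightarrow> real \<Rightarrow> (real^'n::finite \<Rightarrow> real) \<Rightarrow> bool" where
  "lin_sol N \<mu> v \<longleftrightarrow> (\<exists>G L. weak_grad v G \<and> weak_lap v L \<and>
     (\<forall>\<phi>. testfun (UNIV - {0}) \<phi> \<longrightarrow>
        (\<integral>x. L x * clap \<phi> x \<partial>lborel)
        - Cmu1 N \<mu> * (\<integral>x. (G x \<bullet> cgrad \<phi> x) / norm x^2 \<partial>lborel)
        + Cmu2 N \<mu> * (\<integral>x. v x * \<phi> x / norm x^4 \<partial>lborel)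
        = (two_ss N - 1) * (\<integral>x. Umu N \<mu> x powr (two_ss N - 2) * v x * \<phi> x \<partial>lborel)))"

end

theory Submission
  imports Defs "HOL-Computational_Algebra.Polynomial"
begin

text \<open>
  Write \<open>m = (N - 4) / 2\<close>, \<open>\<alpha> = 1 - \<mu> / (N - 4)\<close> and \<open>t = ln |x|\<close>. A solution \<open>v\<close> is tested with
  \<open>p(x) |x|^-q \<psi>(ln |x|)\<close>, where \<open>p\<close> is a homogeneous polynomial of degree \<open>d\<close> and \<open>\<psi>\<close> is a test function
  on the line. By induction on \<open>d\<close> the contribution of the Laplacian of \<open>p\<close> vanishes, so that
  \<open>\<psi> \<mapsto> \<integral> v p |x|^-(d+m+4) \<psi>(ln |x|)\<close> is a distributional solution of
  \<open>w'''' - A w'' + B w = \<gamma> sech^4(\<alpha> t) w\<close>; hence it is given by a classical solution \<open>w\<close>, and integrability of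
  \<open>v^2 / |x|^4\<close> forces \<open>w\<close> and its derivatives to tend to \<open>0\<close>. Neither spherical harmonics nor polar coordinates are needed.

  For \<open>d \<ge> 1\<close> and \<open>\<alpha> < 1\<close> the quadratic form of this equation strictly dominates the one for \<open>d = 1\<close>, \<open>\<alpha> = 1\<close>,
  which is a sum of squares with ground state \<open>sech^(m+1)\<close> (the translation mode); so \<open>w = 0\<close>. For \<open>d = 0\<close> put \<open>w = sech^m y\<close>:
  the equation is the linearised Paneitz equation on the round sphere and factors as \<open>(L - N) (L + c) y = 0\<close> with \<open>c > 0\<close>
  and \<open>L\<close> the radial Laplacian, which leaves only \<open>y = tanh\<close>, the dilation mode. Since polynomials are dense,
  \<open>v\<close> is a multiple of the dilation generator.
\<close>

text \<open>A solution is only known to be locally integrable, so the push-forward of v times a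
  polynomial under ln |x| has no pointwise values. Its primitive W is continuous, because Young's
  inequality with a free parameter bounds the increments of W by the energy in a spherical shell
  plus the dilation invariant mass of the shell. The equation is therefore tested in a form
  integrated once, and du Bois-Reymond's lemma for fifth derivatives recovers w = W'. The same bound
  makes the oscillation of W on unit intervals vanish at both ends; interior estimates turn this
  into decay of w and of three derivatives, which supplies the boundary values of every energy
  identity.

  The threshold is sharp: at \<alpha> = 1 the translation modes lie in the kernel. After rescaling t
  by \<alpha>, the coefficients in degree zero no longer contain \<alpha>, while in degree at least
  one \<alpha> < 1 strictly raises the zeroth-order coefficient.

  The dilation generator is singular at the origin. Its weak derivatives on the whole space are
  obtained by cutting off in ln |x|, where the cut-offs are translates of one step and have
  uniformly bounded derivatives.\<close>

section \<open>Test functions on the line\<close>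

text \<open>By translation invariance the integrals of the difference quotients vanish; pass to the limit.\<close>

lemma integral_directional_derivative_zero:
  fixes f g :: "'a::euclidean_space \<Rightarrow> real"
  assumes der: "\<And>x. ((\<lambda>t. f (x + t *\<^sub>R e)) has_real_derivative g x) (at 0)"
    and cf: "continuous_on UNIV f" and cg: "continuous_on UNIV g"
    and supp: "\<And>x. R \<le> norm x \<Longrightarrow> f x = 0"
  shows "integral\<^sup>L lborel g = 0"
proof -
  have der': "((\<lambda>t. f (x + t *\<^sub>R e)) has_real_derivative g (x + t *\<^sub>R e)) (at t)" for x t
  proof -
    have "((\<lambda>s. f ((x + t *\<^sub>R e) + s *\<^sub>R e)) has_real_derivative g (x + t *\<^sub>R e)) (at (t - t))"
      using der[of "x + t *\<^sub>R e"] by simp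
    then have "((\<lambda>s. f ((x + t *\<^sub>R e) + (s - t) *\<^sub>R e)) has_real_derivative g (x + t *\<^sub>R e)) (at t)"
      using DERIV_shift[of "\<lambda>s. f ((x + t *\<^sub>R e) + s *\<^sub>R e)" "g (x + t *\<^sub>R e)" t "-t"] by simp
    then show ?thesis by (simp add: algebra_simps)
  qed
  have gz: "g x = 0" if "R < norm x" for x
  proof -
    have "open {t. R < norm (x + t *\<^sub>R e)}" by (intro open_Collect_less continuous_intros)
    then have "((\<lambda>t. 0::real) has_real_derivative g x) (at 0)"
      using der[of x] that supp
      by (intro DERIV_cong_ev[THEN iffD1, OF refl _ refl der[of x]] eventually_nhds[THEN iffD2] exI[of _ "{t. R < norm (x + t *\<^sub>R e)}"]) auto
    then show ?thesis using DERIV_unique DERIV_const by blast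
  qed
  obtain B where B: "\<And>x. \<bar>g x\<bar> \<le> B"
  proof -
    have "compact (g ` cball 0 (max R 0))" by (intro compact_continuous_image continuous_on_subset[OF cg]) auto
    then obtain B where B: "\<And>y. y \<in> g ` cball 0 (max R 0) \<Longrightarrow> norm y \<le> B" "B > 0"
      using compact_imp_bounded bounded_pos by metis
    have "\<bar>g x\<bar> \<le> B" for x
      using B gz[of x] by (cases "norm x \<le> max R 0") auto
    then show thesis using that by blast
  qed
  have fi: "integrable lborel f"
  proof -
    have "integrable lborel (\<lambda>x. indicator (cball 0 R) x *\<^sub>R f x)"
      by (rule borel_integrable_compact) (auto intro: continuous_on_subset[OF cf])
    moreover have "(\<lambda>x. indicator (cball 0 R) x *\<^sub>R f x) = f" using supp by (auto simp: indicator_def fun_eq_iff)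
    ultimately show ?thesis by simp
  qed
  \<comment> \<open>The steps 1/(n+1) are at most 1, so every quotient vanishes outside the ball of
    radius |R| + |e|; inside, the mean value theorem bounds it by the bound B of |g|.\<close>
  define q where "q n x = (f (x + inverse (real (Suc n)) *\<^sub>R e) - f x) * real (Suc n)" for n x
  have q0: "integral\<^sup>L lborel (q n) = 0" for n
  proof -
    have e: "distr lborel borel ((+) (inverse (real (Suc n)) *\<^sub>R e)) = lborel" by (rule lborel_distr_plus)
    have "integrable lborel (\<lambda>x. f (inverse (real (Suc n)) *\<^sub>R e + x))"
      using fi by (subst (asm) e[symmetric], subst (asm) integrable_distr_eq) auto
    moreover have "integral\<^sup>L lborel (\<lambda>x. f (inverse (real (Suc n)) *\<^sub>R e + x)) = integral\<^sup>L lborel f"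
      using fi by (subst (2) e[symmetric], subst integral_distr) auto
    ultimately show ?thesis unfolding q_def using fi by (simp add: add.commute Bochner_Integration.integral_diff)
  qed
  have "(\<lambda>n. integral\<^sup>L lborel (q n)) \<longlonglongrightarrow> integral\<^sup>L lborel g"
  proof (rule integral_dominated_convergence[where w="\<lambda>x. indicator (cball 0 (\<bar>R\<bar> + norm e)) x *\<^sub>R B"])
    show "g \<in> borel_measurable lborel" using cg by (simp add: borel_measurable_continuous_onI)
    show "q n \<in> borel_measurable lborel" for n
    proof -
      have "continuous_on UNIV (q n)" unfolding q_def
        by (intro continuous_intros continuous_on_compose2[OF cf]) auto
      then show ?thesis by (simp add: borel_measurable_continuous_onI)
    qed
    show "integrable lborel (\<lambda>x::'a. indicator (cball 0 (\<bar>R\<bar> + norm e)) x *\<^sub>R B)"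
      by (rule borel_integrable_compact) auto
    show "AE x in lborel. (\<lambda>n. q n x) \<longlonglongrightarrow> g x"
    proof (intro AE_I2)
      fix x
      have "(\<lambda>t. (f (x + t *\<^sub>R e) - f x) / t) \<midarrow>0\<rightarrow> g x"
        using der[of x] by (simp add: has_field_derivative_iff)
      then have "(\<lambda>n. (f (x + inverse (real (Suc n)) *\<^sub>R e) - f x) / inverse (real (Suc n))) \<longlonglongrightarrow> g x"
        by (rule filterlim_compose) (use LIMSEQ_inverse_real_of_nat in \<open>auto simp: filterlim_at\<close>)
      then show "(\<lambda>n. q n x) \<longlonglongrightarrow> g x" by (simp add: q_def field_simps)
    qed
    show "AE x in lborel. norm (q n x) \<le> indicator (cball 0 (\<bar>R\<bar> + norm e)) x *\<^sub>R B" for n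
    proof (intro AE_I2)
      fix x
      let ?h = "inverse (real (Suc n))"
      have h: "0 < ?h" "?h \<le> 1" by (auto simp: field_simps)
      show "norm (q n x) \<le> indicator (cball 0 (\<bar>R\<bar> + norm e)) x *\<^sub>R B"
      proof (cases "norm x \<le> \<bar>R\<bar> + norm e")
        case True
        obtain z where "f (x + ?h *\<^sub>R e) - f (x + 0 *\<^sub>R e) = (?h - 0) * g (x + z *\<^sub>R e)"
          using MVT2[OF h(1), of "\<lambda>t. f (x + t *\<^sub>R e)" "\<lambda>t. g (x + t *\<^sub>R e)"] der' by blast
        then have "q n x = g (x + z *\<^sub>R e)" by (simp add: q_def)
        then show ?thesis using B True by auto
      next
        case False
        have "norm (?h *\<^sub>R e) \<le> 1 * norm e" unfolding norm_scaleR using h by (intro mult_right_mono) auto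
        moreover have "norm x - norm (?h *\<^sub>R e) \<le> norm (x + ?h *\<^sub>R e)"
          by (metis norm_diff_ineq)
        moreover have "0 \<le> norm e" by simp
        ultimately have "R \<le> norm x" "R \<le> norm (x + ?h *\<^sub>R e)" using False by linarith+
        then show ?thesis using supp False by (simp add: q_def indicator_def)
      qed
    qed
  qed
  then show ?thesis using q0 by (simp add: LIMSEQ_const_iff)
qed


lemma integrable_continuous_compact_support:
  fixes f :: "'a::euclidean_space \<Rightarrow> real"
  assumes "continuous_on UNIV f" "\<And>x. R \<le> norm x \<Longrightarrow> f x = 0"
  shows "integrable lborel f"
proof -
  have "integrable lborel (\<lambda>x. indicator (cball 0 R) x *\<^sub>R f x)"
    by (rule borel_integrable_compact) (auto intro: continuous_on_subset[OF assms(1)])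
  moreover have "(\<lambda>x. indicator (cball 0 R) x *\<^sub>R f x) = f"
    using assms(2) by (auto simp: indicator_def fun_eq_iff)
  ultimately show ?thesis by simp
qed

lemma integral_by_parts_real_line:
  fixes f g :: "real \<Rightarrow> real"
  assumes f: "\<And>x. (f has_real_derivative f' x) (at x)" and g: "\<And>x. (g has_real_derivative g' x) (at x)"
    and c: "continuous_on UNIV f'" "continuous_on UNIV g'"
    and supp: "\<And>t. R \<le> \<bar>t\<bar> \<Longrightarrow> g t = 0" "\<And>t. R \<le> \<bar>t\<bar> \<Longrightarrow> g' t = 0"
  shows "(\<integral>t. f t * g' t \<partial>lborel) = - (\<integral>t. f' t * g t \<partial>lborel)"
proof -
  have cf: "continuous_on UNIV f" "continuous_on UNIV g"
    using DERIV_isCont[OF f] DERIV_isCont[OF g] by (auto intro!: continuous_at_imp_continuous_on)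
  have "(\<integral>t. f t * g' t + f' t * g t \<partial>lborel) = 0"
  proof (rule integral_directional_derivative_zero[where f="\<lambda>t. f t * g t" and e=1 and R=R])
    fix x :: real
    have "((\<lambda>t. f t * g t) has_real_derivative f x * g' x + f' x * g x) (at (0 + x))"
      using DERIV_mult[OF f g, of x] by (simp add: algebra_simps)
    then show "((\<lambda>t. f (x + t *\<^sub>R 1) * g (x + t *\<^sub>R 1)) has_real_derivative f x * g' x + f' x * g x) (at 0)"
      unfolding DERIV_shift by (simp add: add.commute)
  qed (use supp in \<open>auto intro!: continuous_intros c cf\<close>)
  moreover have "integrable lborel (\<lambda>t. f t * g' t)" "integrable lborel (\<lambda>t. f' t * g t)"
    by (rule integrable_continuous_compact_support[where R=R]; use supp in \<open>auto intro!: continuous_intros c cf\<close>)+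
  ultimately show ?thesis by simp
qed

lemma integral_pos_continuous:
  fixes f :: "'a::euclidean_space \<Rightarrow> real"
  assumes "continuous_on UNIV f" "integrable lborel f" "\<And>x. 0 \<le> f x" "0 < f a"
  shows "0 < integral\<^sup>L lborel f"
proof -
  have "isCont f a" using assms(1) by (simp add: continuous_on_eq_continuous_at)
  then obtain d where d: "d > 0" "\<And>x. dist x a < d \<Longrightarrow> dist (f x) (f a) < f a / 2"
    using assms(4) unfolding continuous_at_eps_delta by (metis half_gt_zero)
  have "integral\<^sup>L lborel (\<lambda>x. f a / 2 * indicator (ball a d) x) \<le> integral\<^sup>L lborel f"
  proof (rule integral_mono[OF _ assms(2)])
    show "integrable lborel (\<lambda>x. f a / 2 * indicator (ball a d) x)"
      by (intro integrable_mult_right integrable_real_indicator) (use emeasure_lborel_ball_finite[of a d] in \<open>auto simp: less_top[symmetric]\<close>)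
    show "f a / 2 * indicator (ball a d) x \<le> f x" for x
      using d(2)[of x] assms(3)[of x] by (auto simp: indicator_def dist_commute dist_real_def abs_if split: if_splits)
  qed
  moreover have "integral\<^sup>L lborel (\<lambda>x. f a / 2 * indicator (ball a d) x) = f a / 2 * measure lborel (ball a d)"
    by simp
  moreover have "0 < measure lborel (ball a d)" using content_ball_pos[OF d(1), of a] by simp
  ultimately show ?thesis using assms(4) by (smt (verit) mult_pos_pos half_gt_zero)
qed

section \<open>Primitives of continuous functions\<close>

definition antideriv :: "(real \<Rightarrow> real) \<Rightarrow> real \<Rightarrow> real" where
  "antideriv f t = (LBINT y=0..t. f y)"

lemma antideriv_DERIV:
  assumes "continuous_on UNIV f"
  shows "(antideriv f has_real_derivative f x) (at x)"
proof -
  \<comment> \<open>The interval is widened by 1 on both sides so that it contains 0 and has x in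
    its interior.\<close>
  have "((\<lambda>u. LBINT y=0..u. f y) has_vector_derivative f x) (at x within {-\<bar>x\<bar>-1..\<bar>x\<bar>+1})"
    using interval_integral_FTC2[of "-\<bar>x\<bar>-1" 0 "\<bar>x\<bar>+1" f x] assms
    continuous_on_subset[OF assms, of "{-\<bar>x\<bar>-1..\<bar>x\<bar>+1}"] by (auto simp: zero_ereal_def)
  then have "((\<lambda>u. LBINT y=0..u. f y) has_vector_derivative f x) (at x)"
    by (subst (asm) at_within_interior) (auto simp: interior_atLeastAtMost_real)
  then show ?thesis unfolding antideriv_def by (simp add: has_real_derivative_iff_has_vector_derivative)
qed

lemma antideriv_continuous: "continuous_on UNIV f \<Longrightarrow> continuous_on UNIV (antideriv f)"
  by (auto intro!: continuous_at_imp_continuous_on DERIV_isCont[OF antideriv_DERIV])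

lemma antideriv_funpow_continuous: "continuous_on UNIV f \<Longrightarrow> continuous_on UNIV ((antideriv ^^ k) f)"
  by (induction k) (auto intro: antideriv_continuous)

text \<open>Smoothness is witnessed by a sequence of functions, each the derivative of the one
  before. Closure properties are then proved by exhibiting such a sequence, without computing
  iterated \<open>deriv\<close>.\<close>

definition test_fun :: "(real \<Rightarrow> real) \<Rightarrow> bool" where
  "test_fun f \<longleftrightarrow> (\<exists>F. F (0::nat) = f \<and> (\<forall>n x. (F n has_real_derivative F (Suc n) x) (at x)))
     \<and> (\<exists>R. \<forall>t. R \<le> \<bar>t\<bar> \<longrightarrow> f t = 0)"

lemma test_funI:
  assumes "F (0::nat) = f" "\<And>n x. (F n has_real_derivative F (Suc n) x) (at x)" "\<And>t. R \<le> \<bar>t\<bar> \<Longrightarrow> f t = 0"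
  shows "test_fun f"
  using assms unfolding test_fun_def by blast

lemma test_funE:
  assumes "test_fun f"
  obtains F R where "F (0::nat) = f" "\<And>n x. (F n has_real_derivative F (Suc n) x) (at x)"
    "\<And>n t. R \<le> \<bar>t\<bar> \<Longrightarrow> F n t = 0"
proof -
  obtain F R where F: "F (0::nat) = f" "\<And>n x. (F n has_real_derivative F (Suc n) x) (at x)"
     and R: "\<And>t. R \<le> \<bar>t\<bar> \<Longrightarrow> f t = 0" using assms unfolding test_fun_def by blast
  have z: "F n t = 0" if "R < \<bar>t\<bar>" for n t
    using that
  proof (induction n arbitrary: t)
    case 0 then show ?case using F R by simp
  next
    case (Suc n)
    have "open {t. R < \<bar>t::real\<bar>}" by (intro open_Collect_less continuous_intros)
    then have "((\<lambda>t. 0::real) has_real_derivative F (Suc n) t) (at t)"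
      using Suc
      by (intro DERIV_cong_ev[THEN iffD1, OF refl _ refl F(2)] eventually_nhds[THEN iffD2] exI[of _ "{t. R < \<bar>t\<bar>}"]) auto
    then show ?case using DERIV_unique DERIV_const by blast
  qed
  \<comment> \<open>The induction needs an open set and so gives the strict inequality; adding 1 to
    R restores the non-strict form.\<close>
  show thesis by (rule that[OF F, of "R+1"]) (auto intro!: z)
qed

lemma test_fun_DERIV: "test_fun f \<Longrightarrow> (f has_real_derivative deriv f x) (at x)"
  by (erule test_funE) (metis DERIV_imp_deriv)

lemma test_fun_deriv: assumes "test_fun f" shows "test_fun (deriv f)"
proof -
  obtain F R where F: "F (0::nat) = f" "\<And>n x. (F n has_real_derivative F (Suc n) x) (at x)"
    "\<And>n t. R \<le> \<bar>t\<bar> \<Longrightarrow> F n t = 0" using test_funE[OF assms] by metis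
  have "deriv f = F 1" using F(1) F(2)[of 0] DERIV_imp_deriv by fastforce
  then show ?thesis using F by (intro test_funI[of "\<lambda>n. F (Suc n)" _ R]) auto
qed

lemma test_fun_support: "test_fun f \<Longrightarrow> \<exists>R>0. \<forall>t. R \<le> \<bar>t\<bar> \<longrightarrow> f t = 0 \<and> deriv f t = 0"
proof -
  assume a: "test_fun f"
  obtain F R where F: "F (0::nat) = f" "\<And>n x. (F n has_real_derivative F (Suc n) x) (at x)"
    "\<And>n t. R \<le> \<bar>t\<bar> \<Longrightarrow> F n t = 0" using test_funE[OF a] by metis
  have "deriv f = F 1" using F(1) F(2)[of 0] DERIV_imp_deriv by fastforce
  then show ?thesis using F(1,3) by (intro exI[of _ "max R 1"]) auto
qed

lemma test_fun_continuous: "test_fun f \<Longrightarrow> continuous_on UNIV f"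
  by (auto intro!: continuous_at_imp_continuous_on DERIV_isCont[OF test_fun_DERIV])

lemma test_fun_funpow: "test_fun f \<Longrightarrow> test_fun ((deriv ^^ k) f)"
  by (induction k) (auto intro: test_fun_deriv)

lemma test_fun_linear: assumes "test_fun f" "test_fun g" shows "test_fun (\<lambda>t. a * f t + b * g t)"
proof -
  obtain F R where F: "F (0::nat) = f" "\<And>n x. (F n has_real_derivative F (Suc n) x) (at x)"
    "\<And>n t. R \<le> \<bar>t\<bar> \<Longrightarrow> F n t = 0" using test_funE[OF assms(1)] by metis
  obtain G R' where G: "G (0::nat) = g" "\<And>n x. (G n has_real_derivative G (Suc n) x) (at x)"
    "\<And>n t. R' \<le> \<bar>t\<bar> \<Longrightarrow> G n t = 0" using test_funE[OF assms(2)] by metis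
  show ?thesis
    by (rule test_funI[of "\<lambda>n t. a * F n t + b * G n t" _ "max R R'"])
       (use F G in \<open>auto intro!: derivative_eq_intros\<close>)
qed

lemma test_fun_cmult: "test_fun f \<Longrightarrow> test_fun (\<lambda>t. a * f t)" using test_fun_linear[of f f a 0] by simp
lemma test_fun_add: "test_fun f \<Longrightarrow> test_fun g \<Longrightarrow> test_fun (\<lambda>t. f t + g t)" using test_fun_linear[of f g 1 1] by simp
lemma test_fun_diff: "test_fun f \<Longrightarrow> test_fun g \<Longrightarrow> test_fun (\<lambda>t. f t - g t)" using test_fun_linear[of f g 1 "-1"] by simp

lemma deriv_linear: "test_fun f \<Longrightarrow> test_fun g \<Longrightarrow> deriv (\<lambda>t. a * f t + b * g t) = (\<lambda>t. a * deriv f t + b * deriv g t)"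
  by (rule ext, rule DERIV_imp_deriv) (auto intro!: derivative_eq_intros test_fun_DERIV)

lemma deriv_funpow_linear: "test_fun f \<Longrightarrow> test_fun g \<Longrightarrow>
   (deriv ^^ k) (\<lambda>t. a * f t + b * g t) = (\<lambda>t. a * (deriv ^^ k) f t + b * (deriv ^^ k) g t)"
  by (induction k) (auto simp: deriv_linear test_fun_funpow)

lemma test_fun_exp: assumes "test_fun f" shows "test_fun (\<lambda>t. exp (c * t) * f t)"
proof -
  obtain F R where F: "F (0::nat) = f" "\<And>n x. (F n has_real_derivative F (Suc n) x) (at x)"
    "\<And>n t. R \<le> \<bar>t\<bar> \<Longrightarrow> F n t = 0" using test_funE[OF assms] by metis
  \<comment> \<open>\<open>G n k\<close> is (D + c)^n applied to the k-th derivative of f, because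
    exp(-c t) D exp(c t) = D + c.\<close>
  define G where "G = rec_nat F (\<lambda>_ g k t. g (Suc k) t + c * g k t)"
  have G: "G 0 = F" "\<And>n. G (Suc n) = (\<lambda>k t. G n (Suc k) t + c * G n k t)" by (auto simp: G_def)
  have dG: "(G n k has_real_derivative G n (Suc k) x) (at x)" for n k x
    by (induction n arbitrary: k) (auto simp: G F intro!: derivative_eq_intros)
  show ?thesis
    by (rule test_funI[of "\<lambda>n t. exp (c * t) * G n 0 t" _ R])
      (use F in \<open>auto simp: G algebra_simps intro!: derivative_eq_intros dG\<close>)
qed

lemma test_fun_affine: assumes "test_fun f" "c \<noteq> 0" shows "test_fun (\<lambda>t. f (c * t + d))"
proof -
  obtain F R where F: "F (0::nat) = f" "\<And>n x. (F n has_real_derivative F (Suc n) x) (at x)"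
    "\<And>n t. R \<le> \<bar>t\<bar> \<Longrightarrow> F n t = 0" using test_funE[OF assms(1)] by metis
  show ?thesis
  proof (rule test_funI[of "\<lambda>n t. c ^ n * F n (c * t + d)" _ "(\<bar>R\<bar> + \<bar>d\<bar>) / \<bar>c\<bar>"])
    show "((\<lambda>t. c ^ n * F n (c * t + d)) has_real_derivative c ^ Suc n * F (Suc n) (c * x + d)) (at x)" for n x
    proof -
      have "((\<lambda>t. F n (c * t + d)) has_real_derivative F (Suc n) (c * x + d) * c) (at x)"
        by (rule DERIV_chain2[OF F(2)]) (auto intro!: derivative_eq_intros)
      then show ?thesis by (auto intro!: derivative_eq_intros simp: algebra_simps)
    qed
    show "f (c * t + d) = 0" if "(\<bar>R\<bar> + \<bar>d\<bar>) / \<bar>c\<bar> \<le> \<bar>t\<bar>" for t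
    proof -
      have "\<bar>R\<bar> + \<bar>d\<bar> \<le> \<bar>c * t\<bar>" using that assms(2) by (simp add: field_simps abs_mult)
      then show ?thesis using F(1) F(3)[of "c * t + d" 0] by (auto simp: abs_if split: if_splits)
    qed
  qed (use F in auto)
qed

text \<open>These functions are closed under differentiation, so the bump \<open>exp (- 1 / (t (1 - t)))\<close> is smooth.\<close>

definition bump_fn :: "real poly \<Rightarrow> nat \<Rightarrow> real \<Rightarrow> real" where
  "bump_fn p k t = (if 0 < t \<and> t < 1 then poly p t / (t * (1 - t)) ^ k * exp (- 1 / (t * (1 - t))) else 0)"

lemma power_le_fact_exp: fixes x :: real assumes "0 \<le> x" shows "x ^ n \<le> fact n * exp x"
proof -
  have "x ^ n /\<^sub>R fact n \<le> (\<Sum>k. x ^ k /\<^sub>R fact k)"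
    using sum_le_suminf[OF summable_exp_generic[of x], of "{n}"] assms by auto
  then show ?thesis by (simp add: exp_def field_simps)
qed

text \<open>The factor exp(-1/s) with s = t (1 - t) beats every power of s. Two spare powers are
  kept, so that the difference quotients at the endpoints tend to 0.\<close>

lemma bump_fn_bound: "\<exists>C. \<forall>t. 0 < t \<and> t < 1 \<longrightarrow> \<bar>bump_fn p k t\<bar> \<le> C * (t * (1 - t))\<^sup>2"
proof -
  have "compact (poly p ` {0..1})" by (intro compact_continuous_image continuous_intros) auto
  then obtain B where B: "\<And>t. 0 \<le> t \<Longrightarrow> t \<le> 1 \<Longrightarrow> \<bar>poly p t\<bar> \<le> B"
    using compact_imp_bounded bounded_iff by (metis atLeastAtMost_iff imageI real_norm_def)
  have "\<bar>bump_fn p k t\<bar> \<le> (B * fact (k + 2)) * (t * (1 - t))\<^sup>2" if "0 < t" "t < 1" for t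
  proof -
    define s where "s = t * (1 - t)"
    have s: "s > 0" using that by (simp add: s_def)
    have "(1 / s) ^ (k + 2) \<le> fact (k + 2) * exp (1 / s)" using s by (intro power_le_fact_exp) auto
    then have "exp (- 1 / s) / s ^ k \<le> fact (k + 2) * s\<^sup>2"
      using s by (simp add: exp_minus field_simps power_add power2_eq_square)
    then have "\<bar>poly p t\<bar> * (exp (- 1 / s) / s ^ k) \<le> B * (fact (k + 2) * s\<^sup>2)"
      using B[of t] that s by (intro mult_mono) auto
    then show ?thesis using that s by (simp add: bump_fn_def s_def[symmetric] abs_mult mult_ac)
  qed
  then show ?thesis by blast
qed

text \<open>The derivative is written over the common denominator s^(k+2), so that differentiation
  maps the class of \<open>bump_fn\<close> into itself and raises the exponent by two.\<close>

lemma inverse_power_exp_DERIV: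
  fixes s :: "real \<Rightarrow> real"
  assumes ds: "(s has_real_derivative d) (at x)" and nz: "s x \<noteq> 0"
  shows "((\<lambda>t. inverse (s t) ^ k * exp (- inverse (s t))) has_real_derivative
    (d - real k * s x * d) * inverse (s x) ^ (k + 2) * exp (- inverse (s x))) (at x)"
proof -
  define i where "i = inverse (s x)"
  have si: "s x * i = 1" using nz by (simp add: i_def)
  have di: "((\<lambda>t. inverse (s t)) has_real_derivative - (d * i ^ 2)) (at x)"
    using DERIV_inverse_fun[OF ds nz] by (simp add: i_def power2_eq_square)
  have dik: "((\<lambda>t. inverse (s t) ^ k) has_real_derivative - (real k * (d * i ^ (k + 1)))) (at x)"
    by (rule DERIV_cong[OF DERIV_power[OF di, of k]])
       (cases k; simp add: i_def[symmetric] power2_eq_square algebra_simps)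
  have de: "((\<lambda>t. exp (- inverse (s t))) has_real_derivative exp (- i) * (d * i ^ 2)) (at x)"
    by (rule derivative_eq_intros di | simp add: i_def)+
  have k1: "real k * s x * d * i ^ (k + 2) = real k * d * i ^ (k + 1)"
  proof -
    have "real k * s x * d * i ^ (k + 2) = (s x * i) * (real k * d * i ^ (k + 1))" by (simp add: power2_eq_square)
    then show ?thesis using si by simp
  qed
  have "(d - real k * s x * d) * i ^ (k + 2) = d * i ^ (k + 2) - real k * d * i ^ (k + 1)"
    using k1 by (simp only: left_diff_distrib)
  then show ?thesis
    by (intro DERIV_cong[OF DERIV_mult[OF dik de]])
       (simp add: i_def[symmetric] power_add algebra_simps power2_eq_square)
qed

text \<open>With s = t (1 - t), the polynomial \<open>[:0,1,-1:]\<close> is s and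
  \<open>[:1,-2:]\<close> is its derivative. Outside the open unit interval the quadratic bound
  forces the derivative to be 0.\<close>

lemma bump_fn_DERIV:
  "(bump_fn p k has_real_derivative bump_fn (pderiv p * [:0,1,-1:]\<^sup>2 - smult (real k) (p * [:0,1,-1:] * [:1,-2:]) + p * [:1,-2:]) (k + 2) x) (at x)"
    (is "(_ has_real_derivative bump_fn ?q _ x) _")
proof (cases "0 < x \<and> x < 1")
  case True
  then have "0 < x" "x < 1" by auto
  have s: "x * (1 - x) \<noteq> 0" using True by auto
  have ds: "((\<lambda>t. t * (1 - t)) has_real_derivative 1 - 2 * x) (at x)"
    by (auto intro!: derivative_eq_intros)
  define y where "y = x * (1 - x)"
  have y2: "inverse y ^ k = y ^ 2 * inverse y ^ (k + 2)"
    using s by (simp add: y_def[symmetric] power_add power2_eq_square field_simps)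
  have hbq: "bump_fn ?q (k + 2) x = (poly (pderiv p) x * y ^ 2 - real k * poly p x * y * (1 - 2 * x)
      + poly p x * (1 - 2 * x)) * inverse y ^ (k + 2) * exp (- inverse y)"
  proof -
    have "bump_fn ?q (k + 2) x = poly ?q x * inverse y ^ (k + 2) * exp (- inverse y)"
      using True by (simp only: bump_fn_def y_def if_True divide_inverse power_inverse minus_mult_left[symmetric] mult_1 refl simp_thms)
    moreover have "poly ?q x = poly (pderiv p) x * y ^ 2 - real k * poly p x * y * (1 - 2 * x) + poly p x * (1 - 2 * x)"
      by (simp add: y_def algebra_simps power2_eq_square)
    ultimately show ?thesis by (simp only:)
  qed
  have "((\<lambda>t. poly p t * (inverse (t * (1 - t)) ^ k * exp (- inverse (t * (1 - t))))) has_real_derivative bump_fn ?q (k + 2) x) (at x)"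
    by (rule DERIV_cong[OF DERIV_mult[OF poly_DERIV[of p x] inverse_power_exp_DERIV[OF ds s, of k]]])
       (unfold hbq y_def[symmetric] y2, simp only: left_diff_distrib distrib_left distrib_right right_diff_distrib mult_ac)
  then show ?thesis
    by (rule DERIV_cong_ev[THEN iffD1, OF refl _ refl, rotated])
       (use True in \<open>auto simp: bump_fn_def field_simps eventually_nhds intro!: exI[of _ "{0<..<1}"]\<close>)
next
  case False
  obtain C where C: "\<And>t. 0 < t \<Longrightarrow> t < 1 \<Longrightarrow> \<bar>bump_fn p k t\<bar> \<le> C * (t * (1 - t))\<^sup>2"
    using bump_fn_bound by blast
  \<comment> \<open>For x outside the open interval, t (1 - t) is at most the distance from t to x,
    since it is at most t and at most 1 - t.\<close>
  have b: "\<bar>bump_fn p k t\<bar> \<le> \<bar>C\<bar> * \<bar>t - x\<bar>\<^sup>2" for t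
  proof (cases "0 < t \<and> t < 1")
    case True
    then have t: "0 < t" "t < 1" by auto
    have "t * (1 - t) \<le> t" "t * (1 - t) \<le> 1 - t" using t mult_right_mono[of t 1 "1-t"] mult_left_mono[of "1-t" 1 t] by auto
    then have "t * (1 - t) \<le> \<bar>t - x\<bar>" using False t by (smt (verit))
    then have "(t * (1 - t))\<^sup>2 \<le> \<bar>t - x\<bar>\<^sup>2" using t by (intro power_mono) auto
    then have "C * (t * (1 - t))\<^sup>2 \<le> \<bar>C\<bar> * \<bar>t - x\<bar>\<^sup>2" by (intro mult_mono) auto
    then show ?thesis using C[OF t] by linarith
  qed (auto simp: bump_fn_def)
  have "((\<lambda>t. (bump_fn p k t - bump_fn p k x) / (t - x)) \<longlongrightarrow> 0) (at x)"
  proof (rule Lim_null_comparison[where g="\<lambda>t. \<bar>C\<bar> * \<bar>t - x\<bar>"])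
    show "\<forall>\<^sub>F t in at x. norm ((bump_fn p k t - bump_fn p k x) / (t - x)) \<le> \<bar>C\<bar> * \<bar>t - x\<bar>"
    proof (unfold eventually_at_filter, intro always_eventually allI impI)
      fix t assume "t \<noteq> x"
      moreover have "bump_fn p k x = 0" using False by (auto simp: bump_fn_def)
      ultimately show "norm ((bump_fn p k t - bump_fn p k x) / (t - x)) \<le> \<bar>C\<bar> * \<bar>t - x\<bar>"
        using b[of t] by (simp add: abs_divide divide_le_eq power2_eq_square mult.assoc)
    qed
    show "((\<lambda>t. \<bar>C\<bar> * \<bar>t - x\<bar>) \<longlongrightarrow> 0) (at x)"
      by (auto intro!: tendsto_eq_intros)
  qed
  then have "(bump_fn p k has_real_derivative 0) (at x)" by (simp add: has_field_derivative_iff)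
  moreover have "bump_fn r j x = 0" for r j using False by (auto simp: bump_fn_def)
  ultimately show ?thesis by (simp only:)
qed

lemma test_fun_bump_fn: "test_fun (bump_fn p k)"
proof -
  define st where "st = rec_nat (p, k) (\<lambda>_ (p, k). (pderiv p * [:0,1,-1:]\<^sup>2 - smult (real k) (p * [:0,1,-1:] * [:1,-2:]) + p * [:1,-2:], k + 2))"
  show ?thesis
  proof (rule test_funI[of "\<lambda>n. bump_fn (fst (st n)) (snd (st n))" _ 1])
    show "(bump_fn (fst (st n)) (snd (st n)) has_real_derivative bump_fn (fst (st (Suc n))) (snd (st (Suc n))) x) (at x)" for n x
      using bump_fn_DERIV[of "fst (st n)" "snd (st n)" x] by (simp only: st_def nat.rec case_prod_unfold fst_conv snd_conv)
  qed (auto simp: st_def bump_fn_def)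
qed

lemma bump_exists: assumes "a < b"
  obtains \<psi> where "test_fun \<psi>" "\<And>t. 0 \<le> \<psi> t" "\<And>t. 0 < \<psi> t \<longleftrightarrow> a < t \<and> t < b"
proof -
  define \<psi> where "\<psi> t = bump_fn 1 0 (1 / (b - a) * t + (- a / (b - a)))" for t
  have e: "1 / (b - a) * t + (- a / (b - a)) = (t - a) / (b - a)" for t by (simp add: diff_divide_distrib)
  have "test_fun \<psi>" unfolding \<psi>_def using assms by (intro test_fun_affine test_fun_bump_fn) auto
  moreover have "0 \<le> \<psi> t" for t by (auto simp: \<psi>_def bump_fn_def)
  moreover have "0 < \<psi> t \<longleftrightarrow> a < t \<and> t < b" for t
    unfolding \<psi>_def e using assms by (auto simp: bump_fn_def field_simps)
  ultimately show thesis using that by blast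
qed

lemma test_fun_integrable: "test_fun f \<Longrightarrow> integrable lborel f"
  using test_fun_support[of f] test_fun_continuous[of f] by (metis integrable_continuous_compact_support real_norm_def)

lemma test_fun_times_continuous_integrable:
  "test_fun f \<Longrightarrow> continuous_on UNIV h \<Longrightarrow> integrable lborel (\<lambda>t. h t * f t)"
proof -
  assume a: "test_fun f" "continuous_on UNIV h"
  obtain R where "\<forall>t. R \<le> \<bar>t\<bar> \<longrightarrow> f t = 0" using test_fun_support[OF a(1)] by blast
  then show ?thesis using a test_fun_continuous[of f]
    by (intro integrable_continuous_compact_support[where R=R]) (auto intro!: continuous_intros)
qed

text \<open>A primitive is constant on either side of the support. Normalised to vanish on the left,
  it equals the integral of f on the right, which is 0.\<close>

lemma test_fun_antiderivative:
  assumes "test_fun f" "integral\<^sup>L lborel f = 0"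
  obtains g where "test_fun g" "deriv g = f"
proof -
  obtain F R where F: "F (0::nat) = f" "\<And>n x. (F n has_real_derivative F (Suc n) x) (at x)"
    "\<And>n t. R \<le> \<bar>t\<bar> \<Longrightarrow> F n t = 0" using test_funE[OF assms(1)] by metis
  define S where "S = \<bar>R\<bar> + 1"
  have S: "S > 0" "\<And>t. S \<le> \<bar>t\<bar> \<Longrightarrow> f t = 0" using F(1) F(3)[of _ 0] by (auto simp: S_def)
  define g where "g t = antideriv f t - antideriv f (- S)" for t
  have dg: "(g has_real_derivative f x) (at x)" for x
    unfolding g_def by (auto intro!: derivative_eq_intros antideriv_DERIV test_fun_continuous assms)
  have "(\<integral>x. f x * indicator {-S..S} x \<partial>lborel) = g S - g (-S)"
    using S(1) by (intro integral_FTC_Icc_real dg DERIV_isCont[OF test_fun_DERIV] assms(1)) auto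
  moreover have "(\<lambda>x. f x * indicator {-S..S} x) = f" 
  proof
    show "f x * indicator {-S..S} x = f x" for x using S(2)[of x] by (cases "S \<le> \<bar>x\<bar>") (auto simp: indicator_def)
  qed
  ultimately have gS: "g S = 0" "g (-S) = 0" using assms(2) by (auto simp: g_def)
  have z: "g t = 0" if "S \<le> \<bar>t\<bar>" for t
  proof (cases "t \<le> 0")
    case True
    then have "t = -S \<or> t < -S" using that by auto
    then show ?thesis
    proof
      assume "t < -S"
      then obtain z where "z < -S" "g (-S) - g t = (-S - t) * f z" using MVT2[of t "-S" g f] dg by blast
      then show ?thesis using gS S by auto
    qed (use gS in simp)
  next
    case False
    then have "t = S \<or> t > S" using that by auto
    then show ?thesis
    proof
      assume "S < t"
      then obtain z where "z > S" "g t - g S = (t - S) * f z" using MVT2[of S t g f] dg by blast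
      then show ?thesis using gS S by auto
    qed (use gS in simp)
  qed
  have "test_fun g"
    by (rule test_funI[of "\<lambda>n. case n of 0 \<Rightarrow> g | Suc k \<Rightarrow> F k" _ S]) (use dg F z in \<open>auto split: nat.split\<close>)
  moreover have "deriv g = f" using dg DERIV_imp_deriv by blast
  ultimately show thesis using that by blast
qed

lemma antideriv_by_parts: assumes "continuous_on UNIV f" "test_fun \<psi>"
  shows "(\<integral>t. f t * \<psi> t \<partial>lborel) = - (\<integral>t. antideriv f t * deriv \<psi> t \<partial>lborel)"
proof -
  obtain R where "\<forall>t. R \<le> \<bar>t\<bar> \<longrightarrow> \<psi> t = 0 \<and> deriv \<psi> t = 0" using test_fun_support[OF assms(2)] by blast
  then have "(\<integral>t. antideriv f t * deriv \<psi> t \<partial>lborel) = - (\<integral>t. f t * \<psi> t \<partial>lborel)"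
    by (intro integral_by_parts_real_line[where R=R] antideriv_DERIV assms test_fun_DERIV test_fun_continuous test_fun_deriv) auto
  then show ?thesis by simp
qed

lemma antideriv_by_parts_funpow: assumes "continuous_on UNIV f" "test_fun \<psi>"
  shows "(\<integral>t. f t * \<psi> t \<partial>lborel) = (-1) ^ k * (\<integral>t. (antideriv ^^ k) f t * (deriv ^^ k) \<psi> t \<partial>lborel)"
proof (induction k)
  case (Suc k)
  have "(\<integral>t. (antideriv ^^ k) f t * (deriv ^^ k) \<psi> t \<partial>lborel) =
     - (\<integral>t. (antideriv ^^ Suc k) f t * (deriv ^^ Suc k) \<psi> t \<partial>lborel)"
    using antideriv_by_parts[OF antideriv_funpow_continuous[OF assms(1)] test_fun_funpow[OF assms(2)], of k k] by simp
  then show ?case using Suc by simp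
qed simp

text \<open>A bump supported where h keeps the sign it has at a makes the integral of h times the
  bump, multiplied by h a, positive.\<close>

lemma test_fun_orthogonal_zero:
  assumes c: "continuous_on UNIV h" and o: "\<And>\<psi>. test_fun \<psi> \<Longrightarrow> (\<integral>t. h t * \<psi> t \<partial>lborel) = 0"
  shows "h a = 0"
proof (rule ccontr)
  assume h: "h a \<noteq> 0"
  have "isCont h a" using c by (simp add: continuous_on_eq_continuous_at)
  then obtain d where d: "d > 0" "\<And>x. dist x a < d \<Longrightarrow> dist (h x) (h a) < \<bar>h a\<bar>"
    using h unfolding continuous_at_eps_delta by (metis zero_less_abs_iff)
  obtain \<psi> where \<psi>: "test_fun \<psi>" "\<And>t. 0 \<le> \<psi> t" "\<And>t. 0 < \<psi> t \<longleftrightarrow> a - d < t \<and> t < a + d"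
    using bump_exists[of "a - d" "a + d"] d by auto
  have "0 < integral\<^sup>L lborel (\<lambda>t. h a * (h t * \<psi> t))"
  proof (rule integral_pos_continuous[where a=a])
    show "continuous_on UNIV (\<lambda>t. h a * (h t * \<psi> t))" by (intro continuous_intros c test_fun_continuous \<psi>)
    show "integrable lborel (\<lambda>t. h a * (h t * \<psi> t))"
      by (intro integrable_mult_right test_fun_times_continuous_integrable c \<psi>)
    show "0 < h a * (h a * \<psi> a)" using \<psi>(3)[of a] d h by (auto simp: mult.assoc[symmetric] zero_less_mult_iff)
    show "0 \<le> h a * (h x * \<psi> x)" for x
    proof (cases "dist x a < d")
      case True
      then have "0 \<le> h a * h x" using d(2)[of x] by (auto simp: dist_real_def abs_if zero_le_mult_iff split: if_splits)
      then show ?thesis using \<psi>(2)[of x] by (simp add: mult.assoc[symmetric])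
    next
      case False
      then have "\<psi> x = 0" using \<psi>(2)[of x] \<psi>(3)[of x] by (auto simp: dist_real_def abs_if split: if_splits)
      then show ?thesis by simp
    qed
  qed
  then show False using o[OF \<psi>(1)] by simp
qed

text \<open>A chain of derivatives ending in 0 says that h is a polynomial of degree below k, in the
  form in which the regularity argument differentiates it. The induction splits a test function into
  a multiple of a fixed bump of integral 1 and a derivative of a test function.\<close>

lemma du_Bois_Reymond:
  assumes "continuous_on UNIV h" "\<And>\<psi>. test_fun \<psi> \<Longrightarrow> (\<integral>t. h t * (deriv ^^ k) \<psi> t \<partial>lborel) = 0"
  shows "\<exists>P. P 0 = h \<and> (\<forall>n<k. \<forall>t. (P n has_real_derivative P (Suc n) t) (at t)) \<and> P k = (\<lambda>_. 0)"
  using assms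
proof (induction k arbitrary: h)
  case 0
  have "h t = 0" for t by (rule test_fun_orthogonal_zero[OF 0(1)]) (use 0(2) in simp)
  then have "h = (\<lambda>_. 0)" by blast
  then show ?case by (intro exI[of _ "\<lambda>_. h"]) simp
next
  case (Suc k)
  obtain \<rho>0 where \<rho>0: "test_fun \<rho>0" "\<And>t. 0 \<le> \<rho>0 t" "\<And>t. 0 < \<rho>0 t \<longleftrightarrow> 0 < t \<and> t < 1"
    using bump_exists[of 0 1] by auto
  have pos: "0 < integral\<^sup>L lborel \<rho>0"
    by (rule integral_pos_continuous[where a="1/2"]) (use \<rho>0 in \<open>auto intro: test_fun_continuous test_fun_integrable\<close>)
  define \<rho> where "\<rho> t = \<rho>0 t / integral\<^sup>L lborel \<rho>0" for t
  have \<rho>: "test_fun \<rho>" "integral\<^sup>L lborel \<rho> = 1"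
    using test_fun_cmult[OF \<rho>0(1), of "1 / integral\<^sup>L lborel \<rho>0"] pos by (auto simp: \<rho>_def[abs_def])
  \<comment> \<open>\<open>J\<close> is a k-fold primitive of 1, so integrating it against the k-th
    derivative of \<psi> gives (-1)^k times the integral of \<psi>. Subtracting c (-1)^k J from h
    removes exactly what h sees of the mean of \<psi>.\<close>
  define c where "c = (\<integral>t. h t * (deriv ^^ k) \<rho> t \<partial>lborel)"
  define J where "J = (antideriv ^^ k) (\<lambda>_. 1)"
  have cJ: "continuous_on UNIV J" unfolding J_def by (intro antideriv_funpow_continuous) auto
  have int: "integrable lborel (\<lambda>t. g t * (deriv ^^ k) \<psi> t)" if "test_fun \<psi>" "continuous_on UNIV g" for g \<psi>
    using that by (intro test_fun_times_continuous_integrable test_fun_funpow)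
  have "(\<integral>t. (h t - c * (-1) ^ k * J t) * (deriv ^^ k) \<psi> t \<partial>lborel) = 0" if \<psi>: "test_fun \<psi>" for \<psi>
  proof -
    define b where "b = integral\<^sup>L lborel \<psi>"
    \<comment> \<open>This difference has mean zero, hence is the derivative of a test function g.
      The hypothesis of order k + 1 for g becomes a statement of order k about \<psi>.\<close>
    have t: "test_fun (\<lambda>t. 1 * \<psi> t + (- b) * \<rho> t)" by (intro test_fun_linear \<psi> \<rho>)
    have "(\<integral>t. 1 * \<psi> t + (- b) * \<rho> t \<partial>lborel) = 0"
      using test_fun_integrable[OF \<psi>] test_fun_integrable[OF \<rho>(1)] \<rho>(2) by (simp add: b_def)
    then obtain g where g: "test_fun g" "deriv g = (\<lambda>t. 1 * \<psi> t + (- b) * \<rho> t)"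
      using test_fun_antiderivative[OF t] by blast
    have "(\<integral>t. h t * (deriv ^^ Suc k) g t \<partial>lborel) = 0" by (rule Suc(3)[OF g(1)])
    then have "(\<integral>t. h t * ((deriv ^^ k) \<psi> t - b * (deriv ^^ k) \<rho> t) \<partial>lborel) = 0"
      using deriv_funpow_linear[OF \<psi> \<rho>(1), of k 1 "-b"] by (simp add: g(2) funpow_Suc_right del: funpow.simps(2))
    moreover have "(\<integral>t. h t * ((deriv ^^ k) \<psi> t - b * (deriv ^^ k) \<rho> t) \<partial>lborel)
       = (\<integral>t. h t * (deriv ^^ k) \<psi> t - b * (h t * (deriv ^^ k) \<rho> t) \<partial>lborel)"
      by (simp add: right_diff_distrib mult.left_commute)
    moreover have "\<dots> = (\<integral>t. h t * (deriv ^^ k) \<psi> t \<partial>lborel) - b * c"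
      using int[OF \<psi> Suc(2)] int[OF \<rho>(1) Suc(2)] by (simp add: c_def)
    ultimately have 1: "(\<integral>t. h t * (deriv ^^ k) \<psi> t \<partial>lborel) = b * c" by simp
    have 2: "b = (-1) ^ k * (\<integral>t. J t * (deriv ^^ k) \<psi> t \<partial>lborel)"
      using antideriv_by_parts_funpow[of "\<lambda>_. 1" \<psi> k] \<psi> by (simp add: b_def J_def)
    have "(\<integral>t. (h t - c * (-1) ^ k * J t) * (deriv ^^ k) \<psi> t \<partial>lborel)
       = (\<integral>t. h t * (deriv ^^ k) \<psi> t - (c * (-1) ^ k) * (J t * (deriv ^^ k) \<psi> t) \<partial>lborel)"
      by (simp add: left_diff_distrib mult.assoc)
    also have "\<dots> = b * c - c * (-1) ^ k * (\<integral>t. J t * (deriv ^^ k) \<psi> t \<partial>lborel)"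
      using int[OF \<psi> Suc(2)] int[OF \<psi> cJ] 1 by simp
    also have "\<dots> = 0" by (subst 2) (simp add: mult.commute mult.left_commute)
    finally show ?thesis .
  qed
  moreover have "continuous_on UNIV (\<lambda>t. h t - c * (-1) ^ k * J t)" by (intro continuous_intros Suc cJ)
  ultimately obtain P where P: "P 0 = (\<lambda>t. h t - c * (-1) ^ k * J t)"
     "\<forall>n<k. \<forall>t. (P n has_real_derivative P (Suc n) t) (at t)" "P k = (\<lambda>_. 0)"
    using Suc(1) by blast
  \<comment> \<open>The subtracted term is added back. Its k-th derivative is the constant c (-1)^k,
    so the chain needs one more entry before it reaches 0.\<close>
  define Q where "Q n t = (if n \<le> k then P n t + c * (-1) ^ k * (antideriv ^^ (k - n)) (\<lambda>_. 1) t else 0)" for n t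
  have "Q 0 = h" by (auto simp: Q_def P J_def)
  moreover have "Q (Suc k) = (\<lambda>_. 0)" by (auto simp: Q_def)
  moreover have "(Q n has_real_derivative Q (Suc n) t) (at t)" if "n < Suc k" for n t
  proof (cases "n = k")
    case True then show ?thesis using P(3) by (auto simp: Q_def[abs_def])
  next
    case False
    then have n: "n < k" using that by simp
    then have e: "k - n = Suc (k - Suc n)" by simp
    have "((antideriv ^^ (k - n)) (\<lambda>_. 1) has_real_derivative (antideriv ^^ (k - Suc n)) (\<lambda>_. 1) t) (at t)"
      unfolding e by (simp, intro antideriv_DERIV antideriv_funpow_continuous) auto
    then show ?thesis using n P(2) by (auto simp: Q_def[abs_def] intro!: derivative_eq_intros)
  qed
  ultimately show ?case by blast
qed

section \<open>The fourth-order equation on the line\<close>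

text \<open>The hypothesis is the equation of w = W' tested against \<psi> and integrated by parts
  once, hence five derivatives on \<psi>. Primitives move all terms onto the fifth derivative; du
  Bois-Reymond then makes W a polynomial plus primitives of continuous functions, and each
  differentiation feeds the gained regularity back in.\<close>

lemma weak_ode_regularity:
  assumes cW: "continuous_on UNIV W" and dV: "\<And>t. (V has_real_derivative V' t) (at t)" and cV': "continuous_on UNIV V'"
    and weak: "\<And>\<psi>. test_fun \<psi> \<Longrightarrow> (\<integral>t. W t * ((deriv ^^ 5) \<psi> t - a * (deriv ^^ 3) \<psi> t + b * deriv \<psi> t
         - (V t * deriv \<psi> t + V' t * \<psi> t)) \<partial>lborel) = 0"
  obtains w0 w1 w2 w3 where "\<And>t. (W has_real_derivative w0 t) (at t)" "\<And>t. (w0 has_real_derivative w1 t) (at t)"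
    "\<And>t. (w1 has_real_derivative w2 t) (at t)" "\<And>t. (w2 has_real_derivative w3 t) (at t)"
    "\<And>t. (w3 has_real_derivative a * w2 t - b * w0 t + V t * w0 t) (at t)"
proof -
  have cV: "continuous_on UNIV V" using DERIV_isCont[OF dV] by (auto intro!: continuous_at_imp_continuous_on)
  define X where "X t = V t * W t" for t
  define Y where "Y t = V' t * W t" for t
  have cX: "continuous_on UNIV X" and cY: "continuous_on UNIV Y"
    unfolding X_def Y_def by (intro continuous_intros cV cV' cW)+
  let ?I = antideriv
  \<comment> \<open>The number of primitives in a term is 5 minus the order of the derivative on
    \<psi> there. Only the Y term crosses an odd number of integrations by parts, which flips its
    sign.\<close>
  define H where "H t = W t - a * ?I (?I W) t + b * ?I (?I (?I (?I W))) t - ?I (?I (?I (?I X))) t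
     + ?I (?I (?I (?I (?I Y)))) t" for t
  note cI = antideriv_continuous
  have cH: "continuous_on UNIV H" unfolding H_def
    by (intro continuous_intros cI cW cX cY)
  have "(\<integral>t. H t * (deriv ^^ 5) \<psi> t \<partial>lborel) = 0" if \<psi>: "test_fun \<psi>" for \<psi>
  proof -
    note d = test_fun_funpow[OF \<psi>]
    have e2: "(\<integral>t. W t * (deriv ^^ 3) \<psi> t \<partial>lborel) = (\<integral>t. ?I (?I W) t * (deriv ^^ 5) \<psi> t \<partial>lborel)"
      using antideriv_by_parts_funpow[OF cW d[of 3], of 2] by (simp add: numeral_eq_Suc)
    have e4: "(\<integral>t. W t * deriv \<psi> t \<partial>lborel) = (\<integral>t. ?I (?I (?I (?I W))) t * (deriv ^^ 5) \<psi> t \<partial>lborel)"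
      using antideriv_by_parts_funpow[OF cW d[of 1], of 4] by (simp add: numeral_eq_Suc)
    have eX: "(\<integral>t. X t * deriv \<psi> t \<partial>lborel) = (\<integral>t. ?I (?I (?I (?I X))) t * (deriv ^^ 5) \<psi> t \<partial>lborel)"
      using antideriv_by_parts_funpow[OF cX d[of 1], of 4] by (simp add: numeral_eq_Suc)
    have eY: "(\<integral>t. Y t * \<psi> t \<partial>lborel) = - (\<integral>t. ?I (?I (?I (?I (?I Y)))) t * (deriv ^^ 5) \<psi> t \<partial>lborel)"
      using antideriv_by_parts_funpow[OF cY \<psi>, of 5] by (simp add: numeral_eq_Suc)
    note i = test_fun_times_continuous_integrable[OF d] test_fun_times_continuous_integrable[OF test_fun_deriv[OF \<psi>]] test_fun_times_continuous_integrable[OF \<psi>]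
    have "(\<integral>t. H t * (deriv ^^ 5) \<psi> t \<partial>lborel) = (\<integral>t. W t * (deriv ^^ 5) \<psi> t - a * (?I (?I W) t * (deriv ^^ 5) \<psi> t)
        + b * (?I (?I (?I (?I W))) t * (deriv ^^ 5) \<psi> t) - ?I (?I (?I (?I X))) t * (deriv ^^ 5) \<psi> t
        + ?I (?I (?I (?I (?I Y)))) t * (deriv ^^ 5) \<psi> t \<partial>lborel)"
      by (intro Bochner_Integration.integral_cong refl) (simp add: H_def distrib_right left_diff_distrib del: funpow.simps)
    also have "\<dots> = (\<integral>t. W t * (deriv ^^ 5) \<psi> t \<partial>lborel) - a * (\<integral>t. W t * (deriv ^^ 3) \<psi> t \<partial>lborel)
        + b * (\<integral>t. W t * deriv \<psi> t \<partial>lborel) - (\<integral>t. X t * deriv \<psi> t \<partial>lborel) - (\<integral>t. Y t * \<psi> t \<partial>lborel)"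
      unfolding e2 e4 eX eY by (simp add: i cI cW cX cY)
    also have "\<dots> = (\<integral>t. W t * (deriv ^^ 5) \<psi> t - a * (W t * (deriv ^^ 3) \<psi> t)
        + b * (W t * deriv \<psi> t) - X t * deriv \<psi> t - Y t * \<psi> t \<partial>lborel)"
      by (simp add: i cI cW cX cY)
    also have "\<dots> = (\<integral>t. W t * ((deriv ^^ 5) \<psi> t - a * (deriv ^^ 3) \<psi> t + b * deriv \<psi> t
         - (V t * deriv \<psi> t + V' t * \<psi> t)) \<partial>lborel)"
      by (intro Bochner_Integration.integral_cong refl) (simp add: X_def Y_def algebra_simps del: funpow.simps)
    also have "\<dots> = 0" by (rule weak[OF \<psi>])
    finally show ?thesis .
  qed
  then obtain P where P: "P 0 = H" "\<And>n t. n < 5 \<Longrightarrow> (P n has_real_derivative P (Suc n) t) (at t)" "P 5 = (\<lambda>_. 0)"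
    using du_Bois_Reymond[OF cH, of 5] by blast
  have dP: "(P 0 has_real_derivative P 1 t) (at t)" "(P 1 has_real_derivative P 2 t) (at t)"
    "(P 2 has_real_derivative P 3 t) (at t)" "(P 3 has_real_derivative P 4 t) (at t)" "(P 4 has_real_derivative 0) (at t)" for t
    using P(2)[of 0 t] P(2)[of 1 t] P(2)[of 2 t] P(2)[of 3 t] P(2)[of 4 t] P(3) by (simp_all add: numeral_eq_Suc)
  have W: "W = (\<lambda>t. P 0 t + a * ?I (?I W) t - b * ?I (?I (?I (?I W))) t + ?I (?I (?I (?I X))) t
     - ?I (?I (?I (?I (?I Y)))) t)" by (simp add: P(1) H_def)
  \<comment> \<open>These are the formal derivatives of the right-hand side for W. A primitive of W
    that has been differentiated away is replaced by W itself, later by w0 and w1.\<close>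
  define w0 where "w0 t = P 1 t + a * ?I W t - b * ?I (?I (?I W)) t + ?I (?I (?I X)) t - ?I (?I (?I (?I Y))) t" for t
  define w1 where "w1 t = P 2 t + a * W t - b * ?I (?I W) t + ?I (?I X) t - ?I (?I (?I Y)) t" for t
  define w2 where "w2 t = P 3 t + a * w0 t - b * ?I W t + ?I X t - ?I (?I Y) t" for t
  define w3 where "w3 t = P 4 t + a * w1 t - b * W t + X t - ?I Y t" for t
  note dI = antideriv_DERIV
  have d0: "(W has_real_derivative w0 t) (at t)" for t
    by (subst W, unfold w0_def) (rule derivative_eq_intros dP dI cI cW cX cY refl | simp)+
  have d1: "(w0 has_real_derivative w1 t) (at t)" for t
    unfolding w0_def[abs_def] w1_def by (rule derivative_eq_intros dP dI cI cW cX cY refl | simp)+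
  have d2: "(w1 has_real_derivative w2 t) (at t)" for t
    unfolding w1_def[abs_def] w2_def by (rule derivative_eq_intros dP dI d0 cI cW cX cY refl | simp)+
  have d3: "(w2 has_real_derivative w3 t) (at t)" for t
    unfolding w2_def[abs_def] w3_def by (rule derivative_eq_intros dP dI d1 cI cW cX cY refl | simp)+
  have dX: "(X has_real_derivative V' t * W t + V t * w0 t) (at t)" for t
    unfolding X_def[abs_def] by (rule derivative_eq_intros dV d0 refl | simp)+
  \<comment> \<open>The term Y = V' W cancels against the product rule for X = V W and leaves V
    w0.\<close>
  have d4: "(w3 has_real_derivative a * w2 t - b * w0 t + V t * w0 t) (at t)" for t
    unfolding w3_def[abs_def] by (rule derivative_eq_intros dP dI d2 d0 dX cI cW cX cY refl | simp add: Y_def)+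
  show thesis by (rule that[OF d0 d1 d2 d3 d4])
qed

section \<open>Interior estimates for the derivatives of a solution\<close>

lemma mvt_bound:
  fixes f :: "real \<Rightarrow> real"
  assumes "\<And>t. (f has_real_derivative f' t) (at t)" "\<And>t. t \<in> {a..b} \<Longrightarrow> \<bar>f' t\<bar> \<le> M" "x \<in> {a..b}" "y \<in> {a..b}"
  shows "\<bar>f x - f y\<bar> \<le> M * \<bar>x - y\<bar>"
  using field_differentiable_bound[of "{a..b}" f f' M x y] assms by (auto intro: DERIV_subset)

text \<open>Iterated mean value theorem: two points in the outer thirds of the interval at which the
  j-th derivative is small are at least l/3 apart, so the next derivative is small somewhere between
  them. The constant is fixed before the functions and the interval.\<close>

lemma small_derivative_point:
  fixes j :: nat
  shows "\<exists>C>0. \<forall>F a l \<delta>. 0 < l \<longrightarrow> (\<forall>n t. n < j \<longrightarrow> (F n has_real_derivative F (Suc n) t) (at t)) \<longrightarrow>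
     (\<forall>t\<in>{a..a+l::real}. \<bar>F 0 t\<bar> \<le> \<delta>) \<longrightarrow> (\<exists>\<xi>\<in>{a..a+l}. \<bar>F j \<xi> :: real\<bar> \<le> C * \<delta> / l ^ j)"
proof (induction j)
  case 0
  show ?case by (rule exI[of _ 1]) force
next
  case (Suc j)
  then obtain C where C: "C > 0" and IH: "\<And>F a l \<delta>. 0 < l \<Longrightarrow> (\<forall>n t. n < j \<longrightarrow> (F n has_real_derivative F (Suc n) t) (at t)) \<Longrightarrow>
     (\<forall>t\<in>{a..a+l::real}. \<bar>F 0 t\<bar> \<le> \<delta>) \<Longrightarrow> (\<exists>\<xi>\<in>{a..a+l}. \<bar>F j \<xi> :: real\<bar> \<le> C * \<delta> / l ^ j)" by blast
  show ?case
  proof (intro exI[of _ "2 * 3 ^ Suc j * C"] conjI allI impI)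
    fix F :: "nat \<Rightarrow> real \<Rightarrow> real" and a l \<delta>
    assume l: "0 < (l::real)" and F: "\<forall>n t. n < Suc j \<longrightarrow> (F n has_real_derivative F (Suc n) t) (at t)"
      and \<delta>: "\<forall>t\<in>{a..a+l}. \<bar>F 0 t\<bar> \<le> \<delta>"
    obtain x where x: "x \<in> {a..a+l/3}" "\<bar>F j x\<bar> \<le> C * \<delta> / (l/3) ^ j"
      using IH[of "l/3" F a \<delta>] l F \<delta> by force
    obtain y where y: "y \<in> {a+2*l/3..a+2*l/3+l/3}" "\<bar>F j y\<bar> \<le> C * \<delta> / (l/3) ^ j"
      using IH[of "l/3" F "a+2*l/3" \<delta>] l F \<delta> by force
    have xy: "x < y" "l/3 \<le> y - x" using x y l by auto
    obtain z where z: "x < z" "z < y" "F j y - F j x = (y - x) * F (Suc j) z"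
      using MVT2[OF xy(1), of "F j" "F (Suc j)"] F by blast
    have "(l/3) * \<bar>F (Suc j) z\<bar> \<le> (y - x) * \<bar>F (Suc j) z\<bar>" using xy by (intro mult_right_mono) auto
    also have "\<dots> = \<bar>F j y - F j x\<bar>" using z(3) xy by (simp add: abs_mult)
    also have "\<dots> \<le> 2 * (C * \<delta> / (l/3) ^ j)" using x y by linarith
    finally have "(l/3) * \<bar>F (Suc j) z\<bar> \<le> 2 * (C * \<delta> / (l/3) ^ j)" .
    moreover have "0 < l / 3" using l by simp
    ultimately have "\<bar>F (Suc j) z\<bar> \<le> 2 * (C * \<delta> / (l/3) ^ j) / (l / 3)" by (metis pos_le_divide_eq mult.commute)
    also have "\<dots> = 2 * 3 ^ Suc j * C * \<delta> / l ^ Suc j" using l by (simp add: field_simps power_divide)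
    finally show "\<exists>\<xi>\<in>{a..a+l}. \<bar>F (Suc j) \<xi>\<bar> \<le> 2 * 3 ^ Suc j * C * \<delta> / l ^ Suc j"
      using z x y by (intro bexI[of _ z]) auto
  qed (use C in auto)
qed

text \<open>The constant is chosen before the functions and the point, so it is uniform in t and
  transfers vanishing oscillation of W to decay of its derivatives. Each derivative is small
  somewhere in an interval of length h and changes there by at most h times the maximum of the next
  one; the equation bounds the last one by earlier ones.\<close>

lemma ode_interior_bound:
  assumes "0 \<le> K"
  obtains C where "0 < C"
    "\<And>W w0 w1 w2 w3 w4 t \<delta>. (\<And>t. (W has_real_derivative w0 t) (at t)) \<Longrightarrow> (\<And>t. (w0 has_real_derivative w1 t) (at t)) \<Longrightarrow>
    (\<And>t. (w1 has_real_derivative w2 t) (at t)) \<Longrightarrow> (\<And>t. (w2 has_real_derivative w3 t) (at t)) \<Longrightarrow>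
    (\<And>t. (w3 has_real_derivative w4 t) (at t)) \<Longrightarrow> (\<And>t. \<bar>w4 t\<bar> \<le> K * (\<bar>w0 t\<bar> + \<bar>w2 t\<bar>)) \<Longrightarrow>
    (\<And>s. s \<in> {t..t+1} \<Longrightarrow> \<bar>W s - W t\<bar> \<le> \<delta>) \<Longrightarrow>
     \<bar>w0 t\<bar> \<le> C * \<delta> \<and> \<bar>w1 t\<bar> \<le> C * \<delta> \<and> \<bar>w2 t\<bar> \<le> C * \<delta> \<and> \<bar>w3 t\<bar> \<le> C * (\<delta>::real)"
proof -
  \<comment> \<open>With h (1 + K) = 1/2, the increments add up to at most half the sum of the four
    maxima and are absorbed.\<close>
  define h where "h = 1 / (2 * (1 + K))"
  have h: "0 < h" "h \<le> 1" "h * (1 + K) = 1 / 2" using assms by (auto simp: h_def field_simps)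
  obtain Cj where Cj: "\<And>j. Cj j > (0::real)" "\<And>j F a l \<delta>. 0 < l \<Longrightarrow> (\<forall>n t. n < (j::nat) \<longrightarrow> (F n has_real_derivative F (Suc n) t) (at t)) \<Longrightarrow>
     (\<forall>t\<in>{a..a+l::real}. \<bar>F 0 t\<bar> \<le> \<delta>) \<Longrightarrow> (\<exists>\<xi>\<in>{a..a+l}. \<bar>F j \<xi> :: real\<bar> \<le> Cj j * \<delta> / l ^ j)"
    using small_derivative_point by metis
  define c where "c = (\<Sum>j\<in>{1..4::nat}. Cj j / h ^ j)"
  have cj: "Cj j / h ^ j \<le> c" if "j \<in> {1..4}" for j
    unfolding c_def using that Cj(1) h by (intro member_le_sum) (auto intro: less_imp_le)
  have c0: "0 < c" unfolding c_def using Cj(1) h by (intro sum_pos) auto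
  show thesis
  proof (rule that[of "8 * c"])
    fix W w0 w1 w2 w3 w4 :: "real \<Rightarrow> real" and t \<delta> :: real
    assume d: "\<And>t. (W has_real_derivative w0 t) (at t)" "\<And>t. (w0 has_real_derivative w1 t) (at t)"
    "\<And>t. (w1 has_real_derivative w2 t) (at t)" "\<And>t. (w2 has_real_derivative w3 t) (at t)"
    "\<And>t. (w3 has_real_derivative w4 t) (at t)" and b: "\<And>t. \<bar>w4 t\<bar> \<le> K * (\<bar>w0 t\<bar> + \<bar>w2 t\<bar>)"
      and o: "\<And>s. s \<in> {t..t+1} \<Longrightarrow> \<bar>W s - W t\<bar> \<le> \<delta>"
    \<comment> \<open>Subtracting \<open>W t\<close> turns the oscillation into a bound on the
      function; w0, ..., w3 are its derivatives of order 1 to 4.\<close>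
    define F where "F n = (case n of 0 \<Rightarrow> (\<lambda>s. W s - W t) | Suc 0 \<Rightarrow> w0 | Suc (Suc 0) \<Rightarrow> w1 | Suc (Suc (Suc 0)) \<Rightarrow> w2 | _ \<Rightarrow> w3)" for n :: nat
    have F: "F 0 = (\<lambda>s. W s - W t)" "F 1 = w0" "F 2 = w1" "F 3 = w2" "F 4 = w3"
      by (simp_all add: F_def numeral_eq_Suc)
    have dF: "(F n has_real_derivative F (Suc n) s) (at s)" if "n < 4" for n s
    proof -
      have "n = 0 \<or> n = 1 \<or> n = 2 \<or> n = 3" using that by auto
      moreover have "((\<lambda>s. W s - W t) has_real_derivative w0 s) (at s)" using d(1) by (auto intro!: derivative_eq_intros)
      ultimately show ?thesis using d(2-4)[of s] by (auto simp: F_def numeral_eq_Suc)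
    qed
    have \<delta>: "0 \<le> \<delta>" using o[of t] by auto
    have pt: "\<exists>\<xi>\<in>{t..t+h}. \<bar>F j \<xi>\<bar> \<le> c * \<delta>" if j: "j \<in> {1..4}" for j
    proof -
      have "\<exists>\<xi>\<in>{t..t+h}. \<bar>F j \<xi>\<bar> \<le> Cj j * \<delta> / h ^ j"
        using j h(2) by (intro Cj(2)[OF h(1)]) (auto simp: F(1) intro!: dF o)
      moreover have "Cj j * \<delta> / h ^ j \<le> c * \<delta>" using mult_right_mono[OF cj[OF j] \<delta>] by simp
      ultimately show ?thesis by (meson order_trans)
    qed
    have mx: "\<exists>x\<in>{t..t+h}. \<forall>y\<in>{t..t+h}. \<bar>f y\<bar> \<le> \<bar>f x\<bar>" if "\<And>t. (f has_real_derivative f' t) (at t)" for f f' :: "real \<Rightarrow> real"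
      using h DERIV_isCont[OF that] by (intro continuous_attains_sup) (auto intro!: continuous_at_imp_continuous_on continuous_intros)
    obtain M0 where M0: "\<And>y. y \<in> {t..t+h} \<Longrightarrow> \<bar>w0 y\<bar> \<le> M0" "\<exists>x\<in>{t..t+h}. M0 = \<bar>w0 x\<bar>" using mx[OF d(2)] by blast
    obtain M1 where M1: "\<And>y. y \<in> {t..t+h} \<Longrightarrow> \<bar>w1 y\<bar> \<le> M1" "\<exists>x\<in>{t..t+h}. M1 = \<bar>w1 x\<bar>" using mx[OF d(3)] by blast
    obtain M2 where M2: "\<And>y. y \<in> {t..t+h} \<Longrightarrow> \<bar>w2 y\<bar> \<le> M2" "\<exists>x\<in>{t..t+h}. M2 = \<bar>w2 x\<bar>" using mx[OF d(4)] by blast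
    obtain M3 where M3: "\<And>y. y \<in> {t..t+h} \<Longrightarrow> \<bar>w3 y\<bar> \<le> M3" "\<exists>x\<in>{t..t+h}. M3 = \<bar>w3 x\<bar>" using mx[OF d(5)] by blast
    have step: "M \<le> c * \<delta> + h * M'" if st: "\<And>t. (f has_real_derivative f' t) (at t)" "\<And>y. y \<in> {t..t+h} \<Longrightarrow> \<bar>f' y\<bar> \<le> M'"
       "\<exists>x\<in>{t..t+h}. M = \<bar>f x\<bar>" "\<exists>\<xi>\<in>{t..t+h}. \<bar>f \<xi>\<bar> \<le> c * \<delta>" for f f' M M'
    proof -
      obtain x \<xi> where x: "x \<in> {t..t+h}" "M = \<bar>f x\<bar>" "\<xi> \<in> {t..t+h}" "\<bar>f \<xi>\<bar> \<le> c * \<delta>" using st(3,4) by blast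
      have "\<bar>f x - f \<xi>\<bar> \<le> M' * \<bar>x - \<xi>\<bar>" by (rule mvt_bound[OF st(1,2) x(1,3)])
      also have "\<dots> \<le> M' * h" using x st(2)[of t] h by (intro mult_left_mono) auto
      finally show ?thesis using x by (simp add: mult.commute) 
    qed
    have "\<bar>w4 y\<bar> \<le> K * (M0 + M2)" if "y \<in> {t..t+h}" for y
      using b[of y] mult_left_mono[OF add_mono[OF M0(1)[OF that] M2(1)[OF that]] assms] by linarith
    then have s3: "M3 \<le> c * \<delta> + h * (K * (M0 + M2))" using pt[of 4, unfolded F] by (intro step[OF d(5) _ M3(2)]) (auto simp: F)
    have s2: "M2 \<le> c * \<delta> + h * M3" using pt[of 3, unfolded F] by (intro step[OF d(4) M3(1) M2(2)]) (auto simp: F)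
    have s1: "M1 \<le> c * \<delta> + h * M2" using pt[of 2, unfolded F] by (intro step[OF d(3) M2(1) M1(2)]) (auto simp: F)
    have s0: "M0 \<le> c * \<delta> + h * M1" using pt[of 1, unfolded F] by (intro step[OF d(2) M1(1) M0(2)]) (auto simp: F)
    have nn: "0 \<le> M0" "0 \<le> M1" "0 \<le> M2" "0 \<le> M3" using M0(2) M1(2) M2(2) M3(2) by auto
    have "h * M1 + h * M2 + h * M3 + h * (K * (M0 + M2)) \<le> (h * (1 + K)) * (M0 + M1 + M2 + M3)"
      using h(1) assms nn by (simp add: algebra_simps)
    then have hM: "2 * (h * M1 + h * M2 + h * M3 + h * (K * (M0 + M2))) \<le> M0 + M1 + M2 + M3" unfolding h(3) by simp
    define x where "x = h * M1 + h * M2 + h * M3 + h * (K * (M0 + M2))"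
    have "M0 + M1 + M2 + M3 \<le> 4 * (c * \<delta>) + x" unfolding x_def using add_mono[OF add_mono[OF s0 s1] add_mono[OF s2 s3]] by (simp add: algebra_simps)
    then have "M0 + M1 + M2 + M3 \<le> 8 * (c * \<delta>)" using hM[folded x_def] by simp
    then show "\<bar>w0 t\<bar> \<le> 8 * c * \<delta> \<and> \<bar>w1 t\<bar> \<le> 8 * c * \<delta> \<and> \<bar>w2 t\<bar> \<le> 8 * c * \<delta> \<and> \<bar>w3 t\<bar> \<le> 8 * c * \<delta>"
      using M0(1)[of t] M1(1)[of t] M2(1)[of t] M3(1)[of t] nn h(1) by auto
  qed (use c0 in auto)
qed

text \<open>This replaces integrating an energy density over the line: when the boundary terms J
  tend to 0 at both ends, a nonnegative density vanishes, with no integrability to check.\<close>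

lemma monotone_vanishing:
  fixes J :: "real \<Rightarrow> real"
  assumes d: "\<And>t. (J has_real_derivative J' t) (at t)" and nn: "\<And>t. 0 \<le> J' t" and lim: "(J \<longlongrightarrow> 0) at_infinity"
  shows "J t = 0" "J' t = 0"
proof -
  have mono: "J x \<le> J y" if "x \<le> y" for x y using DERIV_nonneg_imp_nondecreasing[OF that] d nn by blast
  have top: "(J \<longlongrightarrow> 0) at_top" and bot: "(J \<longlongrightarrow> 0) at_bot"
    using tendsto_mono[OF at_top_le_at_infinity lim] tendsto_mono[OF at_bot_le_at_infinity lim] by auto
  have z: "J t = 0" for t
  proof (rule antisym)
    show "J t \<le> 0" by (rule tendsto_lowerbound[OF top]) (auto simp: eventually_at_top_linorder intro!: exI[of _ t] mono)
    show "0 \<le> J t" by (rule tendsto_upperbound[OF bot]) (auto simp: eventually_at_bot_linorder intro!: exI[of _ t] mono)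
  qed
  then show "J t = 0" .
  have "J = (\<lambda>_. 0)" using z by blast
  then show "J' t = 0" using d[of t] DERIV_unique DERIV_const by metis
qed

lemma tendsto_bounded_times_zero:
  fixes f c :: "real \<Rightarrow> real"
  assumes "(f \<longlongrightarrow> 0) F" "\<And>t. \<bar>c t\<bar> \<le> C"
  shows "((\<lambda>t. c t * f t) \<longlongrightarrow> 0) F"
proof (rule Lim_null_comparison[where g="\<lambda>t. C * \<bar>f t\<bar>"])
  show "\<forall>\<^sub>F t in F. norm (c t * f t) \<le> C * \<bar>f t\<bar>"
    by (auto simp: abs_mult intro!: always_eventually mult_right_mono assms(2))
  show "((\<lambda>t. C * \<bar>f t\<bar>) \<longlongrightarrow> 0) F" using assms(1) by (auto intro!: tendsto_eq_intros)
qed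

lemma abs_tanh_le_1: "\<bar>tanh (t::real)\<bar> \<le> 1"
  using tanh_real_bounds[of t] by auto

text \<open>\<open>J'\<close> is the energy density rewritten by the substitution \<open>w0 = sech^n g\<close>: its first two squares are \<open>(sech^n g'')^2\<close> and a
  positive multiple of \<open>(sech^n g')^2\<close>.\<close>

lemma ode_positive_trivial:
  fixes n A B :: real
  assumes n: "0 < n" and d: "\<And>t. (w0 has_real_derivative w1 t) (at t)"
    "\<And>t. (w1 has_real_derivative w2 t) (at t)" "\<And>t. (w2 has_real_derivative w3 t) (at t)"
    "\<And>t. (w3 has_real_derivative A * w2 t - B * w0 t + n * (n+1) * (n+2) * (n+3) * (1 - (tanh t)\<^sup>2)\<^sup>2 * w0 t) (at t)"
    and A: "n\<^sup>2 + (n+2)\<^sup>2 \<le> A" and B: "n\<^sup>2 * (n+2)\<^sup>2 < B"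
    and v: "(w0 \<longlongrightarrow> 0) at_infinity" "(w1 \<longlongrightarrow> 0) at_infinity" "(w2 \<longlongrightarrow> 0) at_infinity" "(w3 \<longlongrightarrow> 0) at_infinity"
  shows "w0 t = 0"
proof -
  define T where "T = (tanh :: real \<Rightarrow> real)"
  note d4 = d(4)[folded T_def]
  have T1: "\<bar>T t\<bar> \<le> 1" for t unfolding T_def by (rule abs_tanh_le_1)
  \<comment> \<open>This is the coefficient in sech^n (cosh^n w0)'' = w2 + 2 n T w1 + e(T)
    w0.\<close>
  define e where "e x = n\<^sup>2 * x\<^sup>2 + n * (1 - x\<^sup>2)" for x
  define g where "g x = x * (6 * n + 8 * n\<^sup>2 + 2 * n ^ 3) - x ^ 3 * (2 * n + 4 * n\<^sup>2)" for x
  define R where "R x = n\<^sup>2 + (n+2)\<^sup>2 - 2 * n\<^sup>2 + (2 * n\<^sup>2 + 4 * n) * (1 - x\<^sup>2)" for x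
  \<comment> \<open>By the equation, the first three terms differentiate to w2^2 + A w1^2 + B w0^2
    minus the potential times w0^2. The others are the total derivatives split off when the squares
    are completed, which determines g.\<close>
  define J where "J t = - (w0 t * w3 t - w1 t * w2 t - A * (w0 t * w1 t) - 2 * n * T t * (w1 t)\<^sup>2
      - 2 * e (T t) * (w0 t * w1 t) - g (T t) * (w0 t)\<^sup>2)" for t
  define J' where "J' t = (w2 t + 2 * n * T t * w1 t + e (T t) * w0 t)\<^sup>2 + R (T t) * (w1 t + n * T t * w0 t)\<^sup>2
     + (A - (n\<^sup>2 + (n+2)\<^sup>2)) * (w1 t)\<^sup>2 + (B - n\<^sup>2 * (n+2)\<^sup>2) * (w0 t)\<^sup>2" for t
  have dT: "(T has_real_derivative 1 - (T t)\<^sup>2) (at t)" for t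
    unfolding T_def by (rule has_field_derivative_tanh[OF _ DERIV_ident, THEN DERIV_cong]) auto
  have dJ: "(J has_real_derivative J' t) (at t)" for t
    unfolding J_def[abs_def] e_def[abs_def] g_def
    apply (rule DERIV_cong)
     apply (rule d(1-3) d4 dT derivative_intros)+
    apply (simp only: J'_def e_def R_def)
    apply (simp add: algebra_simps power2_eq_square power3_eq_cube)
    done
  have Tsq: "(T t)\<^sup>2 \<le> 1" for t using T1[of t] by (simp add: abs_square_le_1)
  have R: "0 \<le> R (T t)" for t unfolding R_def
  proof -
    have "0 \<le> (2 * n\<^sup>2 + 4 * n) * (1 - (T t)\<^sup>2)" using n Tsq[of t] by (intro mult_nonneg_nonneg) auto
    moreover have "n\<^sup>2 \<le> (n + 2)\<^sup>2" using n by (intro power_mono) auto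
    ultimately show "0 \<le> n\<^sup>2 + (n+2)\<^sup>2 - 2 * n\<^sup>2 + (2 * n\<^sup>2 + 4 * n) * (1 - (T t)\<^sup>2)" by linarith
  qed
  have J'nn: "0 \<le> J' t" for t unfolding J'_def
    using A B R[of t] by (intro add_nonneg_nonneg mult_nonneg_nonneg) auto
  have e_b: "\<bar>2 * e (T t)\<bar> \<le> 2 * (n\<^sup>2 + n)" for t
  proof -
    have "0 \<le> e (T t)" unfolding e_def using n Tsq[of t] by (intro add_nonneg_nonneg mult_nonneg_nonneg) auto
    moreover have "n\<^sup>2 * (T t)\<^sup>2 \<le> n\<^sup>2 * 1" "n * (1 - (T t)\<^sup>2) \<le> n * 1" using n Tsq[of t] by (intro mult_left_mono; simp)+
    ultimately have "0 \<le> e (T t)" "e (T t) \<le> n\<^sup>2 + n" unfolding e_def by linarith+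
    then show ?thesis by simp
  qed
  have g_b: "\<bar>g (T t)\<bar> \<le> (6 * n + 8 * n\<^sup>2 + 2 * n ^ 3) + (2 * n + 4 * n\<^sup>2)" for t
  proof -
    have "\<bar>T t * (6 * n + 8 * n\<^sup>2 + 2 * n ^ 3)\<bar> \<le> 1 * (6 * n + 8 * n\<^sup>2 + 2 * n ^ 3)"
      unfolding abs_mult using n T1[of t] by (intro mult_mono) auto
    moreover have "\<bar>T t ^ 3 * (2 * n + 4 * n\<^sup>2)\<bar> \<le> 1 * (2 * n + 4 * n\<^sup>2)"
      unfolding abs_mult power_abs using n T1[of t] by (intro mult_mono power_le_one) auto
    moreover have "\<bar>x\<bar> \<le> 1 * X \<Longrightarrow> \<bar>y\<bar> \<le> 1 * Y \<Longrightarrow> \<bar>x - y\<bar> \<le> X + Y" for x y X Y :: real by linarith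
    ultimately show ?thesis unfolding g_def by blast
  qed
  have T_b: "\<bar>2 * n * T t\<bar> \<le> 2 * n" for t using T1[of t] n by (simp add: abs_mult)
  have sq: "((\<lambda>t. (w t)\<^sup>2) \<longlongrightarrow> 0) at_infinity" if "(w \<longlongrightarrow> 0) at_infinity" for w :: "real \<Rightarrow> real"
    using tendsto_power[OF that, of 2] by simp
  have lim: "(J \<longlongrightarrow> - (0 - 0 - A * 0 - 0 - 0 - 0)) at_infinity" unfolding J_def
    by (intro tendsto_minus tendsto_diff tendsto_mult tendsto_const tendsto_mult_zero
       tendsto_bounded_times_zero[OF _ T_b] tendsto_bounded_times_zero[OF _ e_b] tendsto_bounded_times_zero[OF _ g_b] sq v)
  have "J' t = 0" by (rule monotone_vanishing(2)[OF dJ J'nn]) (use lim in simp)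
  \<comment> \<open>Strictness of the bound on B lets the last summand of J' alone control
    w0.\<close>
  moreover have "(B - n\<^sup>2 * (n+2)\<^sup>2) * (w0 t)\<^sup>2 \<le> J' t"
    unfolding J'_def using A R[of t] by (simp add: add_nonneg_nonneg)
  ultimately show ?thesis using B by (simp add: mult_le_0_iff)
qed


lemma cosh_powr_DERIV: "((\<lambda>t. cosh t powr a) has_real_derivative a * tanh t * cosh t powr a) (at (t::real))"
proof -
  have "cosh t powr (a - 1) * sinh t = tanh t * cosh t powr a"
    by (simp add: powr_diff tanh_def field_simps)
  then show ?thesis
    by (auto intro!: derivative_eq_intros simp: cosh_real_pos mult.assoc)
qed

lemma one_minus_tanh_sq: "1 - (tanh (t::real))\<^sup>2 = 1 / (cosh t)\<^sup>2"
proof -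
  have "(tanh t)\<^sup>2 = ((cosh t)\<^sup>2 - 1) / (cosh t)\<^sup>2" by (simp add: tanh_def power_divide sinh_square_eq)
  then show ?thesis by (simp add: diff_divide_distrib)
qed

lemma one_minus_tanh_sq_lim: "((\<lambda>t::real. 1 - (tanh t)\<^sup>2) \<longlongrightarrow> 0) at_infinity"
proof -
  have "((\<lambda>t::real. 1 - (tanh t)\<^sup>2) \<longlongrightarrow> 1 - 1\<^sup>2) at_top" by (intro tendsto_intros tanh_real_at_top)
  moreover have "((\<lambda>t::real. 1 - (tanh t)\<^sup>2) \<longlongrightarrow> 1 - (-1)\<^sup>2) at_bot" by (intro tendsto_intros tanh_real_at_bot)
  ultimately show ?thesis by (simp add: at_infinity_eq_at_top_bot filterlim_sup)
qed

lemma cosh_powr_minus_le_1: "0 \<le> a \<Longrightarrow> cosh (t::real) powr (- a) \<le> 1"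
  using powr_mono2'[of "-a" 1 "cosh t"] cosh_real_ge_1[of t] by simp

text \<open>With \<open>w0 = sech^m y\<close>, \<open>k = sech^(m+2) (L + c) y\<close> and \<open>u = sech^(m+2) ((L + c) y)'\<close>; \<open>Wr\<close> is the weighted Wronskian of \<open>(L + c) y\<close> and
  \<open>tanh\<close>, two solutions of \<open>L h = N h\<close>. It is constant and tends to \<open>0\<close>.\<close>

lemma ode_radial_kernel:
  fixes m :: real
  assumes m: "0 < m" and d: "\<And>t. (w0 has_real_derivative w1 t) (at t)"
    "\<And>t. (w1 has_real_derivative w2 t) (at t)" "\<And>t. (w2 has_real_derivative w3 t) (at t)"
    "\<And>t. (w3 has_real_derivative (m\<^sup>2 + (m+2)\<^sup>2) * w2 t - m\<^sup>2 * (m+2)\<^sup>2 * w0 t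
        + (m+1) * (m+2) * (m+3) * (m+4) * (1 - (tanh t)\<^sup>2)\<^sup>2 * w0 t) (at t)"
    and v: "(w0 \<longlongrightarrow> 0) at_infinity" "(w1 \<longlongrightarrow> 0) at_infinity" "(w2 \<longlongrightarrow> 0) at_infinity" "(w3 \<longlongrightarrow> 0) at_infinity"
  obtains a where "\<And>t. w0 t = a * (cosh t powr (- m) * tanh t)"
proof -
  define T where "T = (tanh :: real \<Rightarrow> real)"
  note d4 = d(4)[folded T_def]
  have dT: "(T has_real_derivative 1 - (T t)\<^sup>2) (at t)" for t
    unfolding T_def by (rule has_field_derivative_tanh[OF _ DERIV_ident, THEN DERIV_cong]) auto
  have T1: "\<bar>T t\<bar> \<le> 1" for t unfolding T_def by (rule abs_tanh_le_1)
  have T2: "\<bar>(T t)\<^sup>2\<bar> \<le> 1" for t using T1[of t] by (simp add: abs_square_le_1)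
  have T3: "\<bar>T t ^ 3\<bar> \<le> 1" for t using T1[of t] by (simp add: power_abs power_le_one)
  note lim0 = tendsto_bounded_times_zero[OF _ T1] tendsto_bounded_times_zero[OF _ T2] tendsto_bounded_times_zero[OF _ T3]
  \<comment> \<open>With L the nonnegative operator, the Paneitz operator on the sphere is (L +
    (m+1)(m+2)) (L + m (m+3)). Subtracting (m+1)(m+2)(m+3)(m+4) gives (L - N) (L + c) with N = 2 m +
    4 and this c.\<close>
  define c where "c = 2 * (m+1) * (m+3)"
  define k where "k t = - w2 t + 2 * (T t * w1 t) + (c - m) * w0 t + (m * (m+3) - c) * ((T t)\<^sup>2 * w0 t)" for t
  define k1 where "k1 t = - w3 t + 2 * (T t * w2 t) + (8 + 7*m + 2*m\<^sup>2) * w1 t - (8 + 5*m + m\<^sup>2) * ((T t)\<^sup>2 * w1 t)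
      + (12 + 10*m + 2*m\<^sup>2) * (T t ^ 3 * w0 t - T t * w0 t)" for t
  have dk: "(k has_real_derivative k1 t) (at t)" for t
    unfolding k_def[abs_def]
    apply (rule DERIV_cong)
     apply (rule d(1-3) dT derivative_intros)+
    apply (simp add: k1_def c_def algebra_simps power2_eq_square power3_eq_cube)
    done
  \<comment> \<open>This is L h = N h for h = cosh^(m+2) k: the order has dropped from four to
    two.\<close>
  have dk1: "(k1 has_real_derivative - 2 * T t * k1 t - (3 * (m+2) * (1 - (T t)\<^sup>2) - m * (m+2) * (T t)\<^sup>2) * k t) (at t)" for t
    unfolding k1_def[abs_def]
    apply (rule DERIV_cong)
     apply (rule d(1-3) d4 dT derivative_intros)+
    apply (simp add: k1_def k_def c_def algebra_simps power2_eq_square power3_eq_cube)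
    done
  have vk: "(k \<longlongrightarrow> 0) at_infinity"
    unfolding k_def by (rule tendsto_eq_intros lim0 v refl | simp)+
  have vk1: "(k1 \<longlongrightarrow> 0) at_infinity"
    unfolding k1_def by (rule tendsto_eq_intros lim0 v refl | simp)+
  define u where "u t = k1 t + (m+2) * (T t * k t)" for t
  have vu: "(u \<longlongrightarrow> 0) at_infinity"
    unfolding u_def by (rule tendsto_eq_intros lim0 vk vk1 refl | simp)+
  have du: "(u has_real_derivative m * T t * u t - (2*m+4) * (1 - (T t)\<^sup>2) * k t) (at t)" for t
    unfolding u_def[abs_def]
    apply (rule DERIV_cong)
     apply (rule dk dk1 dT derivative_intros)+
    apply (simp add: algebra_simps power2_eq_square)
    done
  have dk': "(k has_real_derivative u t - (m+2) * (T t * k t)) (at t)" for t using dk[of t] by (simp add: u_def)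
  note dC = cosh_powr_DERIV[folded T_def]
  define Wr where "Wr t = cosh t powr (-m) * (T t * u t - (k t - (T t)\<^sup>2 * k t))" for t
  have dWr: "(Wr has_real_derivative 0) (at t)" for t
    unfolding Wr_def[abs_def]
    apply (rule DERIV_cong)
     apply (rule dk' du dT dC derivative_intros)+
    apply (simp add: algebra_simps power2_eq_square)
    done
  have Cb: "\<bar>cosh t powr (-m)\<bar> \<le> 1" for t :: real using cosh_powr_minus_le_1[of m t] m by simp
  have "((\<lambda>t. T t * u t - (k t - (T t)\<^sup>2 * k t)) \<longlongrightarrow> 0) at_infinity"
    by (rule tendsto_eq_intros lim0 vk vu refl | simp)+
  then have "(Wr \<longlongrightarrow> 0) at_infinity"
    unfolding Wr_def by (rule tendsto_bounded_times_zero[OF _ Cb])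
  then have "Wr t = 0" for t by (intro monotone_vanishing(1)[OF dWr]) auto
  then have uk: "T t * u t = k t - (T t)\<^sup>2 * k t" for t by (simp add: Wr_def)
  \<comment> \<open>For h = cosh^(m+2) k this is h' + tanh h, which equals a when h = a tanh. It
    recovers a without dividing by tanh, which vanishes at 0.\<close>
  define A where "A t = cosh t powr (m+2) * (u t + T t * k t)" for t
  have dA: "(A has_real_derivative 0) (at t)" for t
  proof -
    have "(A has_real_derivative cosh t powr (m+2) * ((2*m+3) * (T t * u t - (k t - (T t)\<^sup>2 * k t)))) (at t)"
      unfolding A_def[abs_def]
      apply (rule DERIV_cong)
       apply (rule dk' du dT dC derivative_intros)+
      apply (simp add: algebra_simps power2_eq_square)
      done
    then show ?thesis using uk[of t] by simp
  qed
  obtain a where a: "\<And>t. A t = a" using DERIV_isconst_all[of A] dA by metis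
  have ka: "k t = a * (cosh t powr (-(m+2)) * T t)" for t
  proof -
    have "(u t + T t * k t) * T t = k t" using uk[of t] by (simp add: algebra_simps power2_eq_square)
    moreover have "u t + T t * k t = a * cosh t powr (-(m+2))"
    proof -
      have "cosh t powr (-(m+2)) * cosh t powr (m+2) = 1"
        unfolding powr_add[symmetric] using cosh_real_pos[of t] by simp
      then have "cosh t powr (-(m+2)) * A t = u t + T t * k t" unfolding A_def mult.assoc[symmetric] by simp
      then show ?thesis using a[of t] by (simp only: mult.commute)
    qed
    ultimately show ?thesis by simp
  qed
  \<comment> \<open>Since L tanh = N tanh, the operator L + c multiplies tanh by 2 m + 4 + c.
    Subtracting a' tanh from y therefore leaves a solution of (L + c) y = 0.\<close>
  define a' where "a' = a / (2*m + 4 + c)"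
  have cpos: "c > 0" "2*m+4+c \<noteq> 0" using m by (auto simp: c_def intro!: add_pos_pos mult_pos_pos less_imp_neq[THEN not_sym])
  define p where "p t = cosh t powr (-m)" for t :: real
  have dp: "(p has_real_derivative - m * T t * p t) (at t)" for t unfolding p_def[abs_def] by (rule dC)
  have p2: "cosh t powr (-(m+2)) = p t * (1 - (T t)\<^sup>2)" for t
  proof -
    have "1 - (T t)\<^sup>2 = 1 / (cosh t)\<^sup>2" unfolding T_def by (rule one_minus_tanh_sq)
    moreover have "cosh t powr (-(m+2)) = cosh t powr (-m) / (cosh t) powr 2"
      using powr_diff[of "cosh t" "-m" 2] by (simp only: minus_add_distrib diff_conv_add_uminus)
    ultimately show ?thesis using cosh_real_pos[of t] by (simp add: p_def)
  qed
  define y0 where "y0 t = w0 t - a' * (p t * T t)" for t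
  define y1 where "y1 t = w1 t - a' * (p t * (1 - (m+1) * (T t)\<^sup>2))" for t
  define y2 where "y2 t = w2 t - a' * (p t * (m * (m+1) * T t ^ 3 - m * T t - 2 * (m+1) * T t * (1 - (T t)\<^sup>2)))" for t
  have dy0: "(y0 has_real_derivative y1 t) (at t)" for t
    unfolding y0_def[abs_def]
    apply (rule DERIV_cong)
     apply (rule d dT dp derivative_intros)+
    apply (simp add: y1_def algebra_simps power2_eq_square)
    done
  have dy1: "(y1 has_real_derivative y2 t) (at t)" for t
    unfolding y1_def[abs_def]
    apply (rule DERIV_cong)
     apply (rule d dT dp derivative_intros)+
    apply (simp add: y2_def algebra_simps power2_eq_square power3_eq_cube)
    done
  have eqw: "w2 t = 2 * T t * w1 t + (c - m) * w0 t + (m * (m+3) - c) * ((T t)\<^sup>2 * w0 t) - a' * (2*m+4+c) * (p t * (1 - (T t)\<^sup>2) * T t)" for t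
    using ka[of t] cpos(2) unfolding k_def p2 a'_def by simp
  have eqy: "y2 t = 2 * T t * y1 t + (c - m) * y0 t + (m * (m+3) - c) * ((T t)\<^sup>2 * y0 t)" for t
    unfolding y2_def y0_def y1_def eqw by (simp add: algebra_simps power2_eq_square power3_eq_cube)
  \<comment> \<open>With Y = cosh^m y0, the equation (L + c) Y = 0 reads (sech^(2m+2) Y')' = c
    sech^(2m+4) Y. J is sech^(2m+2) Y Y', so J' is a sum of nonnegative terms because c > 0.\<close>
  define J where "J t = (1 - (T t)\<^sup>2) * (y0 t * (y1 t + m * T t * y0 t))" for t
  define J' where "J' t = (1 - (T t)\<^sup>2) * (y1 t + m * T t * y0 t)\<^sup>2 + c * ((1 - (T t)\<^sup>2) * y0 t)\<^sup>2" for t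
  have dJ: "(J has_real_derivative J' t) (at t)" for t
    unfolding J_def[abs_def]
    apply (rule DERIV_cong)
     apply (rule dy0 dy1 dT derivative_intros)+
    apply (simp add: J'_def eqy algebra_simps power2_eq_square)
    done
  have J'nn: "0 \<le> J' t" for t
    unfolding J'_def using T2[of t] cpos(1) by (intro add_nonneg_nonneg mult_nonneg_nonneg) auto
  have pb: "\<bar>p t\<bar> \<le> 1" for t using Cb unfolding p_def .
  have vS: "((\<lambda>t. 1 - (T t)\<^sup>2) \<longlongrightarrow> 0) at_infinity" unfolding T_def by (rule one_minus_tanh_sq_lim)
  \<comment> \<open>p = cosh^(-m) is (1 - T^2)^(m/2), so it inherits the decay of 1 - T^2 because m
    > 0.\<close>
  have pT: "(p \<longlongrightarrow> 0) at_infinity"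
  proof -
    have "((\<lambda>t. (1 - (T t)\<^sup>2) powr (m/2)) \<longlongrightarrow> 0) at_infinity"
      using m T2 by (intro tendsto_zero_powrI[OF vS tendsto_const]) (auto intro!: always_eventually)
    moreover have "(1 - (T t)\<^sup>2) powr (m/2) = p t" for t
    proof -
      have "1 - (T t)\<^sup>2 = cosh t powr (-2)"
        using cosh_real_pos[of t] by (simp add: T_def one_minus_tanh_sq powr_minus divide_inverse)
      then show ?thesis by (simp add: powr_powr p_def)
    qed
    ultimately show ?thesis by simp
  qed
  have vy0: "(y0 \<longlongrightarrow> 0) at_infinity"
    unfolding y0_def by (rule tendsto_eq_intros tendsto_bounded_times_zero[OF pT T1, unfolded mult.commute[of "T _"]] v refl | simp)+
  have vy1: "(y1 \<longlongrightarrow> 0) at_infinity"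
  proof -
    have "((\<lambda>t. w1 t - a' * p t + a' * ((m+1) * ((T t)\<^sup>2 * p t))) \<longlongrightarrow> 0) at_infinity"
      by (rule tendsto_eq_intros lim0 v pT refl | simp)+
    moreover have "w1 t - a' * p t + a' * ((m+1) * ((T t)\<^sup>2 * p t)) = y1 t" for t
      by (simp add: y1_def algebra_simps)
    ultimately show ?thesis by simp
  qed
  have "((\<lambda>t. (1 - (T t)\<^sup>2) * (y0 t * (y1 t + m * (T t * y0 t)))) \<longlongrightarrow> 0) at_infinity"
    by (rule tendsto_eq_intros lim0 vy0 vy1 vS refl | simp)+
  then have "(J \<longlongrightarrow> 0) at_infinity" by (simp add: J_def[abs_def] mult.assoc)
  then have J'0: "J' t = 0" for t by (rule monotone_vanishing(2)[OF dJ J'nn])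
  have "y0 t = 0" for t
  proof -
    have S: "1 - (T t)\<^sup>2 > 0" using p2[of t] T2[of t] cosh_real_pos[of t]
      by (smt (verit, best) mult_zero_right powr_gt_zero zero_less_mult_iff abs_le_iff)
    have "c * ((1 - (T t)\<^sup>2) * y0 t)\<^sup>2 \<le> J' t" unfolding J'_def using S by simp
    then have "c * ((1 - (T t)\<^sup>2) * y0 t)\<^sup>2 \<le> 0" using J'0 by simp
    then have "((1 - (T t)\<^sup>2) * y0 t)\<^sup>2 \<le> 0" using cpos(1) by (simp add: mult_le_0_iff)
    then show ?thesis using S by simp
  qed
  then have "w0 t = a' * (cosh t powr (- m) * tanh t)" for t by (simp add: y0_def p_def T_def)
  then show thesis by (rule that)
qed

section \<open>Homogeneous polynomials times radial functions\<close>

text \<open>The relational form records that the partial derivative exists; \<open>pd\<close> is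
  built on the total \<open>deriv\<close> and carries no such information.\<close>

definition hasPD :: "'n::finite \<Rightarrow> (real^'n \<Rightarrow> real) \<Rightarrow> real^'n \<Rightarrow> real \<Rightarrow> bool" where
  "hasPD i f x D \<longleftrightarrow> ((\<lambda>t. f (x + t *\<^sub>R axis i 1)) has_real_derivative D) (at 0)"

lemma hasPD_pd: "hasPD i f x D \<Longrightarrow> pd i f x = D"
  unfolding hasPD_def pd_def by (rule DERIV_imp_deriv)

lemma hasPD_cong: "hasPD i f x D \<Longrightarrow> D = E \<Longrightarrow> hasPD i f x E" by simp

lemma hasPD_const: "hasPD i (\<lambda>x. c) x 0" by (simp add: hasPD_def)

lemma hasPD_add: "hasPD i f x D \<Longrightarrow> hasPD i g x E \<Longrightarrow> hasPD i (\<lambda>x. f x + g x) x (D + E)"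
  unfolding hasPD_def by (rule DERIV_add)

lemma hasPD_mult: "hasPD i f x D \<Longrightarrow> hasPD i g x E \<Longrightarrow> hasPD i (\<lambda>x. f x * g x) x (D * g x + f x * E)"
  unfolding hasPD_def using DERIV_mult[of "\<lambda>t. f (x + t *\<^sub>R axis i 1)" D 0 UNIV "\<lambda>t. g (x + t *\<^sub>R axis i 1)" E]
  by (simp add: algebra_simps)

lemma hasPD_coord: "hasPD i (\<lambda>x. x $ j) x (if i = j then 1 else 0)"
  unfolding hasPD_def by (auto intro!: derivative_eq_intros simp: axis_def)

lemma hasPD_transform:
  assumes "hasPD i f x D" "open S" "x \<in> S" "\<And>y. y \<in> S \<Longrightarrow> f y = g y"
  shows "hasPD i g x D"
proof -
  have c: "continuous_on UNIV (\<lambda>t::real. x + t *\<^sub>R axis i 1)" by (intro continuous_intros)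
  have "open ((\<lambda>t::real. x + t *\<^sub>R axis i 1) -` S)" using open_vimage[OF assms(2) c] .
  then have "\<forall>\<^sub>F t in nhds 0. f (x + t *\<^sub>R axis i 1) = g (x + t *\<^sub>R axis i 1)"
    unfolding eventually_nhds using assms(3,4) by (intro exI[of _ "(\<lambda>t::real. x + t *\<^sub>R axis i 1) -` S"]) auto
  from DERIV_cong_ev[OF refl this refl] show ?thesis using assms(1) unfolding hasPD_def by blast
qed

lemma pd_transform:
  assumes "open S" "x \<in> S" "\<And>y. y \<in> S \<Longrightarrow> f y = g y"
  shows "pd i f x = pd i g x"
proof -
  have c: "continuous_on UNIV (\<lambda>t::real. x + t *\<^sub>R axis i 1)" by (intro continuous_intros)
  have "open ((\<lambda>t::real. x + t *\<^sub>R axis i 1) -` S)" using open_vimage[OF assms(1) c] .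
  then have "\<forall>\<^sub>F t in nhds 0. f (x + t *\<^sub>R axis i 1) = g (x + t *\<^sub>R axis i 1)"
    unfolding eventually_nhds using assms(2,3) by (intro exI[of _ "(\<lambda>t::real. x + t *\<^sub>R axis i 1) -` S"]) auto
  then show ?thesis unfolding pd_def by (rule deriv_cong_ev) simp
qed

lemma hasPD_norm: assumes "x \<noteq> 0" shows "hasPD i norm x (x $ i / norm x)"
proof -
  have e: "norm (x + t *\<^sub>R axis i 1) = sqrt ((norm x)\<^sup>2 + 2 * t * x $ i + t\<^sup>2)" for t
  proof -
    have "(norm (x + t *\<^sub>R axis i 1))\<^sup>2 = (norm x)\<^sup>2 + 2 * t * x $ i + t\<^sup>2"
      unfolding power2_norm_eq_inner
      by (simp add: inner_add_left inner_add_right inner_axis inner_axis' inner_axis_axis power2_eq_square algebra_simps)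
    then show ?thesis by (metis norm_ge_zero real_sqrt_unique)
  qed
  show ?thesis unfolding hasPD_def e using assms
    by (auto intro!: derivative_eq_intros simp: field_simps)
qed

text \<open>Functions of x in logarithmic coordinates. As \<open>0 powr a = 0\<close>, the value at
  the origin is 0 for every q, so identities between such functions hold there as well.\<close>

definition Rad :: "real \<Rightarrow> (real \<Rightarrow> real) \<Rightarrow> real^'n::finite \<Rightarrow> real" where
  "Rad q w x = norm x powr (- q) * w (ln (norm x))"

lemma Rad_0 [simp]: "Rad q w 0 = 0" by (simp add: Rad_def)

lemma Rad_norm2: "(norm x)\<^sup>2 * Rad (q + 2) w x = Rad q w x"
proof (cases "x = 0")
  case False
  have "norm x powr (- q) = norm x powr 2 * norm x powr (- (q + 2))" 
    using powr_add[of "norm x" 2 "-(q+2)"] by (simp only: minus_add_distrib add.left_commute) simp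
  then show ?thesis using False by (simp add: Rad_def)
qed simp

lemma Rad_divide_norm: "Rad q w x / norm x ^ k = Rad (q + real k) w x"
proof (cases "x = 0")
  case False
  have "norm x powr (- (q + real k)) = norm x powr (-q) / norm x powr real k" by (simp add: powr_diff[symmetric])
  then show ?thesis using False by (simp add: Rad_def powr_realpow)
qed simp

text \<open>Both factors contribute x_i / |x|^2, hence the exponent q + 2; on w the derivative acts
  as D - q.\<close>

lemma hasPD_Rad:
  assumes "x \<noteq> 0" "\<And>t. (w has_real_derivative w1 t) (at t)"
  shows "hasPD i (Rad q w) x (x $ i * Rad (q + 2) (\<lambda>t. w1 t - q * w t) x)"
proof -
  let ?n = "\<lambda>t. norm (x + t *\<^sub>R axis i 1)"
  have n: "(?n has_real_derivative x $ i / norm x) (at 0)" using hasPD_norm[OF assms(1), of i] by (simp add: hasPD_def)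
  have nz: "norm x > 0" using assms by simp
  have l: "((\<lambda>t. ln (?n t)) has_real_derivative (x $ i / norm x) / norm x) (at 0)"
    using n nz by (auto intro!: derivative_eq_intros)
  have w: "((\<lambda>t. w (ln (?n t))) has_real_derivative w1 (ln (norm x)) * ((x $ i / norm x) / norm x)) (at 0)"
    using DERIV_chain2[OF assms(2) l] by simp
  have p: "((\<lambda>t. ?n t powr (- q)) has_real_derivative (- q) * norm x powr (- q - 1) * (x $ i / norm x)) (at 0)"
    using n nz by (auto intro!: derivative_eq_intros simp: powr_diff)
  have e: "norm x powr (- q - 1) = norm x powr (- (q + 2)) * norm x" "norm x powr (- q) = norm x powr (- (q + 2)) * (norm x * norm x)"

  proof -
    have "- q - 1 = -(q+2) + 1" "- q = -(q+2) + 2" by simp_all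
    then show "norm x powr (- q - 1) = norm x powr (- (q + 2)) * norm x" "norm x powr (- q) = norm x powr (- (q + 2)) * (norm x * norm x)"
      using nz powr_add[of "norm x" "-(q+2)" 1] powr_add[of "norm x" "-(q+2)" 2] by (simp_all only: powr_one powr_numeral power2_eq_square)
  qed
  show ?thesis unfolding hasPD_def Rad_def
    by (rule DERIV_cong[OF DERIV_mult[OF p w]]) (use nz in \<open>simp add: e field_simps\<close>)
qed

lemma Rad_test_fun_zero_near:
  assumes "test_fun \<psi>" obtains \<delta> where "\<delta> > 0" "\<And>q x. x \<in> ball (0::real^'n::finite) \<delta> \<Longrightarrow> Rad q \<psi> x = 0"
proof -
  obtain R where R: "R > 0" "\<And>t. R \<le> \<bar>t\<bar> \<Longrightarrow> \<psi> t = 0" using test_fun_support[OF assms] by blast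
  have "Rad q \<psi> x = 0" if "x \<in> ball 0 (exp (-R))" for q and x :: "real^'n"
  proof (cases "x = 0")
    case False
    then have "ln (norm x) < - R" using that by (metis exp_ln exp_less_cancel_iff mem_ball_0 zero_less_norm_iff)
    then have "\<psi> (ln (norm x)) = 0" using R by (intro R(2)) auto
    then show ?thesis by (simp add: Rad_def)
  qed simp
  then show thesis using that[of "exp (-R)"] by simp
qed

lemma Rad_test_fun_zero_far:
  assumes "test_fun \<psi>" obtains R where "\<And>q x. R \<le> norm (x::real^'n::finite) \<Longrightarrow> Rad q \<psi> x = 0"
proof -
  obtain R where R: "R > 0" "\<And>t. R \<le> \<bar>t\<bar> \<Longrightarrow> \<psi> t = 0" using test_fun_support[OF assms] by blast
  have "Rad q \<psi> x = 0" if "exp R \<le> norm x" for q and x :: "real^'n"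
  proof -
    have "R \<le> ln (norm x)" using that by (metis exp_gt_zero ln_exp ln_le_cancel_iff order_less_le_trans)
    then have "\<psi> (ln (norm x)) = 0" using R by (intro R(2)) auto
    then show ?thesis by (simp add: Rad_def)
  qed
  then show thesis using that by blast
qed

lemma hasPD_Rad_test_fun:
  assumes "test_fun \<psi>" shows "hasPD i (Rad q \<psi>) x (x $ i * Rad (q + 2) (\<lambda>t. deriv \<psi> t - q * \<psi> t) x)"
proof (cases "x = 0")
  case False then show ?thesis using hasPD_Rad[OF False test_fun_DERIV[OF assms]] by simp
next
  case True
  obtain \<delta> where d: "\<delta> > 0" "\<And>x::real^'a. x \<in> ball 0 \<delta> \<Longrightarrow> Rad q \<psi> x = 0" using Rad_test_fun_zero_near[OF assms] by metis
  have "hasPD i (Rad q \<psi>) x 0" by (rule hasPD_transform[OF hasPD_const[of i 0], of "ball 0 \<delta>"]) (use d True in auto)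
  then show ?thesis using True by simp
qed

lemma continuous_off_zero:
  fixes f :: "'a::real_normed_vector \<Rightarrow> real"
  assumes "continuous_on (UNIV - {0}) f" "\<delta> > 0" "\<And>x. x \<in> ball 0 \<delta> \<Longrightarrow> f x = 0"
  shows "continuous_on UNIV f"
proof -
  have "continuous_on ((UNIV - {0}) \<union> ball 0 \<delta>) f"
    by (rule continuous_on_open_Un[OF _ _ assms(1)])
       (use assms continuous_on_cong[of "ball 0 \<delta>" "ball 0 \<delta>" f "\<lambda>_. 0"] in auto)
  moreover have "(UNIV - {0}) \<union> ball 0 \<delta> = (UNIV :: 'a set)" using assms(2) by auto
  ultimately show ?thesis by simp
qed

lemma continuous_Rad:
  assumes "continuous_on UNIV w" shows "continuous_on (UNIV - {0::real^'n::finite}) (Rad q w)"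
proof -
  have "continuous_on (UNIV - {0::real^'n}) (\<lambda>x. ln (norm x))" by (intro continuous_intros) auto
  from continuous_on_compose2[OF assms this] have "continuous_on (UNIV - {0::real^'n}) (\<lambda>x. w (ln (norm x)))" by simp
  moreover have "continuous_on (UNIV - {0::real^'n}) (\<lambda>x. norm x powr (- q))" by (intro continuous_intros) auto
  ultimately show ?thesis unfolding Rad_def by (intro continuous_on_mult)
qed

lemma continuous_Rad_test_fun: assumes "test_fun \<psi>" shows "continuous_on UNIV (Rad q \<psi> :: real^'n::finite \<Rightarrow> real)"
proof -
  obtain \<delta> where d: "\<delta> > 0" "\<And>x::real^'n. x \<in> ball 0 \<delta> \<Longrightarrow> Rad q \<psi> x = 0" using Rad_test_fun_zero_near[OF assms] by metis
  show ?thesis by (rule continuous_off_zero[OF continuous_Rad[OF test_fun_continuous[OF assms]] d])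
qed

text \<open>Generated by rules, so that degrees are tracked by rule induction; \<open>zero\<close>
  admits the zero function in every degree, which differentiation requires.\<close>

inductive hpoly :: "nat \<Rightarrow> (real^'n::finite \<Rightarrow> real) \<Rightarrow> bool" where
  const: "hpoly 0 (\<lambda>_. c)"
| coord: "hpoly d p \<Longrightarrow> hpoly (Suc d) (\<lambda>x. x $ i * p x)"
| add: "hpoly d p \<Longrightarrow> hpoly d q \<Longrightarrow> hpoly d (\<lambda>x. p x + q x)"
| zero: "hpoly d (\<lambda>_. 0)"

lemma hpoly_sum: "finite A \<Longrightarrow> (\<And>i. i \<in> A \<Longrightarrow> hpoly d (f i)) \<Longrightarrow> hpoly d (\<lambda>x. \<Sum>i\<in>A. f i x)"
  by (induction A rule: finite_induct) (auto intro: hpoly.intros)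

lemma hpoly_continuous: "hpoly d p \<Longrightarrow> continuous_on UNIV p"
  by (induction rule: hpoly.induct) (auto intro!: continuous_intros)

lemma hpoly_cmult: "hpoly d p \<Longrightarrow> hpoly d (\<lambda>x. c * p x)"
proof (induction rule: hpoly.induct)
  case (const a) then show ?case using hpoly.const[of "c * a"] by simp
next
  case (coord d p i) then show ?case using hpoly.coord[OF coord.IH, of i] by (simp add: mult.left_commute)
next
  case (add d p q) then show ?case using hpoly.add[OF add.IH] by (simp add: distrib_left)
qed (auto intro: hpoly.intros)

lemma hpoly_bound: "hpoly d p \<Longrightarrow> \<exists>C\<ge>0. \<forall>x. \<bar>p x\<bar> \<le> C * norm x ^ d"
proof (induction rule: hpoly.induct)
  case (const c) show ?case by (intro exI[of _ "\<bar>c\<bar>"]) auto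
next
  case (coord d p i)
  then obtain C where C: "C \<ge> 0" "\<And>x. \<bar>p x\<bar> \<le> C * norm x ^ d" by blast
  have "\<bar>x $ i * p x\<bar> \<le> C * norm x ^ Suc d" for x
  proof -
    have "\<bar>x $ i\<bar> * \<bar>p x\<bar> \<le> norm x * (C * norm x ^ d)"
      using C component_le_norm_cart[of x i] by (intro mult_mono) auto
    then show ?thesis by (simp add: abs_mult mult_ac)
  qed
  then show ?case using C by blast
next
  case (add d p q)
  then obtain C C' where C: "C \<ge> 0" "C' \<ge> 0" "\<And>x. \<bar>p x\<bar> \<le> C * norm x ^ d" "\<And>x. \<bar>q x\<bar> \<le> C' * norm x ^ d" by blast
  have "\<bar>p x + q x\<bar> \<le> (C + C') * norm x ^ d" for x
    using C(3,4)[of x] abs_triangle_ineq[of "p x" "q x"] by (simp add: distrib_right)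
  then show ?case using C by (intro exI[of _ "C + C'"]) auto
qed auto

text \<open>In degree \<open>0\<close> the derivative vanishes, so the truncated subtraction is harmless.\<close>

lemma hpoly_pd: "hpoly d p \<Longrightarrow> (\<forall>x. hasPD i p x (pd i p x)) \<and> hpoly (d - 1) (pd i p) \<and> (d = 0 \<longrightarrow> pd i p = (\<lambda>_. 0))"
proof (induction rule: hpoly.induct)
  case (const c)
  have "pd i (\<lambda>_. c) = (\<lambda>_. 0)" by (rule ext, rule hasPD_pd, rule hasPD_const)
  then show ?case using hasPD_const by (auto intro: hpoly.intros)
next
  case (zero d)
  have "pd i (\<lambda>_. 0) = (\<lambda>_. 0)" by (rule ext, rule hasPD_pd, rule hasPD_const)
  then show ?case using hasPD_const by (auto intro: hpoly.intros)
next
  case (coord d p j)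
  have h: "hasPD i (\<lambda>x. x $ j * p x) x ((if i = j then 1 else 0) * p x + x $ j * pd i p x)" for x
    using coord by (intro hasPD_mult hasPD_coord) auto
  then have e: "pd i (\<lambda>x. x $ j * p x) = (\<lambda>x. (if i = j then 1 else 0) * p x + x $ j * pd i p x)"
    using hasPD_pd by blast
  have "hpoly d (\<lambda>x. x $ j * pd i p x)"
  proof (cases d)
    case 0 then show ?thesis using coord by (auto intro: hpoly.intros)
  next
    case (Suc k) then show ?thesis using coord by (auto intro: hpoly.intros)
  qed
  then have "hpoly d (pd i (\<lambda>x. x $ j * p x))" unfolding e using coord by (intro hpoly.add hpoly_cmult)
  then show ?case using h unfolding e by auto
next
  case (add d p q)
  have h: "hasPD i (\<lambda>x. p x + q x) x (pd i p x + pd i q x)" for x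
    using add by (intro hasPD_add) auto
  then have e: "pd i (\<lambda>x. p x + q x) = (\<lambda>x. pd i p x + pd i q x)" using hasPD_pd by blast
  show ?case using h add unfolding e by (auto intro: hpoly.intros)
qed

text \<open>The case distinction is there because d - 2 is truncated on the naturals: in degrees 0
  and 1 the Laplacian is zero.\<close>

lemma hpoly_clap: assumes "hpoly d p" shows "if d < 2 then clap p = (\<lambda>_. 0) else hpoly (d - 2) (clap p)"
proof -
  have 1: "hpoly (d - 1) (pd i p)" for i using hpoly_pd[OF assms] by blast
  have 2: "hpoly (d - 1 - 1) (pd i (pd i p))" "d - 1 = 0 \<longrightarrow> pd i (pd i p) = (\<lambda>_. 0)" for i using hpoly_pd[OF 1] by blast+
  show ?thesis
  proof (cases "d < 2")
    case True then show ?thesis using 2(2) by (simp add: clap_def[abs_def])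
  next
    case False then show ?thesis using 2(1) unfolding clap_def[abs_def] by (auto intro!: hpoly_sum simp: numeral_2_eq_2)
  qed
qed

lemma hpoly_euler: "hpoly d p \<Longrightarrow> (\<Sum>i\<in>UNIV. x $ i * pd i p x) = real d * p x"
proof (induction rule: hpoly.induct)
  case (const c) then show ?case by (simp add: hasPD_pd[OF hasPD_const])
next
  case (zero d) then show ?case by (simp add: hasPD_pd[OF hasPD_const])
next
  case (coord d p j)
  have "pd i (\<lambda>x. x $ j * p x) x = (if i = j then 1 else 0) * p x + x $ j * pd i p x" for i
    by (rule hasPD_pd, rule hasPD_mult[OF hasPD_coord]) (use hpoly_pd[OF coord.hyps] in blast)
  then have "(\<Sum>i\<in>UNIV. x $ i * pd i (\<lambda>x. x $ j * p x) x) = (\<Sum>i\<in>UNIV. (if i = j then x $ i * p x else 0) + x $ j * (x $ i * pd i p x))"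
    by (intro sum.cong) (auto simp: algebra_simps)
  also have "\<dots> = x $ j * p x + x $ j * (\<Sum>i\<in>UNIV. x $ i * pd i p x)"
    by (simp add: sum.distrib sum_distrib_left sum.delta)
  finally show ?case using coord.IH by (simp add: algebra_simps)
next
  case (add d p q)
  have "pd i (\<lambda>x. p x + q x) x = pd i p x + pd i q x" for i
    by (rule hasPD_pd, rule hasPD_add) (use hpoly_pd[OF add.hyps(1)] hpoly_pd[OF add.hyps(2)] in blast)+
  then show ?case using add.IH by (simp add: algebra_simps sum.distrib)
qed

text \<open>This class is closed under partial derivatives. As \<open>smooth\<close> speaks of
  iterated partial derivatives, continuity and partial differentiability of all members already give
  smoothness.\<close>

inductive radial_test :: "(real^'n::finite \<Rightarrow> real) \<Rightarrow> bool" where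
  gen: "hpoly d p \<Longrightarrow> test_fun \<psi> \<Longrightarrow> radial_test (\<lambda>x. p x * Rad q \<psi> x)"
| add: "radial_test f \<Longrightarrow> radial_test g \<Longrightarrow> radial_test (\<lambda>x. f x + g x)"

lemma radial_test_pd: "radial_test f \<Longrightarrow> continuous_on UNIV f \<and> (\<forall>x. hasPD i f x (pd i f x)) \<and> radial_test (pd i f)"
proof (induction rule: radial_test.induct)
  case (gen d p \<psi> q)
  let ?\<psi>1 = "\<lambda>t. deriv \<psi> t - q * \<psi> t"
  have p: "hasPD i p x (pd i p x)" "hpoly (d - 1) (pd i p)" for x using hpoly_pd[OF gen(1)] by auto
  have h: "hasPD i (\<lambda>x. p x * Rad q \<psi> x) x (pd i p x * Rad q \<psi> x + (x $ i * p x) * Rad (q + 2) ?\<psi>1 x)" for x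
    by (rule hasPD_cong[OF hasPD_mult[OF p(1) hasPD_Rad_test_fun[OF gen(2)]]]) simp
  then have e: "pd i (\<lambda>x. p x * Rad q \<psi> x) = (\<lambda>x. pd i p x * Rad q \<psi> x + (x $ i * p x) * Rad (q + 2) ?\<psi>1 x)"
    using hasPD_pd by blast
  have "radial_test (pd i (\<lambda>x. p x * Rad q \<psi> x))" unfolding e
    by (intro radial_test.add radial_test.gen[OF p(2) gen(2)] radial_test.gen[OF hpoly.coord[OF gen(1)]] test_fun_diff test_fun_deriv test_fun_cmult gen(2))
  moreover have "continuous_on UNIV (\<lambda>x. p x * Rad q \<psi> x)"
    by (intro continuous_intros continuous_Rad_test_fun hpoly_continuous gen(2)) (rule gen(1))
  ultimately show ?case using h e by auto
next
  case (add f g)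
  have h: "hasPD i (\<lambda>x. f x + g x) x (pd i f x + pd i g x)" for x using add by (intro hasPD_add) auto
  then have e: "pd i (\<lambda>x. f x + g x) = (\<lambda>x. pd i f x + pd i g x)" using hasPD_pd by blast
  show ?case using h add unfolding e by (auto intro: radial_test.intros continuous_intros)
qed

lemma radial_test_smooth: assumes "radial_test f" shows "smooth f"
proof -
  have "radial_test (fold pd is f)" for "is" using assms
    by (induction "is" arbitrary: f) (use radial_test_pd in auto)
  then show ?thesis unfolding smooth_def using radial_test_pd unfolding hasPD_def real_differentiable_def by blast
qed

lemma radial_test_support: "radial_test f \<Longrightarrow> \<exists>r>0. \<exists>R. \<forall>x. f x \<noteq> 0 \<longrightarrow> r \<le> norm x \<and> norm x \<le> R"
proof (induction rule: radial_test.induct)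
  case (gen d p \<psi> q)
  obtain \<delta> where d: "\<delta> > 0" "\<And>q x. x \<in> ball (0::real^'a) \<delta> \<Longrightarrow> Rad q \<psi> x = 0" using Rad_test_fun_zero_near[OF gen(2)] by metis
  obtain R where R: "\<And>q x. R \<le> norm (x::real^'a) \<Longrightarrow> Rad q \<psi> x = 0" using Rad_test_fun_zero_far[OF gen(2)] by metis
  show ?case using d R by (intro exI[of _ \<delta>] conjI exI[of _ R]) (auto simp: not_less[symmetric] intro: ccontr)
next
  case (add f g)
  then obtain r R r' R' where "r > 0" "\<And>x. f x \<noteq> 0 \<Longrightarrow> r \<le> norm x \<and> norm x \<le> R" "r' > 0" "\<And>x. g x \<noteq> 0 \<Longrightarrow> r' \<le> norm x \<and> norm x \<le> R'" by metis
  note a = this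
  have "min r r' \<le> norm x \<and> norm x \<le> max R R'" if "f x + g x \<noteq> 0" for x
  proof -
    have "f x \<noteq> 0 \<or> g x \<noteq> 0" using that by auto
    then show ?thesis using a(2)[of x] a(4)[of x] by auto
  qed
  then show ?case using a(1,3) by (intro exI[of _ "min r r'"] conjI exI[of _ "max R R'"] allI impI) auto
qed

lemma radial_test_testfun: assumes "radial_test f" shows "testfun (UNIV - {0}) f"
proof -
  obtain r R where r: "r > 0" "\<And>x. f x \<noteq> 0 \<Longrightarrow> r \<le> norm x \<and> norm x \<le> R" using radial_test_support[OF assms] by blast
  have cl: "closed {x::real^'a. r \<le> norm x \<and> norm x \<le> R}"
    by (intro closed_Collect_conj closed_Collect_le continuous_intros)
  have sub: "closure {x. f x \<noteq> 0} \<subseteq> {x. r \<le> norm x \<and> norm x \<le> R}"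
    by (rule closure_minimal[OF _ cl]) (use r in auto)
  have "bounded {x. r \<le> norm x \<and> norm (x::real^'a) \<le> R}" by (rule bounded_subset[OF bounded_cball[of 0 R]]) auto
  then have "compact (closure {x. f x \<noteq> 0})" using sub bounded_subset compact_eq_bounded_closed closed_closure by blast
  then show ?thesis unfolding testfun_def using radial_test_smooth[OF assms] sub r(1) by auto
qed

lemma testfun_mono: "testfun S f \<Longrightarrow> S \<subseteq> T \<Longrightarrow> testfun T f" unfolding testfun_def by blast

lemma testfun_hasPD: "testfun S f \<Longrightarrow> hasPD i f x (pd i f x)"
proof -
  assume "testfun S f"
  then have "(\<lambda>t. fold pd [] f (x + t *\<^sub>R axis i 1)) differentiable (at 0)" unfolding testfun_def smooth_def by blast
  then show ?thesis unfolding hasPD_def pd_def by (simp add: DERIV_deriv_iff_real_differentiable)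
qed

lemma testfun_continuous: "testfun S f \<Longrightarrow> continuous_on UNIV f"
proof -
  assume "testfun S f"
  then have "continuous_on UNIV (fold pd [] f)" unfolding testfun_def smooth_def by blast
  then show ?thesis by simp
qed

lemma testfun_pd: assumes "testfun S f" shows "testfun S (pd i f)"
proof -
  have "smooth (pd i f)" unfolding smooth_def
  proof (intro allI)
    fix "is"
    show "continuous_on UNIV (fold pd is (pd i f)) \<and> (\<forall>j x. (\<lambda>t. fold pd is (pd i f) (x + t *\<^sub>R axis j 1)) differentiable at 0)"
      using assms[unfolded testfun_def smooth_def, THEN conjunct1, rule_format, of "i # is"] by simp
  qed
  moreover have z: "pd i f x = 0" if "x \<notin> closure {x. f x \<noteq> 0}" for x
  proof -
    have "pd i f x = pd i (\<lambda>_. 0) x"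
      by (rule pd_transform[of "- closure {x. f x \<noteq> 0}"]) (use that closure_subset[of "{x. f x \<noteq> 0}"] in auto)
    then show ?thesis using hasPD_pd[OF hasPD_const[of i 0 x]] by simp
  qed
  then have "{x. pd i f x \<noteq> 0} \<subseteq> closure {x. f x \<noteq> 0}" by auto
  then have "closure {x. pd i f x \<noteq> 0} \<subseteq> closure {x. f x \<noteq> 0}" by (simp add: closure_minimal)
  ultimately show ?thesis using assms unfolding testfun_def
    by (meson bounded_subset closed_closure compact_eq_bounded_closed order_trans)
qed

lemma testfun_bounded_support: assumes "testfun S f" obtains R where "\<And>x. R \<le> norm x \<Longrightarrow> f x = 0"
proof -
  have "bounded (closure {x. f x \<noteq> 0})" using assms unfolding testfun_def by (simp add: compact_imp_bounded)
  then obtain R where "\<And>x. x \<in> closure {x. f x \<noteq> 0} \<Longrightarrow> norm x \<le> R" unfolding bounded_iff by blast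
  then have "f x = 0" if "R + 1 \<le> norm x" for x using that closure_subset[of "{x. f x \<noteq> 0}"] by force
  then show thesis using that by blast
qed

lemma testfun_zero_near: assumes "testfun (UNIV - {0}) f" obtains \<delta> where "\<delta> > 0" "\<And>x. x \<in> ball 0 \<delta> \<Longrightarrow> f x = 0"
proof -
  have "open (- closure {x. f x \<noteq> 0})" "0 \<in> - closure {x. f x \<noteq> 0}" using assms unfolding testfun_def by auto
  then obtain \<delta> where "\<delta> > 0" "ball 0 \<delta> \<subseteq> - closure {x. f x \<noteq> 0}" unfolding open_contains_ball by blast
  then show thesis using that[of \<delta>] closure_subset[of "{x. f x \<noteq> 0}"] by blast
qed

text \<open>f may be singular at the origin as long as the products vanish near it, because \<phi>
  or f does. The values f 0 = f' 0 = 0 are those that \<open>Rad\<close> takes there.\<close>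

lemma integral_by_parts_pd:
  fixes f f' \<phi> :: "real^'n::finite \<Rightarrow> real"
  assumes \<phi>: "testfun S \<phi>" and cf: "continuous_on (UNIV - {0}) f" "continuous_on (UNIV - {0}) f'"
    and df: "\<And>x. x \<noteq> 0 \<Longrightarrow> hasPD i f x (f' x)" and f0: "f 0 = 0" "f' 0 = 0"
    and \<delta>: "\<delta> > 0" and near: "(\<forall>x\<in>ball 0 \<delta>. \<phi> x = 0) \<or> (\<forall>x\<in>ball 0 \<delta>. f x = 0)"
  shows "(\<integral>x. f x * pd i \<phi> x \<partial>lborel) = - (\<integral>x. f' x * \<phi> x \<partial>lborel)" (is ?eq)
    "integrable lborel (\<lambda>x. f x * pd i \<phi> x)" (is ?i1) "integrable lborel (\<lambda>x. f' x * \<phi> x)" (is ?i2)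
proof -
  obtain R where R: "\<And>x. R \<le> norm x \<Longrightarrow> \<phi> x = 0" using testfun_bounded_support[OF \<phi>] by blast
  obtain R' where R': "\<And>x. R' \<le> norm x \<Longrightarrow> pd i \<phi> x = 0" using testfun_bounded_support[OF testfun_pd[OF \<phi>]] by blast
  have cp: "continuous_on (UNIV - {0}) \<phi>" "continuous_on (UNIV - {0}) (pd i \<phi>)"
    using testfun_continuous[OF \<phi>] testfun_continuous[OF testfun_pd[OF \<phi>]] continuous_on_subset by blast+
  have zero_pd: "pd i g x = 0" if "\<forall>x\<in>ball 0 \<delta>. g x = 0" "x \<in> ball 0 \<delta>" for g :: "real^'n \<Rightarrow> real" and x
    using pd_transform[of "ball 0 \<delta>" x g "\<lambda>_. 0" i] that hasPD_pd[OF hasPD_const[of i 0 x]] by simp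
  have f'z: "f' x = 0" if "\<forall>x\<in>ball 0 \<delta>. f x = 0" "x \<in> ball 0 \<delta>" for x
    using zero_pd[OF that] hasPD_pd[OF df[of x]] f0 by (cases "x = 0") auto
  have z1: "f x * pd i \<phi> x = 0" if "x \<in> ball 0 \<delta>" for x using near zero_pd[of \<phi> x] that by auto
  have z2: "f' x * \<phi> x = 0" if "x \<in> ball 0 \<delta>" for x using near f'z[of x] that by auto
  have z3: "f x * \<phi> x = 0" if "x \<in> ball 0 \<delta>" for x using near that by auto
  have c1: "continuous_on UNIV (\<lambda>x. f x * pd i \<phi> x)"
    by (rule continuous_off_zero[OF _ \<delta> z1]) (intro continuous_intros cf cp)
  have c2: "continuous_on UNIV (\<lambda>x. f' x * \<phi> x)"
    by (rule continuous_off_zero[OF _ \<delta> z2]) (intro continuous_intros cf cp)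
  have c3: "continuous_on UNIV (\<lambda>x. f x * \<phi> x)"
    by (rule continuous_off_zero[OF _ \<delta> z3]) (intro continuous_intros cf cp)
  have "(\<integral>x. f x * pd i \<phi> x + f' x * \<phi> x \<partial>lborel) = 0"
  proof (rule integral_directional_derivative_zero[where f="\<lambda>x. f x * \<phi> x" and R=R and e="axis i 1"])
    fix x :: "real^'n"
    have "hasPD i (\<lambda>x. f x * \<phi> x) x (f x * pd i \<phi> x + f' x * \<phi> x)"
    proof (cases "x = 0")
      case True
      have "hasPD i (\<lambda>x. f x * \<phi> x) x 0"
        by (rule hasPD_transform[OF hasPD_const[of i 0], of "ball 0 \<delta>"]) (use z3 True \<delta> in auto)
      then show ?thesis using True f0 by simp
    next
      case False
      show ?thesis by (rule hasPD_cong[OF hasPD_mult[OF df[OF False] testfun_hasPD[OF \<phi>]]]) simp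
    qed
    then show "((\<lambda>t. f (x + t *\<^sub>R axis i 1) * \<phi> (x + t *\<^sub>R axis i 1)) has_real_derivative f x * pd i \<phi> x + f' x * \<phi> x) (at 0)"
      unfolding hasPD_def .
  qed (use R c1 c2 c3 in \<open>auto intro: continuous_intros\<close>)
  moreover show i1: ?i1 by (rule integrable_continuous_compact_support[OF c1, of R']) (use R' in simp)
  moreover show i2: ?i2 by (rule integrable_continuous_compact_support[OF c2, of R]) (use R in simp)
  ultimately show ?eq by simp
qed

section \<open>The Laplacian and the weighted divergence on polynomials times radial
  functions\<close>

lemma hasPD_poly_Rad:
  assumes "hpoly d p" "\<And>t. (w has_real_derivative w1 t) (at t)" "x \<noteq> 0"
  shows "hasPD i (\<lambda>x. p x * Rad q w x) x (pd i p x * Rad q w x + (x $ i * p x) * Rad (q + 2) (\<lambda>t. w1 t - q * w t) x)"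
proof -
  have p: "hasPD i p x (pd i p x)" using hpoly_pd[OF assms(1)] by auto
  show ?thesis by (rule hasPD_cong[OF hasPD_mult[OF p hasPD_Rad[OF assms(3,2)]]]) simp
qed

lemma hasPD_field:
  fixes x :: "real^'n::finite"
  assumes p: "hpoly d p" and w: "\<And>t. (w has_real_derivative w1 t) (at t)" and u: "\<And>t. (u has_real_derivative u1 t) (at t)" and x: "x \<noteq> 0"
  shows "hasPD i (\<lambda>x. pd i p x * Rad a w x + (x $ i * p x) * Rad (a + 2) u x) x
    (pd i (pd i p) x * Rad a w x + (x $ i * pd i p x) * Rad (a + 2) (\<lambda>t. w1 t - a * w t) x
     + (p x * Rad (a + 2) u x + (x $ i * pd i p x) * Rad (a + 2) u x
     + (x $ i * x $ i) * p x * Rad (a + 4) (\<lambda>t. u1 t - (a + 2) * u t) x))"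
proof -
  have p1: "hpoly (d - 1) (pd i p)" "\<And>x. hasPD i p x (pd i p x)" using hpoly_pd[OF p] by auto
  have h1: "hasPD i (\<lambda>x. x $ i * p x) x (p x + x $ i * pd i p x)"
    by (rule hasPD_cong[OF hasPD_mult[OF hasPD_coord p1(2)]]) simp
  show ?thesis
    by (intro hasPD_add hasPD_poly_Rad[OF p1(1) w x])
       (rule hasPD_cong[OF hasPD_mult[OF h1 hasPD_Rad[OF x u]]], simp add: algebra_simps)
qed

text \<open>Both the gradient of p |x|^-q w and its multiple by |x|^-2 are fields of this shape, so
  one computation serves both operators. Euler's identity turns x . grad p into d p, and |x|^2
  lowers an exponent by two.\<close>

lemma div_field:
  fixes x :: "real^'n::finite"
  assumes p: "hpoly d p" and w: "\<And>t. (w has_real_derivative w1 t) (at t)" and u: "\<And>t. (u has_real_derivative u1 t) (at t)" and x: "x \<noteq> 0"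
  shows "(\<Sum>i\<in>UNIV. pd i (\<lambda>x. pd i p x * Rad a w x + (x $ i * p x) * Rad (a + 2) u x) x)
     = clap p x * Rad a w x + p x * Rad (a + 2) (\<lambda>t. real d * (w1 t - a * w t) + (real CARD('n) + real d) * u t + u1 t - (a + 2) * u t) x"
proof -
  have xx: "(\<Sum>i\<in>UNIV. x $ i * x $ i) = (norm x)\<^sup>2" by (simp add: power2_norm_eq_inner inner_vec_def)
  have "(\<Sum>i\<in>UNIV. pd i (\<lambda>x. pd i p x * Rad a w x + (x $ i * p x) * Rad (a + 2) u x) x)
     = (\<Sum>i\<in>UNIV. pd i (pd i p) x * Rad a w x + (x $ i * pd i p x) * Rad (a + 2) (\<lambda>t. w1 t - a * w t) x
     + (p x * Rad (a + 2) u x + (x $ i * pd i p x) * Rad (a + 2) u x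
     + (x $ i * x $ i) * p x * Rad (a + 4) (\<lambda>t. u1 t - (a + 2) * u t) x))"
    by (intro sum.cong refl hasPD_pd hasPD_field[OF p w u x])
  also have "\<dots> = clap p x * Rad a w x + (real d * p x) * Rad (a + 2) (\<lambda>t. w1 t - a * w t) x
     + (real CARD('n) * p x * Rad (a + 2) u x + (real d * p x) * Rad (a + 2) u x
     + p x * ((norm x)\<^sup>2 * Rad (a + 2 + 2) (\<lambda>t. u1 t - (a + 2) * u t) x))"
    by (simp add: sum.distrib sum_distrib_right[symmetric] hpoly_euler[OF p] clap_def xx add.commute[of 4 a])
  also have "\<dots> = clap p x * Rad a w x + p x * Rad (a + 2) (\<lambda>t. real d * (w1 t - a * w t) + (real CARD('n) + real d) * u t + u1 t - (a + 2) * u t) x"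
    unfolding Rad_norm2 by (simp add: Rad_def algebra_simps)
  finally show ?thesis .
qed

definition wdiv :: "(real^'n::finite \<Rightarrow> real) \<Rightarrow> real^'n \<Rightarrow> real" where
  "wdiv f x = (\<Sum>i\<in>UNIV. pd i (\<lambda>x. pd i f x / norm x ^ 2) x)"

lemma clap_poly_Rad:
  fixes x :: "real^'n::finite"
  assumes p: "hpoly d p" and w: "\<And>t. (w has_real_derivative w1 t) (at t)" "\<And>t. (w1 has_real_derivative w2 t) (at t)" and x: "x \<noteq> 0"
  shows "clap (\<lambda>x. p x * Rad q w x) x = clap p x * Rad q w x
    + p x * Rad (q + 2) (\<lambda>t. (w2 t - q * w1 t) + (real CARD('n) + 2 * real d - q - 2) * (w1 t - q * w t)) x"
proof -
  have u: "((\<lambda>t. w1 t - q * w t) has_real_derivative w2 t - q * w1 t) (at t)" for t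
    by (auto intro!: derivative_eq_intros w)
  have "pd i (pd i (\<lambda>x. p x * Rad q w x)) x = pd i (\<lambda>x. pd i p x * Rad q w x + (x $ i * p x) * Rad (q + 2) (\<lambda>t. w1 t - q * w t) x) x" for i
    by (rule pd_transform[of "UNIV - {0}"]) (use x hasPD_pd[OF hasPD_poly_Rad[OF p w(1)]] in auto)
  then show ?thesis unfolding clap_def[of "\<lambda>x. p x * Rad q w x"] using div_field[OF p w(1) u x, of q]
    by (simp add: algebra_simps)
qed

lemma wdiv_poly_Rad:
  fixes x :: "real^'n::finite"
  assumes p: "hpoly d p" and w: "\<And>t. (w has_real_derivative w1 t) (at t)" "\<And>t. (w1 has_real_derivative w2 t) (at t)" and x: "x \<noteq> 0"
  shows "wdiv (\<lambda>x. p x * Rad q w x) x = clap p x * Rad (q + 2) w x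
    + p x * Rad (q + 4) (\<lambda>t. (w2 t - q * w1 t) + (real CARD('n) + 2 * real d - q - 4) * (w1 t - q * w t) - 2 * real d * w t) x"
proof -
  have u: "((\<lambda>t. w1 t - q * w t) has_real_derivative w2 t - q * w1 t) (at t)" for t
    by (auto intro!: derivative_eq_intros w)
  have "pd i (\<lambda>x. pd i (\<lambda>x. p x * Rad q w x) x / norm x ^ 2) x =
     pd i (\<lambda>x. pd i p x * Rad (q + 2) w x + (x $ i * p x) * Rad ((q + 2) + 2) (\<lambda>t. w1 t - q * w t) x) x" for i

  proof (rule pd_transform[of "UNIV - {0}"])
    fix y :: "real^'n" assume "y \<in> UNIV - {0}"
    then have y: "y \<noteq> 0" by simp
    have r2: "Rad q w y / norm y ^ 2 = Rad (q + 2) w y" for q w using Rad_divide_norm[of q w y 2] by simp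
    show "pd i (\<lambda>x. p x * Rad q w x) y / norm y ^ 2 = pd i p y * Rad (q + 2) w y + (y $ i * p y) * Rad ((q + 2) + 2) (\<lambda>t. w1 t - q * w t) y"
      by (simp only: hasPD_pd[OF hasPD_poly_Rad[OF p w(1) y]] add_divide_distrib times_divide_eq_right[symmetric] r2)
  qed (use x in auto)
  then show ?thesis unfolding wdiv_def using div_field[OF p w(1) u x, of "q + 2"]
    by (simp add: algebra_simps)
qed

lemma pd_zero_near: "\<delta> > 0 \<Longrightarrow> (\<And>x. x \<in> ball 0 \<delta> \<Longrightarrow> f x = 0) \<Longrightarrow> x \<in> ball 0 \<delta> \<Longrightarrow> pd i f x = 0"
  using pd_transform[of "ball 0 \<delta>" x f "\<lambda>_. 0" i] hasPD_pd[OF hasPD_const[of i 0 x]] by simp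

lemma radial_test_zero_near: assumes "radial_test f" obtains \<delta> where "\<delta> > 0" "\<And>x. x \<in> ball 0 \<delta> \<Longrightarrow> f x = 0"
proof -
  obtain r R where r: "r > 0" "\<And>x. f x \<noteq> 0 \<Longrightarrow> r \<le> norm x \<and> norm x \<le> R" using radial_test_support[OF assms] by blast
  have "f x = 0" if "x \<in> ball 0 r" for x using that r(2)[of x] by force
  then show thesis using that r by blast
qed

lemma clap_0: assumes "radial_test f" shows "clap f 0 = 0"
proof -
  obtain \<delta> where d: "\<delta> > 0" "\<And>x. x \<in> ball 0 \<delta> \<Longrightarrow> f x = 0" using radial_test_zero_near[OF assms] by blast
  have "pd i (pd i f) 0 = 0" for i by (rule pd_zero_near[OF d(1) pd_zero_near[OF d]]) (use d in auto)
  then show ?thesis by (simp add: clap_def)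
qed

lemma wdiv_0: assumes "radial_test f" shows "wdiv f 0 = 0"
proof -
  obtain \<delta> where d: "\<delta> > 0" "\<And>x. x \<in> ball 0 \<delta> \<Longrightarrow> f x = 0" using radial_test_zero_near[OF assms] by blast
  have "pd i (\<lambda>x. pd i f x / norm x ^ 2) 0 = 0" for i
    by (rule pd_zero_near[OF d(1)]) (use d pd_zero_near[OF d] in auto)
  then show ?thesis by (simp add: wdiv_def)
qed

lemma clap_test_fun:
  fixes p :: "real^'n::finite \<Rightarrow> real"
  assumes "hpoly d p" "test_fun \<psi>"
  shows "clap (\<lambda>x. p x * Rad q \<psi> x) = (\<lambda>x. clap p x * Rad q \<psi> x + p x * Rad (q + 2)
     (\<lambda>t. (deriv (deriv \<psi>) t - q * deriv \<psi> t) + (real CARD('n) + 2 * real d - q - 2) * (deriv \<psi> t - q * \<psi> t)) x)"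
proof
  fix x :: "real^'n"
  show "clap (\<lambda>x. p x * Rad q \<psi> x) x = clap p x * Rad q \<psi> x + p x * Rad (q + 2)
     (\<lambda>t. (deriv (deriv \<psi>) t - q * deriv \<psi> t) + (real CARD('n) + 2 * real d - q - 2) * (deriv \<psi> t - q * \<psi> t)) x"
    by (cases "x = 0")
       (simp add: clap_0[OF radial_test.gen[OF assms]], rule clap_poly_Rad[OF assms(1) test_fun_DERIV test_fun_DERIV[OF test_fun_deriv]], use assms in auto)
qed

lemma wdiv_test_fun:
  fixes p :: "real^'n::finite \<Rightarrow> real"
  assumes "hpoly d p" "test_fun \<psi>"
  shows "wdiv (\<lambda>x. p x * Rad q \<psi> x) = (\<lambda>x. clap p x * Rad (q + 2) \<psi> x + p x * Rad (q + 4)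
     (\<lambda>t. (deriv (deriv \<psi>) t - q * deriv \<psi> t) + (real CARD('n) + 2 * real d - q - 4) * (deriv \<psi> t - q * \<psi> t) - 2 * real d * \<psi> t) x)"
proof
  fix x :: "real^'n"
  show "wdiv (\<lambda>x. p x * Rad q \<psi> x) x = clap p x * Rad (q + 2) \<psi> x + p x * Rad (q + 4)
     (\<lambda>t. (deriv (deriv \<psi>) t - q * deriv \<psi> t) + (real CARD('n) + 2 * real d - q - 4) * (deriv \<psi> t - q * \<psi> t) - 2 * real d * \<psi> t) x"
    by (cases "x = 0")
       (simp add: wdiv_0[OF radial_test.gen[OF assms]], rule wdiv_poly_Rad[OF assms(1) test_fun_DERIV test_fun_DERIV[OF test_fun_deriv]], use assms in auto)
qed

lemma clap_radial_test_add: assumes "radial_test f" "radial_test g" shows "clap (\<lambda>x. f x + g x) = (\<lambda>x. clap f x + clap g x)"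
proof -
  have 1: "pd i (\<lambda>x. f x + g x) = (\<lambda>x. pd i f x + pd i g x)" if "radial_test f" "radial_test g" for i f g
    by (rule ext, rule hasPD_pd, rule hasPD_add) (use radial_test_pd that in blast)+
  have "radial_test (pd i f)" "radial_test (pd i g)" for i using radial_test_pd assms by blast+
  then show ?thesis unfolding clap_def[abs_def] using assms by (simp add: 1 sum.distrib)
qed

lemma radial_test_sum: "finite A \<Longrightarrow> A \<noteq> {} \<Longrightarrow> (\<And>i. i \<in> A \<Longrightarrow> radial_test (f i)) \<Longrightarrow> radial_test (\<lambda>x. \<Sum>i\<in>A. f i x)"
  by (induction A rule: finite_ne_induct) (auto intro: radial_test.add)

lemma radial_test_clap: "radial_test f \<Longrightarrow> radial_test (clap f)"
  unfolding clap_def[abs_def] by (intro radial_test_sum) (use radial_test_pd in auto)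

lemma radial_test_divide_norm: "radial_test f \<Longrightarrow> radial_test (\<lambda>x. f x / norm x ^ k)"
proof (induction rule: radial_test.induct)
  case (gen d p \<psi> q)
  then show ?case using radial_test.gen[OF gen, of "q + real k"] by (simp add: Rad_divide_norm[symmetric])
next
  case (add f g) then show ?case using radial_test.add[OF add.IH] by (simp add: add_divide_distrib)
qed

text \<open>For this q the two Laplacians act on \<psi> by D^2 + 2 D - q (q+2) and by D^2 - 2 D - q
  (q+2). The product (D^2 - q (q+2))^2 - 4 D^2 has no odd-order terms. All other terms carry a
  Laplacian of p.\<close>

lemma clap_test_fun_test_fun:
  fixes p :: "real^'n::finite \<Rightarrow> real"
  assumes p: "hpoly d p" and pe: "hpoly e (clap p)" and \<psi>: "test_fun \<psi>" and q: "2 * q + 4 = real CARD('n) + 2 * real d"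
  obtains \<psi>1 where "test_fun \<psi>1"
   "clap (clap (\<lambda>x. p x * Rad q \<psi> x)) = (\<lambda>x. clap (clap p) x * Rad q \<psi> x + clap p x * Rad (q + 2) \<psi>1 x
     + p x * Rad (q + 4) (\<lambda>t. (deriv ^^ 4) \<psi> t - (2 * (q * (q + 2)) + 4) * (deriv ^^ 2) \<psi> t + (q * (q + 2))\<^sup>2 * \<psi> t) x)"
proof -
  define c where "c = real CARD('n) + 2 * real d"
  have c: "c = 2 * q + 4" using q by (simp add: c_def)
  define h where "h t = (deriv (deriv \<psi>) t - q * deriv \<psi> t) + (c - q - 2) * (deriv \<psi> t - q * \<psi> t)" for t
  define he where "he t = (deriv (deriv \<psi>) t - q * deriv \<psi> t) + (real CARD('n) + 2 * real e - q - 2) * (deriv \<psi> t - q * \<psi> t)" for t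
  note tt = test_fun_add test_fun_diff test_fun_cmult test_fun_deriv \<psi>
  have t: "test_fun h" "test_fun he" unfolding h_def he_def by (intro tt)+
  have 1: "clap (\<lambda>x. p x * Rad q \<psi> x) = (\<lambda>x. clap p x * Rad q \<psi> x + p x * Rad (q + 2) h x)"
    using clap_test_fun[OF p \<psi>, of q] by (simp add: h_def[abs_def] c_def)
  have 2: "clap (\<lambda>x. clap p x * Rad q \<psi> x) = (\<lambda>x. clap (clap p) x * Rad q \<psi> x + clap p x * Rad (q + 2) he x)"
    using clap_test_fun[OF pe \<psi>, of q] by (simp add: he_def[abs_def])
  have 3: "clap (\<lambda>x. p x * Rad (q + 2) h x) = (\<lambda>x. clap p x * Rad (q + 2) h x + p x * Rad (q + 2 + 2)
     (\<lambda>t. (deriv (deriv h) t - (q + 2) * deriv h t) + (c - (q + 2) - 2) * (deriv h t - (q + 2) * h t)) x)"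
    unfolding c_def by (rule clap_test_fun[OF p t(1)])
  have h': "h = (\<lambda>t. deriv (deriv \<psi>) t + 2 * deriv \<psi> t - q * (q + 2) * \<psi> t)" by (auto simp: h_def c algebra_simps)
  have d1: "deriv h = (\<lambda>t. deriv (deriv (deriv \<psi>)) t + 2 * deriv (deriv \<psi>) t - q * (q + 2) * deriv \<psi> t)"
    unfolding h' by (rule ext, rule DERIV_imp_deriv) (auto intro!: derivative_eq_intros test_fun_DERIV tt)
  have d2: "deriv (deriv h) = (\<lambda>t. deriv (deriv (deriv (deriv \<psi>))) t + 2 * deriv (deriv (deriv \<psi>)) t - q * (q + 2) * deriv (deriv \<psi>) t)"
    unfolding d1 by (rule ext, rule DERIV_imp_deriv) (auto intro!: derivative_eq_intros test_fun_DERIV tt)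
  have 4: "(\<lambda>t. (deriv (deriv h) t - (q + 2) * deriv h t) + (c - (q + 2) - 2) * (deriv h t - (q + 2) * h t))
     = (\<lambda>t. (deriv ^^ 4) \<psi> t - (2 * (q * (q + 2)) + 4) * (deriv ^^ 2) \<psi> t + (q * (q + 2))\<^sup>2 * \<psi> t)"
    unfolding d2 unfolding d1 unfolding h' c by (auto simp: fun_eq_iff numeral_eq_Suc algebra_simps power2_eq_square)
  have e: "q + 2 + 2 = q + 4" by simp
  have "clap (clap (\<lambda>x. p x * Rad q \<psi> x)) = (\<lambda>x. (clap (clap p) x * Rad q \<psi> x + clap p x * Rad (q + 2) he x) +
     (clap p x * Rad (q + 2) h x + p x * Rad (q + 4) (\<lambda>t. (deriv ^^ 4) \<psi> t - (2 * (q * (q + 2)) + 4) * (deriv ^^ 2) \<psi> t + (q * (q + 2))\<^sup>2 * \<psi> t) x))"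
    unfolding 1 clap_radial_test_add[OF radial_test.gen[OF pe \<psi>] radial_test.gen[OF p t(1)]] 2 3 4 e ..
  then show thesis
    by (intro that[of "\<lambda>t. he t + h t"] test_fun_add t) (auto simp: Rad_def algebra_simps)
qed

section \<open>From weak to very weak solutions\<close>

lemma locint_integrable_times:
  fixes u \<phi> :: "real^'n::finite \<Rightarrow> real"
  assumes "locint u" "continuous_on UNIV \<phi>" "\<And>x. R \<le> norm x \<Longrightarrow> \<phi> x = 0"
  shows "integrable lborel (\<lambda>x. u x * \<phi> x)"
proof -
  have "compact (\<phi> ` cball 0 R)" by (intro compact_continuous_image continuous_on_subset[OF assms(2)]) auto
  then obtain B where B: "\<And>x. x \<in> cball 0 R \<Longrightarrow> \<bar>\<phi> x\<bar> \<le> B"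
    using compact_imp_bounded bounded_iff by (metis imageI real_norm_def)
  have i: "integrable lborel (\<lambda>x. indicator (cball 0 R) x *\<^sub>R u x)"
    using assms(1) unfolding locint_def set_integrable_def by auto
  show ?thesis
  proof (rule Bochner_Integration.integrable_bound[OF integrable_mult_right[OF integrable_abs[OF i], of B]])
    show "(\<lambda>x. u x * \<phi> x) \<in> borel_measurable lborel"
      using assms(1) borel_measurable_continuous_onI[OF assms(2)] unfolding locint_def by (auto intro: borel_measurable_times)
    show "AE x in lborel. norm (u x * \<phi> x) \<le> norm (B * \<bar>indicator (cball 0 R) x *\<^sub>R u x\<bar>)"
    proof (intro AE_I2)
      fix x
      show "norm (u x * \<phi> x) \<le> norm (B * \<bar>indicator (cball 0 R) x *\<^sub>R u x\<bar>)"
      proof (cases "x \<in> cball 0 R")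
        case True
        have "\<bar>u x\<bar> * \<bar>\<phi> x\<bar> \<le> \<bar>u x\<bar> * \<bar>B\<bar>" using B[OF True] by (intro mult_left_mono) auto
        then show ?thesis using True by (simp add: abs_mult mult.commute)
      next
        case False then show ?thesis using assms(3)[of x] by simp
      qed
    qed
  qed
qed

lemma locint_integrable_testfun: "locint u \<Longrightarrow> testfun S \<phi> \<Longrightarrow> integrable lborel (\<lambda>x. u x * \<phi> x)"
  by (metis locint_integrable_times testfun_bounded_support testfun_continuous)

lemma locint_component:
  fixes G :: "real^'a::finite \<Rightarrow> real^'b::finite"
  assumes "locint G" shows "locint (\<lambda>x. G x $ i)"
  unfolding locint_def
proof (intro conjI allI impI)
  show "(\<lambda>x. G x $ i) \<in> borel_measurable lborel"

  proof -
    have g: "(\<lambda>y::real^'b. y $ i) \<in> borel_measurable borel" by (intro borel_measurable_continuous_onI continuous_intros)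
    show ?thesis using measurable_compose[OF _ g, of G lborel] assms unfolding locint_def by blast
  qed
  fix K :: "(real^'a) set" assume "compact K"
  then have "integrable lborel (\<lambda>x. indicator K x *\<^sub>R G x)" using assms unfolding locint_def set_integrable_def by blast
  from integrable_bounded_linear[OF bounded_linear_vec_nth[of i] this]
  show "set_integrable lborel K (\<lambda>x. G x $ i)" unfolding set_integrable_def by simp
qed

text \<open>All derivatives move to the test function, which stays in \<open>radial_test\<close>
  under every operation involved. The gradient term moves by one integration by parts, hence the
  change of sign in front of C1.\<close>

lemma weak_to_very_weak:
  fixes v Q :: "real^'n::finite \<Rightarrow> real"
  assumes G: "weak_grad v G" and L: "weak_lap v L" and f: "radial_test \<phi>"
    and eq: "(\<integral>x. L x * clap \<phi> x \<partial>lborel) - C1 * (\<integral>x. (G x \<bullet> cgrad \<phi> x) / norm x^2 \<partial>lborel)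
        + C2 * (\<integral>x. v x * \<phi> x / norm x^4 \<partial>lborel) = C3 * (\<integral>x. Q x * v x * \<phi> x \<partial>lborel)"
  shows "(\<integral>x. v x * clap (clap \<phi>) x \<partial>lborel) + C1 * (\<integral>x. v x * wdiv \<phi> x \<partial>lborel)
    + C2 * (\<integral>x. v x * (\<phi> x / norm x ^ 4) \<partial>lborel) = C3 * (\<integral>x. v x * (Q x * \<phi> x) \<partial>lborel)"
proof -
  have tU: "testfun UNIV g" if "radial_test g" for g :: "real^'n \<Rightarrow> real" using radial_test_testfun[OF that] testfun_mono by blast
  have 1: "(\<integral>x. L x * clap \<phi> x \<partial>lborel) = (\<integral>x. v x * clap (clap \<phi>) x \<partial>lborel)"
    using L tU[OF radial_test_clap[OF f]] unfolding weak_lap_def by simp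
  \<comment> \<open>The weight |x|^-2 goes to the test function, which remains admissible because
    its support avoids the origin.\<close>
  define g where "g i x = pd i \<phi> x / norm x ^ 2" for i x
  have g: "radial_test (g i)" for i unfolding g_def using radial_test_pd[OF f] by (intro radial_test_divide_norm) auto
  have lG: "locint G" "locint v" using G unfolding weak_grad_def by auto
  have "(\<integral>x. (G x \<bullet> cgrad \<phi> x) / norm x^2 \<partial>lborel) = (\<integral>x. (\<Sum>i\<in>UNIV. G x $ i * g i x) \<partial>lborel)"
    by (intro Bochner_Integration.integral_cong refl) (simp add: inner_vec_def cgrad_def g_def sum_divide_distrib)
  also have "\<dots> = (\<Sum>i\<in>UNIV. (\<integral>x. G x $ i * g i x \<partial>lborel))"
    by (intro Bochner_Integration.integral_sum locint_integrable_testfun[OF locint_component[OF lG(1)] tU[OF g]])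
  also have "\<dots> = (\<Sum>i\<in>UNIV. - (\<integral>x. v x * pd i (g i) x \<partial>lborel))"
    using G tU[OF g] unfolding weak_grad_def by simp
  also have "\<dots> = - (\<integral>x. (\<Sum>i\<in>UNIV. v x * pd i (g i) x) \<partial>lborel)"
    unfolding sum_negf
    by (subst Bochner_Integration.integral_sum) (use radial_test_pd[OF g] in \<open>auto intro!: locint_integrable_testfun[OF lG(2)] tU\<close>)
  also have "\<dots> = - (\<integral>x. v x * wdiv \<phi> x \<partial>lborel)"
    by (simp add: wdiv_def g_def[abs_def] sum_distrib_left)
  finally show ?thesis using eq 1 by (simp add: mult_ac)
qed

section \<open>Projection to a single mode\<close>

text \<open>The preimage of the interval from s (excluded) to s' (included) under ln |x|; as a
  difference of balls it is exactly what separates two values of the primitive W.\<close>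

definition shell :: "real \<Rightarrow> real \<Rightarrow> (real^'n::finite) set" where
  "shell s s' = cball 0 (exp s') - cball 0 (exp s)"

lemma le_exp_mono: "y \<le> exp s \<Longrightarrow> s \<le> s' \<Longrightarrow> y \<le> exp (s'::real)" "y \<le> 1 \<Longrightarrow> 0 \<le> s \<Longrightarrow> y \<le> exp s" "y \<le> exp s \<Longrightarrow> s \<le> 0 \<Longrightarrow> y \<le> (1::real)"
  by (meson exp_le_cancel_iff one_le_exp_iff exp_le_one_iff order_trans)+

lemma shell_measurable [measurable, simp]: "shell s s' \<in> sets borel" by (simp add: shell_def)

lemma shell_finite: "emeasure lborel (shell s s' :: (real^'n::finite) set) < \<infinity>"
proof -
  have "emeasure lborel (shell s s' :: (real^'n) set) \<le> emeasure lborel (cball (0::real^'n) (exp s'))"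
    by (rule emeasure_mono) (auto simp: shell_def)
  then show ?thesis using emeasure_lborel_cball_finite[of "0::real^'n" "exp s'"] by (simp add: order_le_less_trans)
qed

text \<open>Bounding |x|^-N by its value on the inner sphere and multiplying by the volume gives a
  bound in s' - s alone, as the measure |x|^-N dx is invariant under dilations.\<close>

lemma shell_norm_integral:
  fixes N :: real assumes N: "N = real CARD('n::finite)" and s: "s \<le> s'"
  shows "integrable lborel (\<lambda>x::real^'n. norm x powr (-N) * indicator (shell s s') x)"
    "(integral\<^sup>L lborel (\<lambda>x::real^'n. norm x powr (-N) * indicator (shell s s') x)) \<le> unit_ball_vol N * (exp (N * (s' - s)) - 1)"
proof -
  have i: "integrable lborel (\<lambda>x::real^'n. exp (- N * s) * indicator (shell s s') x)"
    using shell_finite by (intro integrable_mult_right integrable_real_indicator) auto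
  have b: "norm x powr (-N) * indicator (shell s s') x \<le> exp (- N * s) * indicator (shell s s') x" for x :: "real^'n"
  proof (cases "x \<in> shell s s'")
    case True
    then have "exp s \<le> norm x" by (simp add: shell_def)
    then have "norm x powr (-N) \<le> exp s powr (-N)" using N by (intro powr_mono2') auto
    then show ?thesis using True by (simp add: powr_def mult.commute)
  qed simp
  show 1: "integrable lborel (\<lambda>x::real^'n. norm x powr (-N) * indicator (shell s s') x)"
    by (rule Bochner_Integration.integrable_bound[OF i]) (use b in \<open>auto simp: indicator_def intro!: AE_I2\<close>)
  have "(integral\<^sup>L lborel (\<lambda>x::real^'n. norm x powr (-N) * indicator (shell s s') x)) \<le> (integral\<^sup>L lborel (\<lambda>x::real^'n. exp (- N * s) * indicator (shell s s') x))"
    by (rule integral_mono[OF 1 i]) (rule b)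
  also have "\<dots> = exp (- N * s) * measure lborel (shell s s' :: (real^'n) set)" by simp
  also have "measure lborel (shell s s' :: (real^'n) set) = measure lborel (cball (0::real^'n) (exp s')) - measure lborel (cball (0::real^'n) (exp s))"
    unfolding shell_def using s emeasure_lborel_cball_finite[of "0::real^'n" "exp s'"] by (intro measure_Diff) (auto simp: top_unique less_top[symmetric] dest: le_exp_mono)
  also have "\<dots> = unit_ball_vol N * (exp (N * s') - exp (N * s))"
    using content_cball[of "exp s'" "0::real^'n"] content_cball[of "exp s" "0::real^'n"]
    by (simp add: N right_diff_distrib exp_of_nat_mult[symmetric])
  also have "exp (- N * s) * \<dots> = unit_ball_vol N * (exp (N * (s' - s)) - 1)"
    by (simp add: algebra_simps exp_add[symmetric] exp_diff[symmetric] mult.left_commute)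
  finally show "(integral\<^sup>L lborel (\<lambda>x::real^'n. norm x powr (-N) * indicator (shell s s') x)) \<le> unit_ball_vol N * (exp (N * (s' - s)) - 1)" .
qed

text \<open>Dominated convergence: the unit shell leaves every point, to the right once |x| \<le>
  exp s, to the left once exp (s + 1) < |x|.\<close>

lemma shell_tail:
  fixes h :: "real^'n::finite \<Rightarrow> real"
  assumes h: "integrable lborel h"
  shows "((\<lambda>s. \<integral>x. h x * indicator (shell s (s + 1)) x \<partial>lborel) \<longlongrightarrow> 0) at_infinity"
proof -
  have m: "h \<in> borel_measurable lborel" using h by auto
  have b: "norm (h x * indicator S x) \<le> norm (h x)" for S :: "(real^'n) set" and x by (auto simp: indicator_def)
  have 1: "((\<lambda>s. \<integral>x. h x * indicator (shell s (s + 1)) x \<partial>lborel) \<longlongrightarrow> (integral\<^sup>L lborel (\<lambda>x::real^'n. 0))) at_top"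
  proof (rule integral_dominated_convergence_at_top[where w="\<lambda>x. norm (h x)"])
    show "AE x in lborel. ((\<lambda>s. h x * indicator (shell s (s + 1)) x) \<longlongrightarrow> 0) at_top"
    proof (intro AE_I2 tendsto_eventually)
      fix x :: "real^'n"
      have "\<forall>\<^sub>F s in at_top. norm x \<le> exp s" using exp_at_top by (simp add: filterlim_at_top)
      then show "\<forall>\<^sub>F s in at_top. h x * indicator (shell s (s + 1)) x = 0"
        by eventually_elim (simp add: shell_def)
    qed
  qed (use m h b in \<open>auto intro!: always_eventually AE_I2 borel_measurable_times\<close>)
  have 2: "((\<lambda>s. \<integral>x. h x * indicator (shell (-s) (-s + 1)) x \<partial>lborel) \<longlongrightarrow> (integral\<^sup>L lborel (\<lambda>x::real^'n. 0))) at_top"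
  proof (rule integral_dominated_convergence_at_top[where w="\<lambda>x. norm (h x)"])
    show "AE x in lborel. ((\<lambda>s. h x * indicator (shell (-s) (-s + 1)) x) \<longlongrightarrow> 0) at_top"
    proof (intro AE_I2 tendsto_eventually)
      fix x :: "real^'n"
      show "\<forall>\<^sub>F s in at_top. h x * indicator (shell (-s) (-s + 1)) x = 0"
      proof (cases "x = 0")
        case False
        have "\<forall>\<^sub>F s in at_top. 1 - ln (norm x) < s" by (rule eventually_gt_at_top)
        then have "\<forall>\<^sub>F s in at_top. exp (-s + 1) < norm x"
        proof eventually_elim
          case (elim s)
          then have "exp (-s + 1) < exp (ln (norm x))" by simp
          then show ?case using False by simp
        qed
        then show ?thesis by eventually_elim (simp add: shell_def)
      qed (simp add: shell_def)
    qed
  qed (use m h b in \<open>auto intro!: always_eventually AE_I2 borel_measurable_times\<close>)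
  show ?thesis using 1 2 by (simp add: at_infinity_eq_at_top_bot filterlim_sup filterlim_at_bot_mirror)
qed

text \<open>\<open>W\<close> is a primitive of the push-forward of \<open>f\<close> under \<open>ln |x|\<close>, which replaces polar coordinates.\<close>

lemma radial_primitive:
  fixes f :: "real^'n::finite \<Rightarrow> real"
  assumes f: "f \<in> borel_measurable lborel"
    and fi: "\<And>s s'. s \<le> s' \<Longrightarrow> integrable lborel (\<lambda>x. f x * indicator (shell s s') x)"
  defines "W \<equiv> (\<lambda>s. \<integral>x. f x * (indicator (cball 0 (exp s)) x - indicator (cball 0 1) x) \<partial>lborel)"
  shows "\<And>s s'. s \<le> s' \<Longrightarrow> W s' - W s = (\<integral>x. f x * indicator (shell s s') x \<partial>lborel)"
    and "\<And>g g' R. (\<And>t. (g has_real_derivative g' t) (at t)) \<Longrightarrow> continuous_on UNIV g' \<Longrightarrow>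
       (\<And>t. R \<le> \<bar>t\<bar> \<Longrightarrow> g t = 0) \<Longrightarrow> (\<And>t. R \<le> \<bar>t\<bar> \<Longrightarrow> g' t = 0) \<Longrightarrow>
      (\<integral>x. f x * g (ln (norm x)) \<partial>lborel) = - (\<integral>s. W s * g' s \<partial>lborel)"
proof -
  \<comment> \<open>Subtracting the unit ball normalises W to vanish at 0 and leaves a signed
    indicator of a shell, so that f may fail to be integrable at the origin.\<close>
  let ?k = "\<lambda>x s. indicator (cball (0::real^'n) (exp s)) x - indicator (cball 0 1) x :: real"
  have ki: "integrable lborel (\<lambda>x. f x * ?k x s)" for s
  proof (cases "0 \<le> s")
    case True
    have "1 \<le> exp s" using True by simp
    then have "(\<lambda>x. f x * ?k x s) = (\<lambda>x. f x * indicator (shell 0 s) x)" using True by (auto simp: fun_eq_iff shell_def indicator_def dest: le_exp_mono)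
    then show ?thesis using fi[OF True] by simp
  next
    case False
    have "exp s \<le> 1" using False by simp
    then have "(\<lambda>x. f x * ?k x s) = (\<lambda>x. - (f x * indicator (shell s 0) x))" using False by (auto simp: fun_eq_iff shell_def indicator_def dest: le_exp_mono)
    then show ?thesis using fi[of s 0] False by simp
  qed
  show "W s' - W s = (\<integral>x. f x * indicator (shell s s') x \<partial>lborel)" if "s \<le> s'" for s s'
  proof -
    have "W s' - W s = (\<integral>x. f x * ?k x s' - f x * ?k x s \<partial>lborel)"
      unfolding W_def by (rule Bochner_Integration.integral_diff[symmetric]) (rule ki)+
    also have "\<dots> = (\<integral>x. f x * indicator (shell s s') x \<partial>lborel)"
    proof (intro Bochner_Integration.integral_cong refl)
      fix x
      have "exp s \<le> exp s'" using that by simp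
      then show "f x * ?k x s' - f x * ?k x s = f x * indicator (shell s s') x"
        using that by (auto simp: shell_def indicator_def dest: le_exp_mono)
    qed
    finally show ?thesis .
  qed
  fix g g' R assume g: "\<And>t. (g has_real_derivative g' t) (at t)" and cg: "continuous_on UNIV g'"
    and R: "\<And>t. R \<le> \<bar>t\<bar> \<Longrightarrow> g t = 0" "\<And>t. R \<le> \<bar>t\<bar> \<Longrightarrow> g' t = (0::real)"
  have g'm: "g' \<in> borel_measurable borel" by (rule borel_measurable_continuous_onI[OF cg])
  have g'i: "integrable lborel g'" using R cg by (intro integrable_continuous_compact_support[where R=R]) auto
  define S where "S = \<bar>R\<bar>"
  have fS: "integrable lborel (\<lambda>x. f x * indicator (shell (-S) S) x)" by (rule fi) (simp add: S_def)
  \<comment> \<open>g' vanishes for |s| > S, and for |s| \<le> S the kernel is supported in one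
    fixed shell. This product majorant justifies Fubini.\<close>
  have Fb: "\<bar>f x * ?k x s * g' s\<bar> \<le> \<bar>f x * indicator (shell (-S) S) x\<bar> * \<bar>g' s\<bar>" for x s
  proof (cases "S < \<bar>s\<bar>")
    case True then show ?thesis using R(2)[of s] by (simp add: S_def)
  next
    case False
    then have "0 \<le> S" "-S \<le> s" "s \<le> S" by (auto simp: S_def)
    then have "norm x \<le> 1 \<longrightarrow> norm x \<le> exp S" "norm x \<le> exp (-S) \<longrightarrow> norm x \<le> 1"
      "norm x \<le> exp (-S) \<longrightarrow> norm x \<le> exp s" "norm x \<le> exp s \<longrightarrow> norm x \<le> exp S"
      using le_exp_mono(2)[of "norm x" S] le_exp_mono(3)[of "norm x" "-S"] le_exp_mono(1)[of "norm x" "-S" s] le_exp_mono(1)[of "norm x" s S]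
      by simp_all
    then have "\<bar>?k x s\<bar> \<le> indicator (shell (-S) S) x"
      unfolding indicator_def shell_def by (cases "norm x \<le> exp s"; cases "norm x \<le> 1"; simp)
    then show ?thesis by (simp add: abs_mult mult_left_mono mult_right_mono)
  qed
  have fm[measurable]: "f \<in> borel_measurable borel" using f by simp
  have gm[measurable]: "g' \<in> borel_measurable borel" by (rule g'm)
  have meas: "(\<lambda>(x, s). f x * ?k x s * g' s) \<in> borel_measurable (lborel \<Otimes>\<^sub>M lborel)"
  proof -
    have "(\<lambda>(x::real^'n, s). f x * ((if norm x \<le> exp s then 1 else 0) - (if norm x \<le> 1 then 1 else 0)) * g' s) \<in> borel_measurable (borel \<Otimes>\<^sub>M borel)"
      by measurable
    moreover have "(\<lambda>(x, s). f x * ?k x s * g' s) = (\<lambda>(x::real^'n, s). f x * ((if norm x \<le> exp s then 1 else 0) - (if norm x \<le> 1 then 1 else 0)) * g' s)"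
      by (auto simp: fun_eq_iff indicator_def)
    moreover have "sets (lborel \<Otimes>\<^sub>M lborel :: ((real^'n) \<times> real) measure) = sets (borel \<Otimes>\<^sub>M borel)"
      by (intro sets_pair_measure_cong) auto
    ultimately show ?thesis by (simp cong: measurable_cong_sets)
  qed
  have Gi: "integrable lborel (\<lambda>s. c * \<bar>g' s\<bar>)" for c using g'i by (intro integrable_mult_right integrable_abs)
  have Fx: "integrable lborel (\<lambda>s. f x * ?k x s * g' s)" for x
  proof (rule Bochner_Integration.integrable_bound[OF Gi])
    show "(\<lambda>s. f x * ?k x s * g' s) \<in> borel_measurable lborel"
      using measurable_compose[OF measurable_Pair1'[of x lborel lborel] meas] by simp
    show "AE s in lborel. norm (f x * ?k x s * g' s) \<le> norm (\<bar>f x * indicator (shell (-S) S) x\<bar> * \<bar>g' s\<bar>)"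
      using Fb by (auto intro!: AE_I2)
  qed
  have int: "integrable (lborel \<Otimes>\<^sub>M lborel) (\<lambda>(x, s). f x * ?k x s * g' s)"
  proof (rule lborel_pair.Fubini_integrable[OF meas])
    show "integrable lborel (\<lambda>x. \<integral>s. norm (case (x, s) of (x, s) \<Rightarrow> f x * ?k x s * g' s) \<partial>lborel)"
    proof (rule Bochner_Integration.integrable_bound[OF integrable_mult_left[OF integrable_abs[OF fS], of "\<integral>s. \<bar>g' s\<bar> \<partial>lborel"]])
      show "(\<lambda>x. \<integral>s. norm (case (x, s) of (x, s) \<Rightarrow> f x * ?k x s * g' s) \<partial>lborel) \<in> borel_measurable lborel"

      proof -
        have "(\<lambda>(x, s). norm (f x * ?k x s * g' s)) \<in> borel_measurable (lborel \<Otimes>\<^sub>M lborel)"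
          using measurable_compose[OF meas borel_measurable_norm] by (simp only: case_prod_unfold)
        from lborel.borel_measurable_lebesgue_integral[OF this] show ?thesis by (simp only: case_prod_conv)
      qed
      show "AE x in lborel. norm (\<integral>s. norm (case (x, s) of (x, s) \<Rightarrow> f x * ?k x s * g' s) \<partial>lborel) \<le> norm (\<bar>f x * indicator (shell (-S) S) x\<bar> * (\<integral>s. \<bar>g' s\<bar> \<partial>lborel))"
      proof (intro AE_I2)
        fix x
        have "(\<integral>s. norm (f x * ?k x s * g' s) \<partial>lborel) \<le> (\<integral>s. \<bar>f x * indicator (shell (-S) S) x\<bar> * \<bar>g' s\<bar> \<partial>lborel)"
          using Fb by (intro integral_mono integrable_norm Fx Gi) auto
        then show "norm (\<integral>s. norm (case (x, s) of (x, s) \<Rightarrow> f x * ?k x s * g' s) \<partial>lborel) \<le> norm (\<bar>f x * indicator (shell (-S) S) x\<bar> * (\<integral>s. \<bar>g' s\<bar> \<partial>lborel))"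
          by (simp add: abs_mult)
      qed
    qed
    show "AE x in lborel. integrable lborel (\<lambda>s. case (x, s) of (x, s) \<Rightarrow> f x * ?k x s * g' s)"
      using Fx by auto
  qed
  \<comment> \<open>The ball contains x when s \<ge> ln |x|, and over this half-line g' integrates
    to - g (ln |x|). The unit ball contributes a multiple of the total integral of g', which is
    0.\<close>
  have inner: "(\<integral>s. f x * ?k x s * g' s \<partial>lborel) = - (f x * g (ln (norm x)))" if x: "x \<noteq> 0" for x
  proof -
    define X where "X = ln (norm x)"
    define M where "M = max \<bar>R\<bar> \<bar>X\<bar> + 1"
    have tot: "(\<integral>s. g' s \<partial>lborel) = 0"
    proof -
      have "(\<integral>s. g' s * indicator {-M..M} s \<partial>lborel) = g M - g (-M)"
        using cg by (intro integral_FTC_Icc_real g) (auto simp: M_def continuous_on_eq_continuous_at)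
      moreover have "(\<lambda>s. g' s * indicator {-M..M} s) = g'"
      proof
        fix s show "g' s * indicator {-M..M} s = g' s" using R(2)[of s] by (cases "R \<le> \<bar>s\<bar>") (auto simp: M_def indicator_def)
      qed
      moreover have "g M = 0" "g (-M) = 0" using R(1)[of M] R(1)[of "-M"] by (auto simp: M_def)
      ultimately show ?thesis by simp
    qed
    have half: "(\<integral>s. g' s * indicator {X..M} s \<partial>lborel) = - g X"
    proof -
      have "(\<integral>s. g' s * indicator {X..M} s \<partial>lborel) = g M - g X"
        using cg by (intro integral_FTC_Icc_real g) (auto simp: M_def continuous_on_eq_continuous_at)
      moreover have "g M = 0" using R(1)[of M] by (auto simp: M_def)
      ultimately show ?thesis by simp
    qed
    have k: "f x * ?k x s * g' s = f x * (g' s * indicator {X..M} s) - f x * indicator (cball 0 1) x * g' s" for s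
    proof -
      have "norm x \<le> exp s \<longleftrightarrow> X \<le> s" 
      proof -
        have "norm x = exp X" using x by (simp add: X_def)
        then show ?thesis by simp
      qed
      then show ?thesis using R(2)[of s] by (cases "R \<le> \<bar>s\<bar>") (auto simp: indicator_def M_def algebra_simps)
    qed
    have "integrable lborel (\<lambda>s. g' s * indicator {X..M} s)"
      using integrable_mult_indicator[of "{X..M}" lborel g'] g'i by (simp add: mult.commute)
    then show ?thesis unfolding k using half tot g'i by (simp add: X_def)
  qed
  have "(\<integral>s. W s * g' s \<partial>lborel) = (\<integral>s. (\<integral>x. f x * ?k x s * g' s \<partial>lborel) \<partial>lborel)"
    unfolding W_def by simp
  also have "\<dots> = (\<integral>x. (\<integral>s. f x * ?k x s * g' s \<partial>lborel) \<partial>lborel)"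
    by (rule lborel_pair.Fubini_integral[OF int])
  also have "\<dots> = (\<integral>x. - (f x * g (ln (norm x))) \<partial>lborel)"
  proof (rule integral_cong_AE)
    have "AE x in lborel. x \<noteq> (0::real^'n)" by (rule AE_lborel_singleton)
    then show "AE x in lborel. (\<integral>s. f x * ?k x s * g' s \<partial>lborel) = - (f x * g (ln (norm x)))"
      using inner by auto
    show "(\<lambda>x. \<integral>s. f x * ?k x s * g' s \<partial>lborel) \<in> borel_measurable lborel"
      by (rule lborel.borel_measurable_lebesgue_integral[OF meas])
    have "g \<in> borel_measurable borel" using DERIV_isCont[OF g] by (intro borel_measurable_continuous_onI continuous_at_imp_continuous_on) auto
    then show "(\<lambda>x. - (f x * g (ln (norm x)))) \<in> borel_measurable lborel" by simp
  qed
  finally show "(\<integral>x. f x * g (ln (norm x)) \<partial>lborel) = - (\<integral>s. W s * g' s \<partial>lborel)" by simp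
qed

text \<open>Up to a constant, the integrand is at most the product of |u| / |x|^2 and |x|^(-N/2).
  Young's inequality with a free weight l bounds it by the energy density over l plus l times
  |x|^-N. Large l gives continuity of W, small l gives vanishing oscillation at infinity.\<close>

lemma mode_primitive:
  fixes u p :: "real^'n::finite \<Rightarrow> real"
  assumes N: "N = real CARD('n)" "N = 2 * m + 4" and um: "u \<in> borel_measurable lborel"
    and ui: "integrable lborel (\<lambda>x. (u x)\<^sup>2 / norm x ^ 4)" and p: "hpoly d p"
  obtains W where "continuous_on UNIV W"
    "\<And>\<epsilon>. \<epsilon> > 0 \<Longrightarrow> \<forall>\<^sub>F t in at_infinity. \<forall>s\<in>{t..t+1}. \<bar>W s - W t\<bar> \<le> \<epsilon>"
    "\<And>g g' R. (\<And>t. (g has_real_derivative g' t) (at t)) \<Longrightarrow> continuous_on UNIV g' \<Longrightarrow>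
       (\<And>t. R \<le> \<bar>t\<bar> \<Longrightarrow> g t = 0) \<Longrightarrow> (\<And>t. R \<le> \<bar>t\<bar> \<Longrightarrow> g' t = 0) \<Longrightarrow>
      (\<integral>x. u x * (p x * Rad (real d + m + 4) g x) \<partial>lborel) = - (\<integral>s. W s * g' s \<partial>lborel)"
proof -
  obtain C where C: "C \<ge> 0" "\<And>x. \<bar>p x\<bar> \<le> C * norm x ^ d" using hpoly_bound[OF p] by blast
  define E where "E x = (u x)\<^sup>2 / norm x ^ 4" for x
  define f where "f x = u x * p x * norm x powr (- (real d + m + 4))" for x
  have fE: "\<bar>f x\<bar> \<le> C * (E x / l + l * norm x powr (- N))" if l: "l > 0" for x l
  proof (cases "x = 0")
    case True then show ?thesis using C by (simp add: f_def E_def)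
  next
    case False
    define r where "r = norm x"
    have r: "r > 0" using False by (simp add: r_def)
    define b where "b = r powr (- m - 2)"
    define a where "a = \<bar>u x\<bar> / r\<^sup>2"
    have "\<bar>f x\<bar> = \<bar>u x\<bar> * \<bar>p x\<bar> * r powr (- (real d + m + 4))" by (simp add: f_def abs_mult r_def)
    also have "\<dots> \<le> \<bar>u x\<bar> * (C * r ^ d) * r powr (- (real d + m + 4))"
      using C(2)[of x] by (intro mult_right_mono mult_left_mono) (auto simp: r_def)
    also have "r ^ d = r powr real d" using r by (simp add: powr_realpow)
    also have "\<bar>u x\<bar> * (C * r powr real d) * r powr (- (real d + m + 4)) = C * (\<bar>u x\<bar> * (r powr real d * r powr (- (real d + m + 4))))" by simp
    also have "r powr real d * r powr (- (real d + m + 4)) = r powr (-2) * r powr (- m - 2)"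
      unfolding powr_add[symmetric] by (rule arg_cong[where f="\<lambda>z. r powr z"]) simp
    also have "\<bar>u x\<bar> * (r powr (-2) * r powr (- m - 2)) = a * b" using r by (simp add: a_def b_def powr_minus divide_inverse)
    finally have 1: "\<bar>f x\<bar> \<le> C * (a * b)" .
    have ab: "a \<ge> 0" "b \<ge> 0" by (auto simp: a_def b_def)
    have "0 \<le> (a - l * b)\<^sup>2 / l" using l by simp
    also have "\<dots> = a\<^sup>2 / l + l * b\<^sup>2 - 2 * (a * b)" using l by (simp add: power2_eq_square field_simps)
    finally have "2 * (a * b) \<le> a\<^sup>2 / l + l * b\<^sup>2" by simp
    moreover have "0 \<le> a * b" using ab by simp
    ultimately have "a * b \<le> a\<^sup>2 / l + l * b\<^sup>2" by linarith
    moreover have "a\<^sup>2 = E x" by (simp add: a_def E_def power_divide r_def flip: power_mult)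
    moreover have "b\<^sup>2 = r powr (-N)" using r by (simp add: b_def power2_eq_square powr_add[symmetric] N(2))
    ultimately have "a * b \<le> E x / l + l * norm x powr (-N)" by (simp add: r_def)
    then show ?thesis using 1 C(1) by (meson mult_left_mono order_trans)
  qed
  have pm: "p \<in> borel_measurable borel" by (rule borel_measurable_continuous_onI[OF hpoly_continuous[OF p]])
  have fm: "f \<in> borel_measurable lborel" unfolding f_def using um pm by simp
  have En: "0 \<le> E x" for x by (simp add: E_def)
  have Ei: "integrable lborel E" using ui by (simp add: E_def[abs_def])
  have Es: "integrable lborel (\<lambda>x. E x * indicator (shell s s') x)" for s s'
    using integrable_mult_indicator[of "shell s s'" lborel E] Ei by (simp add: mult.commute)
  have Bi: "integrable lborel (\<lambda>x. C * (E x * indicator (shell s s') x / l + l * (norm x powr (- N) * indicator (shell s s') x)))" if "s \<le> s'" for s s' l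
    using Es shell_norm_integral(1)[OF N(1) that] by (intro integrable_mult_right Bochner_Integration.integrable_add integrable_divide)
  have fb: "\<bar>f x * indicator (shell s s') x\<bar> \<le> C * (E x * indicator (shell s s') x / l + l * (norm x powr (- N) * indicator (shell s s') x))" if "l > 0" for x s s' l
    using fE[OF that, of x] by (cases "x \<in> shell s s'") auto
  have fi: "integrable lborel (\<lambda>x. f x * indicator (shell s s') x)" if "s \<le> s'" for s s'
  proof (rule Bochner_Integration.integrable_bound[OF Bi[OF that, of 1]])
    show "(\<lambda>x. f x * indicator (shell s s') x) \<in> borel_measurable lborel" using fm by simp
    show "AE x in lborel. norm (f x * indicator (shell s s') x) \<le> norm (C * (E x * indicator (shell s s') x / 1 + 1 * (norm x powr (- N) * indicator (shell s s') x)))"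
      using fb[of 1 _ s s'] by (auto intro!: AE_I2 order_trans[OF _ abs_ge_self] simp del: abs_mult)
  qed
  define W where "W s = (\<integral>x. f x * (indicator (cball 0 (exp s)) x - indicator (cball 0 1) x) \<partial>lborel)" for s
  have rp: "W s' - W s = (\<integral>x. f x * indicator (shell s s') x \<partial>lborel)" if "s \<le> s'" for s s'
    unfolding W_def by (rule radial_primitive(1)[OF fm]) (auto intro: fi that)
  define \<omega> where "\<omega> = unit_ball_vol N"
  have \<omega>: "\<omega> \<ge> 0" using N(1) by (simp add: \<omega>_def)
  have est: "\<bar>W s' - W s\<bar> \<le> C * ((\<integral>x. E x * indicator (shell s s') x \<partial>lborel) / l + l * (\<omega> * (exp (N * (s' - s)) - 1)))" if s: "s \<le> s'" and l: "l > 0" for s s' l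
  proof -
    have "\<bar>W s' - W s\<bar> = \<bar>\<integral>x. f x * indicator (shell s s') x \<partial>lborel\<bar>" using rp[OF s] by simp
    also have "\<dots> \<le> (\<integral>x. C * (E x * indicator (shell s s') x / l + l * (norm x powr (- N) * indicator (shell s s') x)) \<partial>lborel)"
      using fb[OF l, of _ s s'] by (intro order_trans[OF integral_abs_bound] integral_mono integrable_abs fi s Bi) auto
    also have "\<dots> = C * ((\<integral>x. E x * indicator (shell s s') x \<partial>lborel) / l + l * (integral\<^sup>L lborel (\<lambda>x::real^'n. norm x powr (- N) * indicator (shell s s') x)))"
      using Es shell_norm_integral(1)[OF N(1) s] by simp
    also have "\<dots> \<le> C * ((\<integral>x. E x * indicator (shell s s') x \<partial>lborel) / l + l * (\<omega> * (exp (N * (s' - s)) - 1)))"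
      using shell_norm_integral(2)[OF N(1) s] l C(1) unfolding \<omega>_def by (intro mult_left_mono add_left_mono) auto
    finally show ?thesis .
  qed
  define E0 where "E0 = integral\<^sup>L lborel E"
  have E0: "0 \<le> E0" unfolding E0_def using En by simp
  have EE0: "(\<integral>x. E x * indicator (shell s s') x \<partial>lborel) \<le> E0" for s s'
    unfolding E0_def by (intro integral_mono Es Ei) (auto simp: indicator_def En)
  have est': "\<bar>W s' - W s\<bar> \<le> C * (E0 / l + l * (\<omega> * (exp (N * \<bar>s' - s\<bar>) - 1)))" if "l > 0" for s s' l
  proof -
    have 1: "\<bar>W s' - W s\<bar> \<le> C * (E0 / l + l * (\<omega> * (exp (N * (s' - s)) - 1)))" if "s \<le> s'" for s s'
      by (rule order_trans[OF est[OF that \<open>l > 0\<close>]]) (use EE0 C(1) \<open>l > 0\<close> in \<open>intro mult_left_mono add_right_mono divide_right_mono; simp\<close>)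
    show ?thesis using 1[of s s'] 1[of s' s] by (cases "s \<le> s'") (auto simp: abs_minus_commute)
  qed
  have cW: "continuous_on UNIV W"
  proof (intro continuous_at_imp_continuous_on ballI)
    fix s :: real
    have "(W \<longlongrightarrow> W s) (at s)"
    proof (rule tendstoI)
      fix e :: real assume e: "e > 0"
      \<comment> \<open>Large l: C E0 / l stays below e/2, and the other term tends to 0 as t tends
        to s.\<close>
      define l where "l = 2 * (C * E0 + 1) / e"
      have CE: "C * E0 \<ge> 0" using C(1) E0 by simp
      have l: "l > 0" using e CE by (simp add: l_def)
      have le: "C * (E0 / l) < e / 2"
      proof -
        have "l * e = 2 * (C * E0 + 1)" using e by (simp add: l_def)
        then have "C * E0 < l * (e / 2)" by simp
        then show ?thesis using l by (simp add: pos_divide_less_eq mult.commute)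
      qed
      have "((\<lambda>t. C * (l * (\<omega> * (exp (N * \<bar>t - s\<bar>) - 1)))) \<longlongrightarrow> C * (l * (\<omega> * (exp (N * \<bar>s - s\<bar>) - 1)))) (at s)"
        by (intro tendsto_intros)
      then have "\<forall>\<^sub>F t in at s. C * (l * (\<omega> * (exp (N * \<bar>t - s\<bar>) - 1))) < e / 2"
        using e by (intro order_tendstoD(2)) auto
      then show "\<forall>\<^sub>F t in at s. dist (W t) (W s) < e"
      proof eventually_elim
        case (elim t)
        have "\<bar>W t - W s\<bar> \<le> C * (E0 / l) + C * (l * (\<omega> * (exp (N * \<bar>t - s\<bar>) - 1)))"
          using est'[OF l, of t s] by (simp add: distrib_left)
        then show ?case using elim le unfolding dist_real_def by linarith
      qed
    qed
    then show "isCont W s" by (simp add: isCont_def)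
  qed
  have osc: "\<forall>\<^sub>F t in at_infinity. \<forall>s\<in>{t..t+1}. \<bar>W s - W t\<bar> \<le> e" if e: "e > 0" for e
  proof -
    define B where "B = C * (\<omega> * (exp N - 1))"
    have B: "B \<ge> 0" unfolding B_def using C(1) \<omega> N by simp
    \<comment> \<open>Small l: the invariant mass of a unit shell contributes at most e/2, while the
      energy in the shell over the fixed l tends to 0.\<close>
    define l where "l = e / (2 * (B + 1))"
    have l: "l > 0" using e B by (simp add: l_def)
    have lB: "l * B \<le> e / 2"
    proof -
      have "l * (B + 1) = e / 2" using B by (simp add: l_def field_simps)
      moreover have "l * B \<le> l * (B + 1)" using l by simp
      ultimately show ?thesis by linarith
    qed
    have "((\<lambda>s. C * ((\<integral>x. E x * indicator (shell s (s + 1)) x \<partial>lborel) / l)) \<longlongrightarrow> C * (0 / l)) at_infinity"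
      using l by (intro tendsto_intros shell_tail[OF Ei]) auto
    then have "\<forall>\<^sub>F s in at_infinity. C * ((\<integral>x. E x * indicator (shell s (s + 1)) x \<partial>lborel) / l) < e / 2"
      using e by (intro order_tendstoD(2)) auto
    then show ?thesis
    proof eventually_elim
      case (elim t)
      show ?case
      proof
        fix s assume s: "s \<in> {t..t+1}"
        have m1: "(\<integral>x. E x * indicator (shell t s) x \<partial>lborel) \<le> (\<integral>x. E x * indicator (shell t (t+1)) x \<partial>lborel)"
        proof (intro integral_mono Es)
          fix x
          show "E x * indicator (shell t s) x \<le> E x * indicator (shell t (t+1)) x"
            using En[of x] s le_exp_mono(1)[of "norm x" s "t+1"] by (auto simp: indicator_def shell_def)
        qed
        have "exp (N * (s - t)) \<le> exp (N * 1)" using s N by (simp del: mult_1_right)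
        then have m2: "l * (\<omega> * (exp (N * (s - t)) - 1)) \<le> l * (\<omega> * (exp N - 1))"
          using l \<omega> by (intro mult_left_mono) auto
        have "\<bar>W s - W t\<bar> \<le> C * ((\<integral>x. E x * indicator (shell t s) x \<partial>lborel) / l + l * (\<omega> * (exp (N * (s - t)) - 1)))"
          using s by (intro est l) auto
        also have "\<dots> \<le> C * ((\<integral>x. E x * indicator (shell t (t+1)) x \<partial>lborel) / l + l * (\<omega> * (exp N - 1)))"
          using l C(1) by (intro mult_left_mono[OF add_mono[OF divide_right_mono[OF m1] m2]]) auto
        also have "\<dots> = C * ((\<integral>x. E x * indicator (shell t (t+1)) x \<partial>lborel) / l) + l * B"
          by (simp add: B_def algebra_simps)
        finally show "\<bar>W s - W t\<bar> \<le> e" using elim lB by linarith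
      qed
    qed
  qed
  show thesis
  proof (rule that[OF cW osc])
    fix g g' R assume g: "\<And>t. (g has_real_derivative g' t) (at t)" "continuous_on UNIV g'"
      "\<And>t. R \<le> \<bar>t\<bar> \<Longrightarrow> g t = 0" "\<And>t. R \<le> \<bar>t\<bar> \<Longrightarrow> g' t = (0::real)"
    have "(\<integral>x. u x * (p x * Rad (real d + m + 4) g x) \<partial>lborel) = (\<integral>x. f x * g (ln (norm x)) \<partial>lborel)"
      by (simp add: f_def Rad_def mult.assoc)
    also have "\<dots> = - (\<integral>s. W s * g' s \<partial>lborel)" unfolding W_def by (rule radial_primitive(2)[OF fm _ g]) (auto intro: fi)
    finally show "(\<integral>x. u x * (p x * Rad (real d + m + 4) g x) \<partial>lborel) = - (\<integral>s. W s * g' s \<partial>lborel)" .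
  qed auto
qed

text \<open>Regularity gives w0 = W'. Decay comes from the vanishing oscillation of W through the
  interior estimate, where boundedness of V controls the fourth derivative of w0 by w0 and
  w2.\<close>

lemma mode_ode:
  fixes u p :: "real^'n::finite \<Rightarrow> real"
  assumes N: "N = real CARD('n)" "N = 2 * m + 4" and um: "u \<in> borel_measurable lborel"
    and ui: "integrable lborel (\<lambda>x. (u x)\<^sup>2 / norm x ^ 4)" and p: "hpoly d p"
    and dV: "\<And>t. (V has_real_derivative V' t) (at t)" and cV': "continuous_on UNIV V'" and Vb: "\<And>t. \<bar>V t\<bar> \<le> K"
    and weak: "\<And>\<psi>. test_fun \<psi> \<Longrightarrow> (\<integral>x. u x * (p x * Rad (real d + m + 4)
        (\<lambda>t. (deriv ^^ 4) \<psi> t - a * (deriv ^^ 2) \<psi> t + b * \<psi> t - V t * \<psi> t) x) \<partial>lborel) = 0"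
  obtains w0 w1 w2 w3 where "\<And>t. (w0 has_real_derivative w1 t) (at t)"
    "\<And>t. (w1 has_real_derivative w2 t) (at t)" "\<And>t. (w2 has_real_derivative w3 t) (at t)"
    "\<And>t. (w3 has_real_derivative a * w2 t - b * w0 t + V t * w0 t) (at t)"
    "(w0 \<longlongrightarrow> 0) at_infinity" "(w1 \<longlongrightarrow> 0) at_infinity" "(w2 \<longlongrightarrow> 0) at_infinity" "(w3 \<longlongrightarrow> 0) at_infinity"
    "\<And>\<psi>. test_fun \<psi> \<Longrightarrow> (\<integral>x. u x * (p x * Rad (real d + m + 4) \<psi> x) \<partial>lborel) = (\<integral>t. w0 t * \<psi> t \<partial>lborel)"
proof -
  obtain W where W: "continuous_on UNIV W"
    "\<And>\<epsilon>. \<epsilon> > 0 \<Longrightarrow> \<forall>\<^sub>F t in at_infinity. \<forall>s\<in>{t..t+1}. \<bar>W s - W t\<bar> \<le> \<epsilon>"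
    "\<And>g g' R. (\<And>t. (g has_real_derivative g' t) (at t)) \<Longrightarrow> continuous_on UNIV g' \<Longrightarrow>
       (\<And>t. R \<le> \<bar>t\<bar> \<Longrightarrow> g t = 0) \<Longrightarrow> (\<And>t. R \<le> \<bar>t\<bar> \<Longrightarrow> g' t = 0) \<Longrightarrow>
      (\<integral>x. u x * (p x * Rad (real d + m + 4) g x) \<partial>lborel) = - (\<integral>s. W s * g' s \<partial>lborel)"
    using mode_primitive[OF N um ui p] by blast
  have cV: "continuous_on UNIV V" using DERIV_isCont[OF dV] by (auto intro!: continuous_at_imp_continuous_on)
  \<comment> \<open>The function tested in \<open>weak\<close> is put for g in the formula for W. It
    contains V \<psi>, and V is only known to be continuously differentiable; for this reason that
    formula admits such g and not just test functions.\<close>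
  have "(\<integral>t. W t * ((deriv ^^ 5) \<psi> t - a * (deriv ^^ 3) \<psi> t + b * deriv \<psi> t - (V t * deriv \<psi> t + V' t * \<psi> t)) \<partial>lborel) = 0" if \<psi>: "test_fun \<psi>" for \<psi>
  proof -
    have t: "test_fun ((deriv ^^ k) \<psi>)" for k by (rule test_fun_funpow[OF \<psi>])
    have dd: "((deriv ^^ k) \<psi> has_real_derivative (deriv ^^ Suc k) \<psi> t) (at t)" for k t using test_fun_DERIV[OF t[of k]] by simp
    have d0: "(\<psi> has_real_derivative deriv \<psi> t) (at t)" for t by (rule test_fun_DERIV[OF \<psi>])
    have "\<exists>R. \<forall>t. R \<le> \<bar>t\<bar> \<longrightarrow> (deriv ^^ k) \<psi> t = 0" for k using test_fun_support[OF t[of k]] by blast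
    then obtain R where R: "\<And>k t. R k \<le> \<bar>t\<bar> \<Longrightarrow> (deriv ^^ k) \<psi> t = 0" by metis
    define S where "S = Max (R ` {..5})"
    have S: "(deriv ^^ k) \<psi> t = 0" if "S \<le> \<bar>t\<bar>" "k \<le> 5" for k t
    proof (rule R)
      have "R k \<le> S" unfolding S_def using that(2) by (intro Max_ge) auto
      then show "R k \<le> \<bar>t\<bar>" using that(1) by simp
    qed
    have S0: "\<psi> t = 0" "deriv \<psi> t = 0" if "S \<le> \<bar>t\<bar>" for t using S[OF that, of 0] S[OF that, of 1] by auto
    have "(\<integral>x. u x * (p x * Rad (real d + m + 4) (\<lambda>t. (deriv ^^ 4) \<psi> t - a * (deriv ^^ 2) \<psi> t + b * \<psi> t - V t * \<psi> t) x) \<partial>lborel)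
      = - (\<integral>t. W t * ((deriv ^^ 5) \<psi> t - a * (deriv ^^ 3) \<psi> t + b * deriv \<psi> t - (V t * deriv \<psi> t + V' t * \<psi> t)) \<partial>lborel)"
    proof (rule W(3)[where R=S])
      show "((\<lambda>t. (deriv ^^ 4) \<psi> t - a * (deriv ^^ 2) \<psi> t + b * \<psi> t - V t * \<psi> t) has_real_derivative
         (deriv ^^ 5) \<psi> t - a * (deriv ^^ 3) \<psi> t + b * deriv \<psi> t - (V t * deriv \<psi> t + V' t * \<psi> t)) (at t)" for t
      proof -
        have 4: "((deriv ^^ 4) \<psi> has_real_derivative (deriv ^^ 5) \<psi> t) (at t)" using dd[of 4 t] by (simp add: eval_nat_numeral)
        have 2: "((deriv ^^ 2) \<psi> has_real_derivative (deriv ^^ 3) \<psi> t) (at t)" using dd[of 2 t] by (simp add: eval_nat_numeral)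
        show ?thesis by (rule derivative_eq_intros 4 2 d0 dV refl | simp del: funpow.simps)+
      qed
      show "continuous_on UNIV (\<lambda>t. (deriv ^^ 5) \<psi> t - a * (deriv ^^ 3) \<psi> t + b * deriv \<psi> t - (V t * deriv \<psi> t + V' t * \<psi> t))"
        by (intro continuous_intros test_fun_continuous t test_fun_deriv \<psi> cV cV')
    qed (simp_all add: S S0 del: funpow.simps)
    then show ?thesis using weak[OF \<psi>] by simp
  qed
  then obtain w0 w1 w2 w3 where w: "\<And>t. (W has_real_derivative w0 t) (at t)" "\<And>t. (w0 has_real_derivative w1 t) (at t)"
    "\<And>t. (w1 has_real_derivative w2 t) (at t)" "\<And>t. (w2 has_real_derivative w3 t) (at t)"
    "\<And>t. (w3 has_real_derivative a * w2 t - b * w0 t + V t * w0 t) (at t)"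
    using weak_ode_regularity[OF W(1) dV cV', of a b] by blast
  define K' where "K' = \<bar>a\<bar> + \<bar>b\<bar> + K"
  have K0: "0 \<le> K" using Vb[of 0] by linarith
  have b4: "\<bar>a * w2 t - b * w0 t + V t * w0 t\<bar> \<le> K' * (\<bar>w0 t\<bar> + \<bar>w2 t\<bar>)" for t
  proof -
    have "\<bar>a * w2 t - b * w0 t + V t * w0 t\<bar> \<le> \<bar>a * w2 t\<bar> + \<bar>b * w0 t\<bar> + \<bar>V t * w0 t\<bar>" by linarith
    also have "\<bar>V t * w0 t\<bar> \<le> K * \<bar>w0 t\<bar>" unfolding abs_mult by (intro mult_right_mono Vb) auto
    also have "\<bar>a * w2 t\<bar> + \<bar>b * w0 t\<bar> + K * \<bar>w0 t\<bar> \<le> K' * (\<bar>w0 t\<bar> + \<bar>w2 t\<bar>)"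
      using K0 by (simp add: K'_def abs_mult algebra_simps)
    finally show ?thesis by simp
  qed
  have K'0: "0 \<le> K'" using K0 by (simp add: K'_def)
  obtain C where C: "0 < C" and Cb: "\<And>t \<delta>. (\<And>s. s \<in> {t..t+1} \<Longrightarrow> \<bar>W s - W t\<bar> \<le> \<delta>) \<Longrightarrow>
     \<bar>w0 t\<bar> \<le> C * \<delta> \<and> \<bar>w1 t\<bar> \<le> C * \<delta> \<and> \<bar>w2 t\<bar> \<le> C * \<delta> \<and> \<bar>w3 t\<bar> \<le> C * \<delta>"
  proof (rule ode_interior_bound[OF K'0], goal_cases)
    case (1 C)
    show ?case by (rule 1(1)[OF 1(2)], rule 1(3)[OF w b4], assumption)
  qed
  have ev: "\<forall>\<^sub>F t in at_infinity. \<bar>w0 t\<bar> < e \<and> \<bar>w1 t\<bar> < e \<and> \<bar>w2 t\<bar> < e \<and> \<bar>w3 t\<bar> < e" if e: "e > 0" for e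
  proof -
    have "e / (2 * C) > 0" using e C by simp
    from W(2)[OF this] show ?thesis
    proof eventually_elim
      case (elim t)
      have "C * (e / (2 * C)) < e" using C e by simp
      moreover have "\<bar>w0 t\<bar> \<le> C * (e / (2 * C)) \<and> \<bar>w1 t\<bar> \<le> C * (e / (2 * C)) \<and> \<bar>w2 t\<bar> \<le> C * (e / (2 * C)) \<and> \<bar>w3 t\<bar> \<le> C * (e / (2 * C))"
        by (rule Cb) (use elim in auto)
      ultimately show ?case by linarith
    qed
  qed
  have lims: "(w0 \<longlongrightarrow> 0) at_infinity" "(w1 \<longlongrightarrow> 0) at_infinity" "(w2 \<longlongrightarrow> 0) at_infinity" "(w3 \<longlongrightarrow> 0) at_infinity"
    by (auto intro!: tendstoI eventually_mono[OF ev] simp: dist_real_def)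
  have rep: "(\<integral>x. u x * (p x * Rad (real d + m + 4) \<psi> x) \<partial>lborel) = (\<integral>t. w0 t * \<psi> t \<partial>lborel)" if \<psi>: "test_fun \<psi>" for \<psi>
  proof -
    obtain R where R: "\<And>t. R \<le> \<bar>t\<bar> \<Longrightarrow> \<psi> t = 0" "\<And>t. R \<le> \<bar>t\<bar> \<Longrightarrow> deriv \<psi> t = 0" using test_fun_support[OF \<psi>] by blast
    have cw0: "continuous_on UNIV w0" using DERIV_isCont[OF w(2)] by (auto intro!: continuous_at_imp_continuous_on)
    have "(\<integral>x. u x * (p x * Rad (real d + m + 4) \<psi> x) \<partial>lborel) = - (\<integral>t. W t * deriv \<psi> t \<partial>lborel)"
      by (rule W(3)[OF test_fun_DERIV[OF \<psi>] test_fun_continuous[OF test_fun_deriv[OF \<psi>]] R])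
    also have "\<dots> = (\<integral>t. w0 t * \<psi> t \<partial>lborel)"
      using integral_by_parts_real_line[OF w(1) test_fun_DERIV[OF \<psi>] cw0 test_fun_continuous[OF test_fun_deriv[OF \<psi>]] R] by simp
    finally show ?thesis .
  qed
  show thesis by (rule that[OF w(2-5) lims rep])
qed

text \<open>Both constants depend on \<mu> only through \<mu> (2 (N - 4) - \<mu>) = 4 m^2 (1 -
  \<alpha>^2); in particular they vanish at \<alpha> = 1.\<close>

lemma Cmu1_eq:
  assumes "N = 2 * m + 4" "\<mu> = 2 * m * (1 - \<alpha>)" "m > 0"
  shows "Cmu1 N \<mu> = 2 * ((m+1)\<^sup>2 + 1) * (1 - \<alpha>\<^sup>2)"
  unfolding Cmu1_def assms using assms(3) by (simp add: field_simps power2_eq_square)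

lemma Cmu2_eq:
  assumes "N = 2 * m + 4" "\<mu> = 2 * m * (1 - \<alpha>)" "m > 0"
  shows "Cmu2 N \<mu> = (m+2)\<^sup>2 * m\<^sup>2 * (1 - \<alpha>\<^sup>2)\<^sup>2 - 4 * m\<^sup>2 * (m+1) * (1 - \<alpha>\<^sup>2)"
proof -
  have 1: "\<mu> * (2 * (N - 4) - \<mu>) = 4 * m\<^sup>2 * (1 - \<alpha>\<^sup>2)" by (simp add: assms algebra_simps power2_eq_square)
  have 2: "\<mu>\<^sup>2 * (2 * (N - 4) - \<mu>)\<^sup>2 = (4 * m\<^sup>2 * (1 - \<alpha>\<^sup>2))\<^sup>2" unfolding 1[symmetric] by (simp add: power_mult_distrib)
  have "Cmu2 N \<mu> = N\<^sup>2 / (16 * (N - 4)\<^sup>2) * (\<mu>\<^sup>2 * (2 * (N - 4) - \<mu>)\<^sup>2) - (N - 2) / 2 * (\<mu> * (2 * (N - 4) - \<mu>))"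
    unfolding Cmu2_def by (simp only: mult.assoc)
  also have "\<dots> = (2 * m + 4)\<^sup>2 / (16 * (2 * m)\<^sup>2) * (4 * m\<^sup>2 * (1 - \<alpha>\<^sup>2))\<^sup>2 - (2 * m + 2) / 2 * (4 * m\<^sup>2 * (1 - \<alpha>\<^sup>2))"
    unfolding 1 2 by (simp add: assms(1))
  also have "\<dots> = (m+2)\<^sup>2 * m\<^sup>2 * (1 - \<alpha>\<^sup>2)\<^sup>2 - 4 * m\<^sup>2 * (m+1) * (1 - \<alpha>\<^sup>2)"
  proof -
    have "(2 * m + 4)\<^sup>2 / (16 * (2 * m)\<^sup>2) * (4 * m\<^sup>2 * (1 - \<alpha>\<^sup>2))\<^sup>2 = (m+2)\<^sup>2 * m\<^sup>2 * (1 - \<alpha>\<^sup>2)\<^sup>2"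
    proof -
      have "(2 * m + 4)\<^sup>2 = 4 * (m+2)\<^sup>2" by (simp add: power2_eq_square algebra_simps)
      then show ?thesis using assms(3) by (simp add: power_mult_distrib power2_eq_square)
    qed
    moreover have "(2 * m + 2) / 2 * (4 * m\<^sup>2 * (1 - \<alpha>\<^sup>2)) = 4 * m\<^sup>2 * (m+1) * (1 - \<alpha>\<^sup>2)" by (simp add: field_simps)
    ultimately show ?thesis by (simp only:)
  qed
  finally show ?thesis .
qed

text \<open>\<open>Rad 4 (potV \<alpha> m)\<close> is the potential of the linearised equation; 1 -
  tanh^2 is sech^2.\<close>

definition potV :: "real \<Rightarrow> real \<Rightarrow> real \<Rightarrow> real" where
  "potV \<alpha> m t = \<alpha> ^ 4 * ((m+1) * (m+2) * (m+3) * (m+4)) * (1 - (tanh (\<alpha> * t))\<^sup>2)\<^sup>2"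

text \<open>The shape that \<open>mode_weak_equation\<close> produces with q = d + m and the two
  constants of the equation inserted; the same holds for \<open>Bcoef\<close>.\<close>

definition Acoef :: "real \<Rightarrow> real \<Rightarrow> real \<Rightarrow> real" where
  "Acoef \<alpha> m d = 2 * ((d + m) * (d + m + 2)) + 4 - 2 * ((m+1)\<^sup>2 + 1) * (1 - \<alpha>\<^sup>2)"

definition Bcoef :: "real \<Rightarrow> real \<Rightarrow> real \<Rightarrow> real" where
  "Bcoef \<alpha> m d = ((d + m) * (d + m + 2))\<^sup>2 - 2 * ((m+1)\<^sup>2 + 1) * (1 - \<alpha>\<^sup>2) * ((d + m)\<^sup>2 + 2 * d)
     + ((m+2)\<^sup>2 * m\<^sup>2 * (1 - \<alpha>\<^sup>2)\<^sup>2 - 4 * m\<^sup>2 * (m+1) * (1 - \<alpha>\<^sup>2))"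

text \<open>Here \<open>d (d + 2 m + 2) = d (d + N - 2)\<close> is the spherical eigenvalue in degree \<open>d\<close>.\<close>

lemma Acoef_alt: "Acoef \<alpha> m d = \<alpha>\<^sup>2 * (2 * (m+1)\<^sup>2 + 2) + 2 * (d * (d + 2 * m + 2))"
  unfolding Acoef_def by (simp add: power2_eq_square algebra_simps)

lemma Bcoef_alt: "Bcoef \<alpha> m d = \<alpha> ^ 4 * ((m+1)\<^sup>2 - 1)\<^sup>2 + (d * (d + 2 * m + 2)) * (d * (d + 2 * m + 2) - 4 + 2 * ((m+1)\<^sup>2 + 1) * \<alpha>\<^sup>2)"
  unfolding Bcoef_def by (simp add: power2_eq_square power4_eq_xxxx algebra_simps)

text \<open>Put n = m + 1 and l = d (d + 2 n). At d = 1 and \<alpha> = 1, where l = 2 n + 1, both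
  would be equalities; larger d raises l and smaller \<alpha> raises the quotients. The assumption m
  \<ge> 1/2, that is N \<ge> 5, enters as 2 n - 3 \<ge> 0.\<close>

lemma coef_bounds:
  fixes m \<alpha> d :: real
  assumes m: "m \<ge> 1/2" and a: "0 < \<alpha>" "\<alpha> < 1" and d: "1 \<le> d"
  shows "(m+1)\<^sup>2 + (m+1+2)\<^sup>2 \<le> Acoef \<alpha> m d / \<alpha>\<^sup>2" "(m+1)\<^sup>2 * (m+1+2)\<^sup>2 < Bcoef \<alpha> m d / \<alpha> ^ 4"
proof -
  define l where "l = d * (d + 2 * m + 2)"
  define n where "n = m + 1"
  have n: "n \<ge> 3/2" using m by (simp add: n_def)
  have l: "2 * n + 1 \<le> l" unfolding l_def n_def using mult_mono[of 1 d "1 + 2 * m + 2" "d + 2 * m + 2"] d m by simp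
  have a2: "0 < \<alpha>\<^sup>2" "\<alpha>\<^sup>2 < 1" using a by (auto simp: power_less_one_iff)
  have a4: "\<alpha> ^ 4 = \<alpha>\<^sup>2 * \<alpha>\<^sup>2" by (simp add: power4_eq_xxxx power2_eq_square)
  have a42: "\<alpha> ^ 4 < \<alpha>\<^sup>2" "0 < \<alpha> ^ 4" "\<alpha> ^ 4 < 1" unfolding a4 using mult_strict_left_mono[OF a2(2) a2(1)] a2 by auto
  have "\<alpha>\<^sup>2 * (n\<^sup>2 + (n+2)\<^sup>2) = \<alpha>\<^sup>2 * (2 * n\<^sup>2 + 2) + 2 * (\<alpha>\<^sup>2 * (2 * n + 1))" by (simp add: power2_eq_square algebra_simps)
  also have "\<alpha>\<^sup>2 * (2 * n + 1) \<le> 1 * l" using a2 l n by (intro mult_mono) auto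
  finally have "\<alpha>\<^sup>2 * (n\<^sup>2 + (n+2)\<^sup>2) \<le> Acoef \<alpha> m d" unfolding Acoef_alt l_def[symmetric] n_def by simp
  then show "(m+1)\<^sup>2 + (m+1+2)\<^sup>2 \<le> Acoef \<alpha> m d / \<alpha>\<^sup>2" using a2 by (simp add: n_def pos_le_divide_eq mult.commute)
  \<comment> \<open>The threshold value is split so that one \<alpha>^4 stands before a positive
    factor and can be raised strictly to \<alpha>^2, and the other stands before 2 n - 3 and can be
    raised to 1.\<close>
  have "\<alpha> ^ 4 * (n\<^sup>2 * (n+2)\<^sup>2) = \<alpha> ^ 4 * (n\<^sup>2 - 1)\<^sup>2 + (2 * n + 1) * (\<alpha> ^ 4 * (2 * n\<^sup>2 + 2) + \<alpha> ^ 4 * (2 * n - 3))"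
    by (simp add: power2_eq_square algebra_simps)
  also have "\<dots> < \<alpha> ^ 4 * (n\<^sup>2 - 1)\<^sup>2 + (2 * n + 1) * (\<alpha>\<^sup>2 * (2 * n\<^sup>2 + 2) + 1 * (2 * n - 3))"
  proof -
    have "0 < 2 * n\<^sup>2 + 2" by (simp add: add_nonneg_pos)
    then have "\<alpha> ^ 4 * (2 * n\<^sup>2 + 2) < \<alpha>\<^sup>2 * (2 * n\<^sup>2 + 2)" using a42 by (intro mult_strict_right_mono) auto
    moreover have "\<alpha> ^ 4 * (2 * n - 3) \<le> 1 * (2 * n - 3)" using a42 n by (intro mult_right_mono) auto
    ultimately have "\<alpha> ^ 4 * (2 * n\<^sup>2 + 2) + \<alpha> ^ 4 * (2 * n - 3) < \<alpha>\<^sup>2 * (2 * n\<^sup>2 + 2) + 1 * (2 * n - 3)" by linarith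
    then show ?thesis using n by (intro add_strict_left_mono mult_strict_left_mono) auto
  qed
  also have "\<dots> \<le> \<alpha> ^ 4 * (n\<^sup>2 - 1)\<^sup>2 + l * (\<alpha>\<^sup>2 * (2 * n\<^sup>2 + 2) + (l - 4))"
    using l n a2 by (intro add_left_mono mult_mono add_nonneg_nonneg mult_nonneg_nonneg) auto
  also have "\<dots> = Bcoef \<alpha> m d" unfolding Bcoef_alt l_def[symmetric] n_def by (simp add: algebra_simps)
  finally show "(m+1)\<^sup>2 * (m+1+2)\<^sup>2 < Bcoef \<alpha> m d / \<alpha> ^ 4" using a42 by (simp add: n_def pos_less_divide_eq mult.commute)
qed

lemma tanh_scaled_DERIV: "((\<lambda>t. tanh (\<alpha> * t)) has_real_derivative \<alpha> * (1 - (tanh (\<alpha> * t))\<^sup>2)) (at (t::real))"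
  by (auto intro!: derivative_eq_intros)

lemma potV_DERIV:
  "(potV \<alpha> m has_real_derivative \<alpha> ^ 4 * ((m+1) * (m+2) * (m+3) * (m+4)) * (- 4 * \<alpha> * tanh (\<alpha> * t) * (1 - (tanh (\<alpha> * t))\<^sup>2)\<^sup>2)) (at t)"
  unfolding potV_def[abs_def]
  apply (rule DERIV_cong)
   apply (rule tanh_scaled_DERIV derivative_intros)+
  apply (simp add: power2_eq_square algebra_simps)
  done

lemma potV_bound: assumes "0 \<le> m" "0 \<le> \<alpha>" shows "\<bar>potV \<alpha> m t\<bar> \<le> \<alpha> ^ 4 * ((m+1) * (m+2) * (m+3) * (m+4))"
proof -
  have "(tanh (\<alpha> * t))\<^sup>2 \<le> 1" using abs_tanh_le_1[of "\<alpha> * t"] by (simp add: abs_square_le_1)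
  then have "\<bar>(1 - (tanh (\<alpha> * t))\<^sup>2)\<^sup>2\<bar> \<le> 1" by (simp add: abs_square_le_1 power_le_one)
  then show ?thesis unfolding potV_def abs_mult[of _ "(1 - (tanh (\<alpha> * t))\<^sup>2)\<^sup>2"]
    using mult_left_mono[of _ 1 "\<alpha> ^ 4 * ((m+1) * (m+2) * (m+3) * (m+4))"] assms by simp
qed

lemma potV_scaled: "\<alpha> \<noteq> 0 \<Longrightarrow> potV \<alpha> m (s / \<alpha>) / \<alpha> ^ 4 = (m+1) * (m+2) * (m+3) * (m+4) * (1 - (tanh s)\<^sup>2)\<^sup>2"
  by (simp add: potV_def)

lemma potV'_continuous: "continuous_on UNIV (\<lambda>t. \<alpha> ^ 4 * ((m+1) * (m+2) * (m+3) * (m+4)) * (- 4 * \<alpha> * tanh (\<alpha> * t) * (1 - (tanh (\<alpha> * t))\<^sup>2)\<^sup>2) :: real)"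
  by (intro continuous_intros) auto

lemma scaled_chain:
  fixes w w' :: "real \<Rightarrow> real"
  assumes "\<alpha> > 0" "\<And>t. (w has_real_derivative w' t) (at t)"
  shows "((\<lambda>s. w (s / \<alpha>) / \<alpha> ^ k) has_real_derivative w' (s / \<alpha>) / \<alpha> ^ Suc k) (at s)"
proof -
  have "((\<lambda>s. s / \<alpha>) has_real_derivative 1 / \<alpha>) (at s)" using assms(1) by (auto intro!: derivative_eq_intros)
  from DERIV_chain2[OF assms(2) this] have "((\<lambda>s. w (s / \<alpha>)) has_real_derivative w' (s / \<alpha>) * (1 / \<alpha>)) (at s)" .
  from DERIV_cdivide[OF this, of "\<alpha> ^ k"] show ?thesis by (simp add: mult.commute)
qed

lemma scaled_lim:
  fixes w :: "real \<Rightarrow> real"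
  assumes "\<alpha> > 0" "(w \<longlongrightarrow> 0) at_infinity"
  shows "((\<lambda>s. w (s / \<alpha>) / \<alpha> ^ k) \<longlongrightarrow> 0) at_infinity"
proof -
  have "filterlim (\<lambda>s. s / \<alpha>) at_infinity at_infinity"
    unfolding filterlim_at_infinity[OF order_refl] 
  proof (intro allI impI)
    fix r :: real assume "0 < r"
    show "\<forall>\<^sub>F x in at_infinity. r \<le> norm (x / \<alpha>)"
      unfolding eventually_at_infinity using assms(1)
      by (intro exI[of _ "r * \<alpha>"]) (auto simp: pos_le_divide_eq abs_divide)
  qed
  from filterlim_compose[OF assms(2) this] have "((\<lambda>s. w (s / \<alpha>)) \<longlongrightarrow> 0) at_infinity" .
  from tendsto_divide[OF this tendsto_const[of "\<alpha> ^ k"]] show ?thesis using assms(1) by simp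
qed

text \<open>With the test function p |x|^-(d+m) \<psi>, the Laplacian of p and its iterate occur
  only in integrals of the shapes in \<open>H1\<close> and \<open>H2\<close>. What remains is p
  times a fourth-order operator acting on \<psi> alone.\<close>

lemma mode_weak_equation:
  fixes u p :: "real^'n::finite \<Rightarrow> real"
  assumes N: "N = real CARD('n)" "N = 2 * m + 4" and lu: "locint u" and p: "hpoly d p" and cV: "continuous_on UNIV V"
    and VW: "\<And>\<phi>. radial_test \<phi> \<Longrightarrow> (\<integral>x. u x * clap (clap \<phi>) x \<partial>lborel) + C1 * (\<integral>x. u x * wdiv \<phi> x \<partial>lborel)
      + C2 * (\<integral>x. u x * (\<phi> x / norm x ^ 4) \<partial>lborel) = (\<integral>x. u x * (Rad 4 V x * \<phi> x) \<partial>lborel)"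
    and H1: "\<And>\<psi>. test_fun \<psi> \<Longrightarrow> (\<integral>x. u x * (clap p x * Rad (real d + m + 2) \<psi> x) \<partial>lborel) = 0"
    and H2: "\<And>\<psi>. test_fun \<psi> \<Longrightarrow> (\<integral>x. u x * (clap (clap p) x * Rad (real d + m) \<psi> x) \<partial>lborel) = 0"
    and \<psi>: "test_fun \<psi>"
  defines "q \<equiv> real d + m"
  shows "(\<integral>x. u x * (p x * Rad (real d + m + 4) (\<lambda>t. (deriv ^^ 4) \<psi> t - (2 * (q * (q + 2)) + 4 - C1) * (deriv ^^ 2) \<psi> t
     + ((q * (q + 2))\<^sup>2 - C1 * (q\<^sup>2 + 2 * real d) + C2) * \<psi> t - V t * \<psi> t) x) \<partial>lborel) = 0"
proof -
  \<comment> \<open>Below degree 2 the Laplacian of p is zero and is filed under degree 0.\<close>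
  obtain e where e: "hpoly e (clap p)"
  proof (cases "d < 2")
    case True then show ?thesis using that[of 0] hpoly_clap[OF p] hpoly.zero by auto
  next
    case False then show ?thesis using that[of "d - 2"] hpoly_clap[OF p] by auto
  qed
  obtain e' where e': "hpoly e' (clap (clap p))"
  proof (cases "e < 2")
    case True then show ?thesis using that[of 0] hpoly_clap[OF e] hpoly.zero by auto
  next
    case False then show ?thesis using that[of "e - 2"] hpoly_clap[OF e] by auto
  qed
  have c: "2 * q + 4 = real CARD('n) + 2 * real d" using N by (simp add: q_def)
  obtain \<psi>1 where \<psi>1: "test_fun \<psi>1"
   "clap (clap (\<lambda>x. p x * Rad q \<psi> x)) = (\<lambda>x. clap (clap p) x * Rad q \<psi> x + clap p x * Rad (q + 2) \<psi>1 x
     + p x * Rad (q + 4) (\<lambda>t. (deriv ^^ 4) \<psi> t - (2 * (q * (q + 2)) + 4) * (deriv ^^ 2) \<psi> t + (q * (q + 2))\<^sup>2 * \<psi> t) x)"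
    using clap_test_fun_test_fun[OF p e \<psi> c] by blast
  have int: "integrable lborel (\<lambda>x. u x * (P x * Rad a f x))" if "hpoly k P" "test_fun f" for k P a f
    using locint_integrable_testfun[OF lu radial_test_testfun[OF radial_test.gen[OF that]]] .
  define f1 where "f1 t = (deriv ^^ 4) \<psi> t - (2 * (q * (q + 2)) + 4) * (deriv ^^ 2) \<psi> t + (q * (q + 2))\<^sup>2 * \<psi> t" for t
  define f2 where "f2 t = (deriv ^^ 2) \<psi> t - (q\<^sup>2 + 2 * real d) * \<psi> t" for t
  note tt = test_fun_add test_fun_diff test_fun_cmult test_fun_funpow test_fun_deriv \<psi>
  have tf: "test_fun f1" "test_fun f2" unfolding f1_def f2_def by (intro tt)+
  define I where "I f = (\<integral>x. u x * (p x * Rad (q + 4) f x) \<partial>lborel)" for f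
  have 1: "(\<integral>x. u x * clap (clap (\<lambda>x. p x * Rad q \<psi> x)) x \<partial>lborel) = I f1"
  proof -
    have "(\<integral>x. u x * clap (clap (\<lambda>x. p x * Rad q \<psi> x)) x \<partial>lborel) = (\<integral>x. u x * (clap (clap p) x * Rad q \<psi> x)
       + u x * (clap p x * Rad (q + 2) \<psi>1 x) + u x * (p x * Rad (q + 4) f1 x) \<partial>lborel)"
      unfolding \<psi>1(2) f1_def[abs_def] by (simp only: distrib_left)
    also have "\<dots> = I f1"
      using int[OF e' \<psi>, of q] int[OF e \<psi>1(1), of "q + 2"] int[OF p tf(1), of "q + 4"] H1[OF \<psi>1(1)] H2[OF \<psi>]
      by (simp add: I_def q_def[symmetric])
    finally show ?thesis .
  qed
  have 2: "(\<integral>x. u x * wdiv (\<lambda>x. p x * Rad q \<psi> x) x \<partial>lborel) = I f2"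
  proof -
    have w: "wdiv (\<lambda>x. p x * Rad q \<psi> x) = (\<lambda>x. clap p x * Rad (q + 2) \<psi> x + p x * Rad (q + 4) f2 x)"
      unfolding wdiv_test_fun[OF p \<psi>] c[symmetric] f2_def[abs_def] by (simp add: numeral_2_eq_2 algebra_simps power2_eq_square)
    have "(\<integral>x. u x * wdiv (\<lambda>x. p x * Rad q \<psi> x) x \<partial>lborel) = (\<integral>x. u x * (clap p x * Rad (q + 2) \<psi> x) + u x * (p x * Rad (q + 4) f2 x) \<partial>lborel)"
      unfolding w by (simp only: distrib_left)
    also have "\<dots> = I f2"
      using int[OF e \<psi>, of "q + 2"] int[OF p tf(2), of "q + 4"] H1[OF \<psi>] by (simp add: I_def q_def[symmetric])
    finally show ?thesis .
  qed
  have 3: "(\<integral>x. u x * ((p x * Rad q \<psi> x) / norm x ^ 4) \<partial>lborel) = I \<psi>"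
    unfolding I_def times_divide_eq_right[symmetric] Rad_divide_norm by simp
  have r4: "Rad 4 V x * (p x * Rad q \<psi> x) = p x * Rad (q + 4) (\<lambda>t. V t * \<psi> t) x" for x
  proof (cases "x = 0")
    case False
    have "norm x powr (- 4) * norm x powr (- q) = norm x powr (- (q + 4))" unfolding powr_add[symmetric] by (rule arg_cong[where f="\<lambda>z. norm x powr z"]) simp
    moreover have "Rad 4 V x * (p x * Rad q \<psi> x) = p x * ((norm x powr (- 4) * norm x powr (- q)) * (V (ln (norm x)) * \<psi> (ln (norm x))))"
      unfolding Rad_def by (simp only: mult_ac)
    ultimately show ?thesis by (simp only: Rad_def)
  qed simp
  have 4: "(\<integral>x. u x * (Rad 4 V x * (p x * Rad q \<psi> x)) \<partial>lborel) = I (\<lambda>t. V t * \<psi> t)"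
    unfolding r4 I_def ..
  have intV: "integrable lborel (\<lambda>x. u x * (p x * Rad (q + 4) (\<lambda>t. V t * \<psi> t) x))"
  proof -
    obtain \<delta> where d: "\<delta> > 0" "\<And>q x. x \<in> ball (0::real^'n) \<delta> \<Longrightarrow> Rad q \<psi> x = 0" using Rad_test_fun_zero_near[OF \<psi>] by metis
    obtain R where R: "\<And>q x. R \<le> norm (x::real^'n) \<Longrightarrow> Rad q \<psi> x = 0" using Rad_test_fun_zero_far[OF \<psi>] by metis
    show ?thesis unfolding r4[symmetric]
    proof (rule locint_integrable_times[OF lu, where R=R])
      have "continuous_on (UNIV - {0}) p" using hpoly_continuous[OF p] continuous_on_subset by blast
      then show "continuous_on UNIV (\<lambda>x. Rad 4 V x * (p x * Rad q \<psi> x))"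
        by - (rule continuous_off_zero[OF _ d(1)], intro continuous_intros continuous_Rad cV test_fun_continuous \<psi>, simp_all add: d)
    qed (simp add: R)
  qed
  have "(\<integral>x. u x * (p x * Rad (q + 4) (\<lambda>t. (deriv ^^ 4) \<psi> t - (2 * (q * (q + 2)) + 4 - C1) * (deriv ^^ 2) \<psi> t
     + ((q * (q + 2))\<^sup>2 - C1 * (q\<^sup>2 + 2 * real d) + C2) * \<psi> t - V t * \<psi> t) x) \<partial>lborel)
    = (\<integral>x. u x * (p x * Rad (q + 4) f1 x) + C1 * (u x * (p x * Rad (q + 4) f2 x)) + C2 * (u x * (p x * Rad (q + 4) \<psi> x))
       - u x * (p x * Rad (q + 4) (\<lambda>t. V t * \<psi> t) x) \<partial>lborel)"
    by (intro Bochner_Integration.integral_cong refl) (simp add: Rad_def f1_def f2_def algebra_simps del: funpow.simps)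
  also have "\<dots> = I f1 + C1 * I f2 + C2 * I \<psi> - I (\<lambda>t. V t * \<psi> t)"
    unfolding I_def using int[OF p tf(1), of "q + 4"] int[OF p tf(2), of "q + 4"] int[OF p \<psi>, of "q + 4"] intV by simp
  also have "\<dots> = 0" using VW[OF radial_test.gen[OF p \<psi>, of q]] unfolding 1 2 3 4 by simp
  finally show ?thesis unfolding q_def .
qed

section \<open>Uniqueness\<close>

text \<open>With all derivatives on the test function, differences of solutions can be formed
  without tracking weak gradients and Laplacians.\<close>

definition very_weak :: "real \<Rightarrow> real \<Rightarrow> (real^'n::finite \<Rightarrow> real) \<Rightarrow> bool" where
  "very_weak m \<alpha> u \<longleftrightarrow> locint u \<and> integrable lborel (\<lambda>x. (u x)\<^sup>2 / norm x ^ 4) \<and>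
    (\<forall>\<phi>. radial_test \<phi> \<longrightarrow> (\<integral>x. u x * clap (clap \<phi>) x \<partial>lborel) + (2 * ((m+1)\<^sup>2 + 1) * (1 - \<alpha>\<^sup>2)) * (\<integral>x. u x * wdiv \<phi> x \<partial>lborel)
      + ((m+2)\<^sup>2 * m\<^sup>2 * (1 - \<alpha>\<^sup>2)\<^sup>2 - 4 * m\<^sup>2 * (m+1) * (1 - \<alpha>\<^sup>2)) * (\<integral>x. u x * (\<phi> x / norm x ^ 4) \<partial>lborel)
      = (\<integral>x. u x * (Rad 4 (potV \<alpha> m) x * \<phi> x) \<partial>lborel))"

text \<open>The substitution s = \<alpha> t turns sech^4(\<alpha> t) into sech^4(s) and divides the
  coefficients by \<alpha>^2 and \<alpha>^4, so that \<alpha> survives only in the coefficients and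
  in the representation of the moments.\<close>

lemma very_weak_mode:
  fixes u p :: "real^'n::finite \<Rightarrow> real"
  assumes N: "real CARD('n) = 2 * m + 4" and m: "m \<ge> 0" and a: "0 < \<alpha>" and u: "very_weak m \<alpha> u" and p: "hpoly d p"
    and H1: "\<And>\<psi>. test_fun \<psi> \<Longrightarrow> (\<integral>x. u x * (clap p x * Rad (real d + m + 2) \<psi> x) \<partial>lborel) = 0"
    and H2: "\<And>\<psi>. test_fun \<psi> \<Longrightarrow> (\<integral>x. u x * (clap (clap p) x * Rad (real d + m) \<psi> x) \<partial>lborel) = 0"
  obtains y0 y1 y2 y3 where "\<And>t. (y0 has_real_derivative y1 t) (at t)"
    "\<And>t. (y1 has_real_derivative y2 t) (at t)" "\<And>t. (y2 has_real_derivative y3 t) (at t)"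
    "\<And>t. (y3 has_real_derivative Acoef \<alpha> m (real d) / \<alpha>\<^sup>2 * y2 t - Bcoef \<alpha> m (real d) / \<alpha> ^ 4 * y0 t
        + (m+1) * (m+2) * (m+3) * (m+4) * (1 - (tanh t)\<^sup>2)\<^sup>2 * y0 t) (at t)"
    "(y0 \<longlongrightarrow> 0) at_infinity" "(y1 \<longlongrightarrow> 0) at_infinity" "(y2 \<longlongrightarrow> 0) at_infinity" "(y3 \<longlongrightarrow> 0) at_infinity"
    "\<And>\<psi>. test_fun \<psi> \<Longrightarrow> (\<integral>x. u x * (p x * Rad (real d + m + 4) \<psi> x) \<partial>lborel) = (\<integral>t. y0 (\<alpha> * t) * \<psi> t \<partial>lborel)"
proof -
  have lu: "locint u" and ui: "integrable lborel (\<lambda>x. (u x)\<^sup>2 / norm x ^ 4)" using u by (auto simp: very_weak_def)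
  have um: "u \<in> borel_measurable lborel" using lu by (auto simp: locint_def)
  have cV: "continuous_on UNIV (potV \<alpha> m)" using DERIV_isCont[OF potV_DERIV] by (auto intro!: continuous_at_imp_continuous_on)
  note VW = u[unfolded very_weak_def, THEN conjunct2, THEN conjunct2, rule_format]
  have weak: "(\<integral>x. u x * (p x * Rad (real d + m + 4) (\<lambda>t. (deriv ^^ 4) \<psi> t - Acoef \<alpha> m (real d) * (deriv ^^ 2) \<psi> t
     + Bcoef \<alpha> m (real d) * \<psi> t - potV \<alpha> m t * \<psi> t) x) \<partial>lborel) = 0" if "test_fun \<psi>" for \<psi>
    unfolding Acoef_def Bcoef_def by (rule mode_weak_equation[OF refl N lu p cV VW H1 H2 that])
  obtain w0 w1 w2 w3 where w: "\<And>t. (w0 has_real_derivative w1 t) (at t)"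
    "\<And>t. (w1 has_real_derivative w2 t) (at t)" "\<And>t. (w2 has_real_derivative w3 t) (at t)"
    "\<And>t. (w3 has_real_derivative Acoef \<alpha> m (real d) * w2 t - Bcoef \<alpha> m (real d) * w0 t + potV \<alpha> m t * w0 t) (at t)"
    and wl: "(w0 \<longlongrightarrow> 0) at_infinity" "(w1 \<longlongrightarrow> 0) at_infinity" "(w2 \<longlongrightarrow> 0) at_infinity" "(w3 \<longlongrightarrow> 0) at_infinity"
    and rep: "\<And>\<psi>. test_fun \<psi> \<Longrightarrow> (\<integral>x. u x * (p x * Rad (real d + m + 4) \<psi> x) \<partial>lborel) = (\<integral>t. w0 t * \<psi> t \<partial>lborel)"
    using mode_ode[OF refl N um ui p potV_DERIV potV'_continuous potV_bound[OF m less_imp_le[OF a]] weak] by blast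
  define y where "y k w s = w (s / \<alpha>) / \<alpha> ^ k" for k :: nat and w :: "real \<Rightarrow> real" and s
  have d4: "(y 3 w3 has_real_derivative Acoef \<alpha> m (real d) / \<alpha>\<^sup>2 * y 2 w2 s - Bcoef \<alpha> m (real d) / \<alpha> ^ 4 * y 0 w0 s
        + (m+1) * (m+2) * (m+3) * (m+4) * (1 - (tanh s)\<^sup>2)\<^sup>2 * y 0 w0 s) (at s)" for s
  proof -
    have "(y 3 w3 has_real_derivative (Acoef \<alpha> m (real d) * w2 (s / \<alpha>) - Bcoef \<alpha> m (real d) * w0 (s / \<alpha>) + potV \<alpha> m (s / \<alpha>) * w0 (s / \<alpha>)) / \<alpha> ^ Suc 3) (at s)"
      unfolding y_def[abs_def] by (rule scaled_chain[OF a w(4)])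
    moreover have "(Acoef \<alpha> m (real d) * w2 (s / \<alpha>) - Bcoef \<alpha> m (real d) * w0 (s / \<alpha>) + potV \<alpha> m (s / \<alpha>) * w0 (s / \<alpha>)) / \<alpha> ^ Suc 3
       = Acoef \<alpha> m (real d) / \<alpha>\<^sup>2 * y 2 w2 s - Bcoef \<alpha> m (real d) / \<alpha> ^ 4 * y 0 w0 s + (potV \<alpha> m (s / \<alpha>) / \<alpha> ^ 4) * y 0 w0 s"
      using a by (simp add: y_def field_simps power2_eq_square eval_nat_numeral)
    ultimately show ?thesis using potV_scaled[of \<alpha> m s] a by simp
  qed
  have d1: "(y 0 w0 has_real_derivative y 1 w1 s) (at s)" "(y 1 w1 has_real_derivative y 2 w2 s) (at s)" "(y 2 w2 has_real_derivative y 3 w3 s) (at s)" for s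
    using scaled_chain[OF a w(1), of 0 s] scaled_chain[OF a w(2), of 1 s] scaled_chain[OF a w(3), of 2 s]
    unfolding y_def[abs_def] by (simp_all only: One_nat_def numeral_2_eq_2 numeral_3_eq_3)
  have l: "(y k w \<longlongrightarrow> 0) at_infinity" if "(w \<longlongrightarrow> 0) at_infinity" for k w
    unfolding y_def by (rule scaled_lim[OF a that])
  show thesis
  proof (rule that[OF d1 d4 l[OF wl(1)] l[OF wl(2)] l[OF wl(3)] l[OF wl(4)]])
    fix \<psi> assume "test_fun \<psi>"
    moreover have "y 0 w0 (\<alpha> * t) = w0 t" for t using a by (simp add: y_def)
    ultimately show "(\<integral>x. u x * (p x * Rad (real d + m + 4) \<psi> x) \<partial>lborel) = (\<integral>t. y 0 w0 (\<alpha> * t) * \<psi> t \<partial>lborel)"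
      using rep by simp
  qed
qed

text \<open>With n = m + 1 the potential is n (n+1)(n+2)(n+3) sech^4, the one whose threshold
  coefficients belong to sech^n.\<close>

lemma mode_trivial:
  fixes u p :: "real^'n::finite \<Rightarrow> real"
  assumes N: "real CARD('n) = 2 * m + 4" and m: "m \<ge> 1/2" and a: "0 < \<alpha>" "\<alpha> < 1" and u: "very_weak m \<alpha> u" and p: "hpoly d p" and d: "1 \<le> d"
    and H1: "\<And>\<psi>. test_fun \<psi> \<Longrightarrow> (\<integral>x. u x * (clap p x * Rad (real d + m + 2) \<psi> x) \<partial>lborel) = 0"
    and H2: "\<And>\<psi>. test_fun \<psi> \<Longrightarrow> (\<integral>x. u x * (clap (clap p) x * Rad (real d + m) \<psi> x) \<partial>lborel) = 0"
    and \<psi>: "test_fun \<psi>"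
  shows "(\<integral>x. u x * (p x * Rad (real d + m + 4) \<psi> x) \<partial>lborel) = 0"
proof -
  have m0: "0 \<le> m" using m by simp
  obtain y0 y1 y2 y3 where y: "\<And>t. (y0 has_real_derivative y1 t) (at t)"
    "\<And>t. (y1 has_real_derivative y2 t) (at t)" "\<And>t. (y2 has_real_derivative y3 t) (at t)"
    "\<And>t. (y3 has_real_derivative Acoef \<alpha> m (real d) / \<alpha>\<^sup>2 * y2 t - Bcoef \<alpha> m (real d) / \<alpha> ^ 4 * y0 t
        + (m+1) * (m+2) * (m+3) * (m+4) * (1 - (tanh t)\<^sup>2)\<^sup>2 * y0 t) (at t)"
    and l: "(y0 \<longlongrightarrow> 0) at_infinity" "(y1 \<longlongrightarrow> 0) at_infinity" "(y2 \<longlongrightarrow> 0) at_infinity" "(y3 \<longlongrightarrow> 0) at_infinity"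
    and rep: "\<And>\<psi>. test_fun \<psi> \<Longrightarrow> (\<integral>x. u x * (p x * Rad (real d + m + 4) \<psi> x) \<partial>lborel) = (\<integral>t. y0 (\<alpha> * t) * \<psi> t \<partial>lborel)"
    using very_weak_mode[OF N m0 a(1) u p H1 H2] by blast
  have y4: "(y3 has_real_derivative Acoef \<alpha> m (real d) / \<alpha>\<^sup>2 * y2 t - Bcoef \<alpha> m (real d) / \<alpha> ^ 4 * y0 t
        + (m+1) * (m+1+1) * (m+1+2) * (m+1+3) * (1 - (tanh t)\<^sup>2)\<^sup>2 * y0 t) (at t)" for t
    using y(4)[of t] by (simp add: add.assoc)
  have d': "1 \<le> real d" using d by simp
  have "y0 t = 0" for t
    by (rule ode_positive_trivial[OF _ y(1-3) y4 coef_bounds[OF m a d'] l]) (use m in simp)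
  then show ?thesis using rep[OF \<psi>] by simp
qed

lemma clap_zero: "clap (\<lambda>_. 0) = (\<lambda>_::real^'a::finite. 0)"
proof -
  have "pd i (\<lambda>_. 0) = (\<lambda>_. 0)" for i :: 'a by (rule ext, rule hasPD_pd, rule hasPD_const)
  then show ?thesis unfolding clap_def[abs_def] by simp
qed

text \<open>In degree 0 both rescaled coefficients are free of \<alpha>, so the kernel is that of
  the conformal case \<alpha> = 1. The radial moments of u are thereby determined up to one
  constant.\<close>

lemma radial_mode:
  fixes u :: "real^'n::finite \<Rightarrow> real"
  assumes N: "real CARD('n) = 2 * m + 4" and m: "m > 0" and a: "0 < \<alpha>" and u: "very_weak m \<alpha> u"
  obtains c where "\<And>\<psi>. test_fun \<psi> \<Longrightarrow> (\<integral>x. u x * Rad (m + 4) \<psi> x \<partial>lborel) = c * (\<integral>t. (cosh (\<alpha> * t) powr (- m) * tanh (\<alpha> * t)) * \<psi> t \<partial>lborel)"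
proof -
  have m0: "0 \<le> m" using m by simp
  have p: "hpoly 0 (\<lambda>_. 1 :: real)" by (rule hpoly.const)
  have c0: "clap (\<lambda>_. 1 :: real) = (\<lambda>_::real^'n. 0)" using hpoly_clap[OF p] by simp
  obtain y0 y1 y2 y3 where y: "\<And>t. (y0 has_real_derivative y1 t) (at t)"
    "\<And>t. (y1 has_real_derivative y2 t) (at t)" "\<And>t. (y2 has_real_derivative y3 t) (at t)"
    "\<And>t. (y3 has_real_derivative Acoef \<alpha> m (real 0) / \<alpha>\<^sup>2 * y2 t - Bcoef \<alpha> m (real 0) / \<alpha> ^ 4 * y0 t
        + (m+1) * (m+2) * (m+3) * (m+4) * (1 - (tanh t)\<^sup>2)\<^sup>2 * y0 t) (at t)"
    and l: "(y0 \<longlongrightarrow> 0) at_infinity" "(y1 \<longlongrightarrow> 0) at_infinity" "(y2 \<longlongrightarrow> 0) at_infinity" "(y3 \<longlongrightarrow> 0) at_infinity"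
    and rep: "\<And>\<psi>. test_fun \<psi> \<Longrightarrow> (\<integral>x. u x * (1 * Rad (real 0 + m + 4) \<psi> x) \<partial>lborel) = (\<integral>t. y0 (\<alpha> * t) * \<psi> t \<partial>lborel)"
  proof (rule very_weak_mode[OF N m0 a u p])
    show "(\<integral>x. u x * (clap (\<lambda>_. 1) x * Rad (real 0 + m + 2) \<psi> x) \<partial>lborel) = 0" for \<psi> by (simp add: c0)
    show "(\<integral>x. u x * (clap (clap (\<lambda>_. 1)) x * Rad (real 0 + m) \<psi> x) \<partial>lborel) = 0" for \<psi> by (simp add: c0 clap_zero)
  qed blast
  have A: "Acoef \<alpha> m (real 0) / \<alpha>\<^sup>2 = m\<^sup>2 + (m+2)\<^sup>2"
  proof -
    have "Acoef \<alpha> m 0 = \<alpha>\<^sup>2 * (m\<^sup>2 + (m+2)\<^sup>2)" unfolding Acoef_alt by (simp add: power2_eq_square algebra_simps)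
    then show ?thesis using a by simp
  qed
  have B: "Bcoef \<alpha> m (real 0) / \<alpha> ^ 4 = m\<^sup>2 * (m+2)\<^sup>2"
  proof -
    have "Bcoef \<alpha> m 0 = \<alpha> ^ 4 * (m\<^sup>2 * (m+2)\<^sup>2)" unfolding Bcoef_alt by (simp add: power2_eq_square algebra_simps)
    then show ?thesis using a by simp
  qed
  obtain c where c: "\<And>t. y0 t = c * (cosh t powr (- m) * tanh t)"
    using ode_radial_kernel[OF m y(1-3) y(4)[unfolded A B] l] by blast
  show thesis
  proof (rule that)
    fix \<psi> assume "test_fun \<psi>"
    from rep[OF this] show "(\<integral>x. u x * Rad (m + 4) \<psi> x \<partial>lborel) = c * (\<integral>t. (cosh (\<alpha> * t) powr (- m) * tanh (\<alpha> * t)) * \<psi> t \<partial>lborel)"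
      by (simp add: c mult.assoc)
  qed
qed

lemma hpoly_0_const: "hpoly d p \<Longrightarrow> d = 0 \<Longrightarrow> \<exists>c. p = (\<lambda>_. c)"
  by (induction rule: hpoly.induct) auto

text \<open>The Laplacian of p has degree d - 2, and (d - 2) + m + 4 = d + m + 2, so the induction
  hypothesis has exactly the exponents that \<open>mode_trivial\<close> requires. Degree 0 is the
  hypothesis on radial moments.\<close>

lemma all_modes_vanish:
  fixes u p :: "real^'n::finite \<Rightarrow> real"
  assumes N: "real CARD('n) = 2 * m + 4" and m: "m \<ge> 1/2" and a: "0 < \<alpha>" "\<alpha> < 1" and u: "very_weak m \<alpha> u"
    and r: "\<And>\<psi>. test_fun \<psi> \<Longrightarrow> (\<integral>x. u x * Rad (m + 4) \<psi> x \<partial>lborel) = 0"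
    and p: "hpoly d p" and \<psi>: "test_fun \<psi>"
  shows "(\<integral>x. u x * (p x * Rad (real d + m + 4) \<psi> x) \<partial>lborel) = 0"
  using p \<psi>
proof (induction d arbitrary: p \<psi> rule: less_induct)
  case (less d)
  show ?case
  proof (cases "d = 0")
    case True
    obtain c where "p = (\<lambda>_. c)" using hpoly_0_const[OF less.prems(1) True] by blast
    then show ?thesis using r[OF less.prems(2)] True by (simp add: mult.left_commute[of _ c])
  next
    case False
    \<comment> \<open>Stated for all e \<le> d, since it is applied to p and also, in order to reach
      \<open>clap (clap p)\<close>, to \<open>clap p\<close>.\<close>
    have H1: "(\<integral>x. u x * (clap q x * Rad (real e + m + 2) \<eta> x) \<partial>lborel) = 0" if "e \<le> d" "hpoly e q" "test_fun \<eta>" for e q \<eta>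
    proof (cases "e < 2")
      case True then show ?thesis using hpoly_clap[OF that(2)] by simp
    next
      case False
      then have "hpoly (e - 2) (clap q)" using hpoly_clap[OF that(2)] by simp
      moreover have "e - 2 < d" using False that(1) by simp
      ultimately have "(\<integral>x. u x * (clap q x * Rad (real (e - 2) + m + 4) \<eta> x) \<partial>lborel) = 0"
        using that(3) by (intro less.IH)
      moreover have "real (e - 2) + m + 4 = real e + m + 2" using False by simp
      ultimately show ?thesis by (simp only:)
    qed
    have H2: "(\<integral>x. u x * (clap (clap p) x * Rad (real d + m) \<eta> x) \<partial>lborel) = 0" if t: "test_fun \<eta>" for \<eta>
    proof (cases "d < 2")
      case True then show ?thesis using hpoly_clap[OF less.prems(1)] by (simp add: clap_zero)
    next
      case False
      then have "hpoly (d - 2) (clap p)" using hpoly_clap[OF less.prems(1)] by simp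
      then have "(\<integral>x. u x * (clap (clap p) x * Rad (real (d - 2) + m + 2) \<eta> x) \<partial>lborel) = 0"
        using t by (intro H1) auto
      moreover have "real (d - 2) + m + 2 = real d + m" using False by simp
      ultimately show ?thesis by (simp only:)
    qed
    show ?thesis
      by (rule mode_trivial[OF N m a u less.prems(1) _ H1[OF order_refl less.prems(1)] H2 less.prems(2)]) (use False in simp_all)
  qed
qed

section \<open>Polynomial moments determine a function of bounded support\<close>

inductive poly_sum :: "(real^'n::finite \<Rightarrow> real) \<Rightarrow> bool" where
  "hpoly d p \<Longrightarrow> poly_sum p"
| "poly_sum f \<Longrightarrow> poly_sum g \<Longrightarrow> poly_sum (\<lambda>x. f x + g x)"

lemma hpoly_mult: "hpoly d p \<Longrightarrow> hpoly e q \<Longrightarrow> hpoly (d + e) (\<lambda>x. p x * q x)"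
proof (induction rule: hpoly.induct)
  case (const c) then show ?case using hpoly_cmult[of e q c] by simp
next
  case (coord d p i) then show ?case using hpoly.coord[of "d + e" "\<lambda>x. p x * q x" i] by (simp add: mult.assoc)
next
  case (add d p p') then show ?case using hpoly.add[of "d + e" "\<lambda>x. p x * q x" "\<lambda>x. p' x * q x"] by (simp add: distrib_right)
qed (auto intro: hpoly.zero)

lemma poly_sum_mult: assumes "poly_sum f" "poly_sum g" shows "poly_sum (\<lambda>x. f x * g x)"
  using assms(1)
proof (induction rule: poly_sum.induct)
  case (1 d p)
  show ?case using assms(2)
  proof (induction rule: poly_sum.induct)
    case (1 e q) then show ?case using hpoly_mult[OF \<open>hpoly d p\<close>] poly_sum.intros by blast
  next
    case (2 f g) then show ?case using poly_sum.intros(2)[OF 2(3,4)] by (simp add: distrib_left)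
  qed
next
  case (2 f' g') then show ?case using poly_sum.intros(2)[OF 2(3,4)] by (simp add: distrib_right)
qed

lemma real_polynomial_poly_sum: "real_polynomial_function f \<Longrightarrow> poly_sum (f :: real^'n::finite \<Rightarrow> real)"
proof (induction rule: real_polynomial_function.induct)
  case (linear f)
  have "f = (\<lambda>x. \<Sum>i\<in>UNIV. x $ i * f (axis i 1))"
  proof
    fix x :: "real^'n"
    have "(\<Sum>i\<in>UNIV. x $ i *\<^sub>R axis i 1) = x" using basis_expansion[of x] by (simp add: scalar_mult_eq_scaleR)
    then have "f x = f (\<Sum>i\<in>UNIV. x $ i *\<^sub>R axis i 1)" by simp
    also have "\<dots> = (\<Sum>i\<in>UNIV. x $ i * f (axis i 1))"
      using linear by (simp add: linear_sum[OF bounded_linear.linear] linear_cmul[OF bounded_linear.linear])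
    finally show "f x = (\<Sum>i\<in>UNIV. x $ i * f (axis i 1))" .
  qed
  moreover have "hpoly 1 (\<lambda>x. \<Sum>i\<in>UNIV. x $ i * f (axis i 1))"
    unfolding One_nat_def by (intro hpoly_sum hpoly.coord hpoly.const) auto
  ultimately have "hpoly 1 f" by metis
  then show ?case by (rule poly_sum.intros)
next
  case (const c) show ?case by (rule poly_sum.intros, rule hpoly.const)
qed (auto intro: poly_sum.intros poly_sum_mult)

text \<open>Stone-Weierstrass passes from polynomials to continuous functions on the ball that
  carries f, cut-offs by distance pass to closed sets, and induction over the generated
  sigma-algebra reaches all Borel sets.\<close>

lemma vanishing_moments:
  fixes f :: "real^'n::finite \<Rightarrow> real"
  assumes fi: "integrable lborel f" and R: "\<And>x. R \<le> norm x \<Longrightarrow> f x = 0"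
    and mom: "\<And>g. poly_sum g \<Longrightarrow> (\<integral>x. f x * g x \<partial>lborel) = 0"
  shows "AE x in lborel. f x = 0"
proof -
  have fm: "f \<in> borel_measurable lborel" using fi by auto
  have int: "integrable lborel (\<lambda>x. f x * g x)" if "continuous_on UNIV g" for g
  proof -
    have "compact (g ` cball 0 R)" by (intro compact_continuous_image continuous_on_subset[OF that]) auto
    then obtain B where B: "\<And>x. x \<in> cball 0 R \<Longrightarrow> \<bar>g x\<bar> \<le> B"
      using compact_imp_bounded bounded_iff by (metis imageI real_norm_def)
    show ?thesis
    proof (rule Bochner_Integration.integrable_bound[OF integrable_mult_right[OF integrable_abs[OF fi], of B]])
      show "(\<lambda>x. f x * g x) \<in> borel_measurable lborel"
        using fm borel_measurable_continuous_onI[OF that] by (auto intro: borel_measurable_times)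
      show "AE x in lborel. norm (f x * g x) \<le> norm (B * \<bar>f x\<bar>)"
      proof (intro AE_I2)
        fix x
        show "norm (f x * g x) \<le> norm (B * \<bar>f x\<bar>)"
        proof (cases "x \<in> cball 0 R")
          case True
          have "\<bar>f x\<bar> * \<bar>g x\<bar> \<le> \<bar>f x\<bar> * \<bar>B\<bar>" using B[OF True] by (intro mult_left_mono) auto
          then show ?thesis by (simp add: abs_mult mult.commute)
        qed (use R in simp)
      qed
    qed
  qed
  have cont: "(\<integral>x. f x * g x \<partial>lborel) = 0" if g: "continuous_on UNIV g" for g
  proof -
    define M where "M = (\<integral>x. \<bar>f x\<bar> \<partial>lborel)"
    have M: "0 \<le> M" unfolding M_def by simp
    have "\<bar>\<integral>x. f x * g x \<partial>lborel\<bar> \<le> e * M" if e: "e > 0" for e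
    proof -
      obtain h where h: "real_polynomial_function h" "\<And>x. x \<in> cball 0 R \<Longrightarrow> \<bar>g x - h x\<bar> < e"
        using Stone_Weierstrass_real_polynomial_function[of "cball 0 R" g e] continuous_on_subset[OF g] e by auto
      have hs: "poly_sum h" by (rule real_polynomial_poly_sum[OF h(1)])
      have hc: "continuous_on UNIV h" using continuous_real_polymonial_function[OF h(1)] by (auto intro!: continuous_at_imp_continuous_on)
      have "(\<integral>x. f x * g x \<partial>lborel) = (\<integral>x. f x * g x - f x * h x \<partial>lborel)"
        using int[OF g] int[OF hc] mom[OF hs] by simp
      also have "\<bar>\<dots>\<bar> \<le> (\<integral>x. \<bar>f x * g x - f x * h x\<bar> \<partial>lborel)" by (rule integral_abs_bound)
      also have "\<dots> \<le> (\<integral>x. e * \<bar>f x\<bar> \<partial>lborel)"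
      proof (intro integral_mono)
        show "integrable lborel (\<lambda>x. \<bar>f x * g x - f x * h x\<bar>)" using int[OF g] int[OF hc] by auto
        show "integrable lborel (\<lambda>x. e * \<bar>f x\<bar>)" using fi by auto
        fix x
        show "\<bar>f x * g x - f x * h x\<bar> \<le> e * \<bar>f x\<bar>"
        proof (cases "x \<in> cball 0 R")
          case True
          have "\<bar>f x\<bar> * \<bar>g x - h x\<bar> \<le> \<bar>f x\<bar> * e" using h(2)[OF True] by (intro mult_left_mono) auto
          then show ?thesis by (simp add: abs_mult[symmetric] right_diff_distrib mult.commute)
        qed (use R in simp)
      qed
      also have "\<dots> = e * M" by (simp add: M_def)
      finally show ?thesis .
    qed
    then have "\<bar>\<integral>x. f x * g x \<partial>lborel\<bar> \<le> 0 + e" if "e > 0" for e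
    proof -
      have "e / (M + 1) > 0" using that M by simp
      from \<open>\<And>e. e > 0 \<Longrightarrow> \<bar>\<integral>x. f x * g x \<partial>lborel\<bar> \<le> e * M\<close>[OF this]
      have "\<bar>\<integral>x. f x * g x \<partial>lborel\<bar> \<le> e / (M + 1) * M" .
      also have "\<dots> \<le> e" using that M by (simp add: field_simps)
      finally show ?thesis by simp
    qed
    then have "\<bar>\<integral>x. f x * g x \<partial>lborel\<bar> \<le> 0" by (rule field_le_epsilon)
    then show ?thesis by simp
  qed
  have cl: "(\<integral>x. f x * indicator C x \<partial>lborel) = 0" if C: "closed C" for C
  \<comment> \<open>\<open>infdist x {}\<close> is 0 by convention, so the cut-offs below would all
    be 1; the empty set is treated apart.\<close>
  proof (cases "C = {}")
    case False
    define g where "g n x = max 0 (1 - real n * infdist x C)" for n x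
    have gc: "continuous_on UNIV (g n)" for n unfolding g_def by (intro continuous_intros)
    have gb: "\<bar>g n x\<bar> \<le> 1" for n x using infdist_nonneg[of x C] by (auto simp: g_def)
    have "(\<lambda>n. \<integral>x. f x * g n x \<partial>lborel) \<longlonglongrightarrow> (\<integral>x. f x * indicator C x \<partial>lborel)"
    proof (rule integral_dominated_convergence[where w="\<lambda>x. \<bar>f x\<bar>"])
      show "(\<lambda>x. f x * indicator C x) \<in> borel_measurable lborel" using fm C by simp
      show "(\<lambda>x. f x * g n x) \<in> borel_measurable lborel" for n using int[OF gc] by auto
      show "integrable lborel (\<lambda>x. \<bar>f x\<bar>)" using fi by auto
      show "AE x in lborel. norm (f x * g n x) \<le> \<bar>f x\<bar>" for n
        using gb[of n] by (auto simp: abs_mult intro!: AE_I2 mult_left_le)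
      show "AE x in lborel. (\<lambda>n. f x * g n x) \<longlonglongrightarrow> f x * indicator C x"
      proof (intro AE_I2 tendsto_mult tendsto_const)
        fix x
        show "(\<lambda>n. g n x) \<longlonglongrightarrow> indicator C x"
        proof (cases "x \<in> C")
          case True then show ?thesis by (simp add: g_def)
        next
          case x: False
          then have p: "infdist x C > 0" using C False by (simp add: infdist_pos_not_in_closed)
          obtain n0 where n0: "1 / infdist x C < real n0" using reals_Archimedean2 by blast
          have "g n x = 0" if "n \<ge> n0" for n
          proof -
            have "1 / infdist x C < real n" using n0 that by linarith
            then show ?thesis using p by (simp add: g_def field_simps)
          qed
          then have "\<forall>\<^sub>F n in sequentially. g n x = 0" by (auto simp: eventually_sequentially)
          then show ?thesis using x by (simp add: tendsto_eventually)
        qed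
      qed
    qed
    then show ?thesis using cont[OF gc] by (simp add: LIMSEQ_const_iff)
  qed simp
  have tot: "integral\<^sup>L lborel f = 0" using cont[of "\<lambda>_. 1"] by simp
  have fA: "integrable lborel (\<lambda>x. f x * indicator A x)" if "A \<in> sets borel" for A
    using integrable_mult_indicator[of A lborel f] fi that by (simp add: mult.commute)
  have all: "(\<integral>x. f x * indicator A x \<partial>lborel) = 0" if A: "A \<in> sets borel" for A
  proof -
    \<comment> \<open>Closed sets form a generator stable under intersection; the complement step
      uses that the total integral of f is 0.\<close>
    have "Int_stable (Collect closed :: (real^'n) set set)" "Collect closed \<subseteq> Pow (UNIV :: (real^'n) set)" "A \<in> sigma_sets UNIV (Collect closed)"
      using A by (auto simp: Int_stable_def borel_eq_closed)
    then show ?thesis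
    proof (induct rule: sigma_sets_induct_disjoint)
      case (basic B) then show ?case using cl by simp
    next
      case empty show ?case by simp
    next
      case (compl B)
      then have B: "B \<in> sets borel" by (simp add: borel_eq_closed)
      have "(\<integral>x. f x * indicator (UNIV - B) x \<partial>lborel) = (\<integral>x. f x - f x * indicator B x \<partial>lborel)"
        by (intro Bochner_Integration.integral_cong) (auto simp: indicator_def)
      also have "\<dots> = 0" using fi fA[OF B] compl tot by simp
      finally show ?case .
    next
      case (union B)
      then have B: "B i \<in> sets borel" for i by (auto simp: borel_eq_closed)
      have "set_lebesgue_integral lborel (\<Union>i. B i) f = (\<Sum>i. set_lebesgue_integral lborel (B i) f)"
        by (intro lebesgue_integral_countable_add) (use B union(1) fA[of "\<Union>i. B i"] in \<open>auto simp: disjoint_family_on_def set_integrable_def mult.commute\<close>)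
      then show ?case using union(3) by (simp add: set_lebesgue_integral_def mult.commute)
    qed
  qed
  show ?thesis
    by (rule density_unique_real[OF fi, of "\<lambda>_. 0"]) (use all in \<open>auto simp: set_lebesgue_integral_def mult.commute\<close>)
qed

text \<open>A radial cut-off makes the support bounded and keeps it off the origin; the polynomial
  moments of the result are modes of u. The supports of the cut-offs exhaust the punctured
  space.\<close>

lemma modes_determine:
  fixes u :: "real^'n::finite \<Rightarrow> real"
  assumes lu: "locint u"
    and modes: "\<And>d p \<psi>. hpoly d p \<Longrightarrow> test_fun \<psi> \<Longrightarrow> (\<integral>x. u x * (p x * Rad (real d + m + 4) \<psi> x) \<partial>lborel) = 0"
  shows "AE x in lborel. u x = 0"
proof -
  have "AE x in lborel. \<forall>k::nat. u x = 0 \<or> x = 0 \<or> \<bar>ln (norm x)\<bar> \<ge> real k"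
  proof (subst AE_all_countable, intro allI)
    fix k :: nat
    show "AE x in lborel. u x = 0 \<or> x = 0 \<or> \<bar>ln (norm x)\<bar> \<ge> real k"
    proof (cases "k = 0")
      case False
      then obtain \<psi> where \<psi>: "test_fun \<psi>" "\<And>t. 0 \<le> \<psi> t" "\<And>t. 0 < \<psi> t \<longleftrightarrow> - real k < t \<and> t < real k"
        using bump_exists[of "- real k" "real k"] by auto
      obtain R where R: "\<And>q x. R \<le> norm (x::real^'n) \<Longrightarrow> Rad q \<psi> x = 0" using Rad_test_fun_zero_far[OF \<psi>(1)] by metis
      \<comment> \<open>The exponential absorbs the power of |x|, so one cut-off \<psi> serves every
        degree d with its own exponent.\<close>
      have e: "Rad 0 \<psi> x = Rad q (\<lambda>t. exp (q * t) * \<psi> t) x" for q and x :: "real^'n"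
      proof (cases "x = 0")
        case False
        have "norm x powr (- q) * exp (q * ln (norm x)) = 1" using False by (simp add: powr_def exp_minus)
        then show ?thesis unfolding Rad_def mult.assoc[symmetric] using False by simp
      qed simp
      have int: "integrable lborel (\<lambda>x. u x * (p x * Rad q \<psi> x))" if "hpoly d p" "test_fun \<psi>" for d p q \<psi>
        using locint_integrable_testfun[OF lu radial_test_testfun[OF radial_test.gen[OF that]]] .
      have "AE x in lborel. u x * Rad 0 \<psi> x = 0"
      proof (rule vanishing_moments[where R=R])
        show "integrable lborel (\<lambda>x. u x * Rad 0 \<psi> x)" using int[OF hpoly.const[of 1] \<psi>(1), of 0] by simp
        show "u x * Rad 0 \<psi> x = 0" if "R \<le> norm x" for x using R[OF that] by simp
        fix g :: "real^'n \<Rightarrow> real" assume "poly_sum g"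
        then have "integrable lborel (\<lambda>x. u x * Rad 0 \<psi> x * g x) \<and> (\<integral>x. u x * Rad 0 \<psi> x * g x \<partial>lborel) = 0"
        proof (induction rule: poly_sum.induct)
          case (1 d p)
          let ?\<psi> = "\<lambda>t. exp ((real d + m + 4) * t) * \<psi> t"
          have eq: "(\<lambda>x. u x * Rad 0 \<psi> x * p x) = (\<lambda>x. u x * (p x * Rad (real d + m + 4) ?\<psi> x))"
            by (rule ext, subst e[of _ "real d + m + 4"]) (simp only: mult.assoc mult.commute[of "Rad _ _ _"])
          show ?case unfolding eq using int[OF 1 test_fun_exp[OF \<psi>(1)]] modes[OF 1 test_fun_exp[OF \<psi>(1)]] by blast
        next
          case (2 f g) then show ?case by (simp add: distrib_left)
        qed
        then show "(\<integral>x. u x * Rad 0 \<psi> x * g x \<partial>lborel) = 0" by simp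
      qed
      then show ?thesis
      proof (rule AE_mp[OF _ AE_I2], intro impI)
        fix x assume "u x * Rad 0 \<psi> x = 0"
        moreover have "Rad 0 \<psi> x > 0" if "x \<noteq> 0" "\<bar>ln (norm x)\<bar> < real k"
          using \<psi>(3)[of "ln (norm x)"] that by (auto simp: Rad_def)
        ultimately show "u x = 0 \<or> x = 0 \<or> real k \<le> \<bar>ln (norm x)\<bar>" by force
      qed
    qed simp
  qed
  moreover have "AE x in lborel. x \<noteq> (0::real^'n)" by (rule AE_lborel_singleton)
  ultimately show ?thesis
  proof eventually_elim
    case (elim x)
    obtain k :: nat where "\<bar>ln (norm x)\<bar> < real k" using reals_Archimedean2 by blast
    then show ?case using elim(1)[rule_format, of k] elim(2) by auto
  qed
qed

section \<open>Radial integrals and integration by parts across the origin\<close>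

lemma Rad_measurable:
  assumes [measurable]: "w \<in> borel_measurable borel" shows "Rad q w \<in> borel_measurable borel"
  unfolding Rad_def[abs_def] by measurable

text \<open>Each shell of unit width in ln |x| has |x|^-N mass at most c, and the weights
  exp(-\<delta> k) form a geometric series.\<close>

lemma Rad_decay_integrable:
  fixes N \<delta> :: real assumes N: "N = real CARD('n::finite)" and \<delta>: "\<delta> > 0"
  shows "integrable lborel (Rad N (\<lambda>t. exp (- \<delta> * \<bar>t\<bar>)) :: real^'n \<Rightarrow> real)"
proof -
  define f :: "nat \<Rightarrow> real^'n \<Rightarrow> real" where "f k x = exp (- \<delta> * real k) * (norm x powr (-N) * indicator (shell (real k) (real k + 1)) x
     + norm x powr (-N) * indicator (shell (- real k - 1) (- real k)) x)" for k x
  define c where "c = unit_ball_vol N * (exp N - 1)"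
  have fi: "integrable lborel (f k)" for k
    unfolding f_def[abs_def] by (intro integrable_mult_right Bochner_Integration.integrable_add shell_norm_integral(1)[OF N]) auto
  have fn: "0 \<le> f k x" for k x by (simp add: f_def)
  have fc: "integral\<^sup>L lborel (f k) \<le> 2 * c * exp (- \<delta>) ^ k" for k
  proof -
    have "integral\<^sup>L lborel (f k) = exp (- \<delta> * real k) * (integral\<^sup>L lborel (\<lambda>x::real^'n. norm x powr (-N) * indicator (shell (real k) (real k + 1)) x)
       + integral\<^sup>L lborel (\<lambda>x::real^'n. norm x powr (-N) * indicator (shell (- real k - 1) (- real k)) x))"
      unfolding f_def[abs_def] using shell_norm_integral(1)[OF N, of "real k" "real k + 1"] shell_norm_integral(1)[OF N, of "- real k - 1" "- real k"] by simp
    also have "\<dots> \<le> exp (- \<delta> * real k) * (c + c)"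
      using shell_norm_integral(2)[OF N, of "real k" "real k + 1"] shell_norm_integral(2)[OF N, of "- real k - 1" "- real k"]
      by (intro mult_left_mono add_mono) (auto simp: c_def)
    also have "\<dots> = 2 * c * exp (- \<delta>) ^ k" by (simp add: exp_of_nat_mult[symmetric] mult.commute)
    finally show ?thesis .
  qed
  have r: "summable (\<lambda>k. C * exp (- \<delta>) ^ k)" for C using \<delta> by (intro summable_mult summable_geometric) simp
  have fs: "summable (\<lambda>k. f k x)" for x
  proof (rule summable_comparison_test_ev[OF always_eventually r[of "2 * norm x powr (-N)"]], intro allI)
    fix k
    have "f k x \<le> exp (- \<delta> * real k) * (norm x powr (-N) + norm x powr (-N))"
      unfolding f_def by (intro mult_left_mono add_mono) (auto simp: indicator_def)
    then show "norm (f k x) \<le> 2 * norm x powr (- N) * exp (- \<delta>) ^ k"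
      using fn[of k x] by (simp add: exp_of_nat_mult[symmetric] mult_ac)
  qed
  have si: "integrable lborel (\<lambda>x. \<Sum>k. f k x)"
  proof (rule integrable_suminf[OF fi])
    show "AE x in lborel. summable (\<lambda>k. norm (f k x))" using fs fn by auto
    show "summable (\<lambda>k. \<integral>x. norm (f k x) \<partial>lborel)"
      by (rule summable_comparison_test_ev[OF always_eventually r[of "2 * c"]]) (use fn fc in auto)
  qed
  have le: "Rad N (\<lambda>t. exp (- \<delta> * \<bar>t\<bar>)) x \<le> (\<Sum>k. f k x)" for x :: "real^'n"
  proof (cases "x = 0")
    case True then show ?thesis using suminf_nonneg[OF fs fn] by simp
  next
    case False
    define t where "t = ln (norm x)"
    have nx: "norm x = exp t" using False by (simp add: t_def)
    obtain k :: nat where k: "real k \<le> \<bar>t\<bar>" "x \<in> shell (real k) (real k + 1) \<or> x \<in> shell (- real k - 1) (- real k)"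
    proof (cases "t > 0")
      case True
      \<comment> \<open>Shells are open inside and closed outside: positive t requires k < t \<le> k
        + 1, hence the ceiling; other t require -k - 1 < t \<le> -k, hence the floor below.\<close>
      define k where "k = nat (\<lceil>t\<rceil> - 1)"
      have "real k = of_int \<lceil>t\<rceil> - 1" using True by (simp add: k_def)
      then have "real k < t" "t \<le> real k + 1" by linarith+
      then show ?thesis using True by (intro that[of k]) (auto simp: shell_def nx)
    next
      case False
      define k where "k = nat \<lfloor>-t\<rfloor>"
      have "real k = of_int \<lfloor>-t\<rfloor>" using False by (simp add: k_def)
      then have "real k \<le> -t" "-t < real k + 1" by linarith+
      then show ?thesis using False by (intro that[of k]) (auto simp: shell_def nx)
    qed
    have "Rad N (\<lambda>t. exp (- \<delta> * \<bar>t\<bar>)) x = norm x powr (-N) * exp (- \<delta> * \<bar>t\<bar>)" by (simp add: Rad_def t_def)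
    also have "\<dots> \<le> norm x powr (-N) * exp (- \<delta> * real k)" using k(1) \<delta> by (intro mult_left_mono) auto
    also have "\<dots> \<le> f k x" using k(2) by (auto simp: f_def indicator_def algebra_simps)
    also have "\<dots> \<le> (\<Sum>k. f k x)" using sum_le_suminf[OF fs, of "{k}"] fn by simp
    finally show ?thesis .
  qed
  have me: "(Rad N (\<lambda>t. exp (- \<delta> * \<bar>t\<bar>)) :: real^'n \<Rightarrow> real) \<in> borel_measurable lborel"
    using Rad_measurable[of "\<lambda>t. exp (- \<delta> * \<bar>t\<bar>)" N] by simp
  have nn: "0 \<le> Rad N (\<lambda>t. exp (- \<delta> * \<bar>t\<bar>)) x" for x :: "real^'n" by (simp add: Rad_def)
  show ?thesis
  proof (rule Bochner_Integration.integrable_bound[OF si me], intro AE_I2)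
    fix x :: "real^'n"
    show "norm (Rad N (\<lambda>t. exp (- \<delta> * \<bar>t\<bar>)) x) \<le> norm (\<Sum>k. f k x)" using le[of x] nn[of x] unfolding real_norm_def by linarith
  qed
qed

lemma integrable_Rad_dominated:
  fixes f :: "real^'n::finite \<Rightarrow> real"
  assumes N: "N = real CARD('n)" and \<delta>: "\<delta> > 0" and f: "f \<in> borel_measurable borel"
    and b: "\<And>x. \<bar>f x\<bar> \<le> C * Rad N (\<lambda>t. exp (- \<delta> * \<bar>t\<bar>)) x"
  shows "integrable lborel f"
  by (rule Bochner_Integration.integrable_bound[OF integrable_mult_right[OF Rad_decay_integrable[OF N \<delta>], of C]])
     (use f in simp, intro AE_I2, unfold real_norm_def, rule order_trans[OF b abs_ge_self])

text \<open>|x|^-s is compared with |x|^-N exp(-\<delta> |ln |x||) for \<delta> = N - s. They agree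
  in the unit ball off the origin, and on a bounded set the loss is a constant.\<close>

lemma locint_power_bound:
  fixes f :: "real^'n::finite \<Rightarrow> real"
  assumes s: "s < real CARD('n)" and f: "f \<in> borel_measurable borel" and b: "\<And>x. x \<noteq> 0 \<Longrightarrow> \<bar>f x\<bar> \<le> C * norm x powr (- s)" and C: "C \<ge> 0"
  shows "locint f"
  unfolding locint_def
proof (intro conjI allI impI)
  show "f \<in> borel_measurable lborel" using f by simp
  fix K :: "(real^'n) set" assume K: "compact K"
  obtain M0 where M0: "\<And>x. x \<in> K \<Longrightarrow> norm x \<le> M0" using compact_imp_bounded[OF K] unfolding bounded_iff by blast
  define M where "M = max M0 1"
  have M: "M \<ge> 1" "\<And>x. x \<in> K \<Longrightarrow> norm x \<le> M" using M0 by (auto simp: M_def le_max_iff_disj)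
  define N where "N = real CARD('n)"
  define \<delta> where "\<delta> = N - s"
  have \<delta>: "\<delta> > 0" using s by (simp add: \<delta>_def N_def)
  \<comment> \<open>The origin is removed because the bound on f holds only off it. The constant
    comes from t + |t| \<le> 2 ln M, valid since t \<le> ln M and 0 \<le> ln M.\<close>
  have "integrable lborel (\<lambda>x. indicator (K - {0}) x * f x)"
  proof (rule integrable_Rad_dominated[OF N_def \<delta>, where C="C * exp (2 * \<delta> * ln M)"])
    have "K \<in> sets borel" by (rule borel_closed[OF compact_imp_closed[OF K]])
    then show "(\<lambda>x. indicator (K - {0}) x * f x) \<in> borel_measurable borel" using f by measurable
    fix x
    show "\<bar>indicator (K - {0}) x * f x\<bar> \<le> C * exp (2 * \<delta> * ln M) * Rad N (\<lambda>t. exp (- \<delta> * \<bar>t\<bar>)) x"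
    proof (cases "x \<in> K - {0}")
      case False then show ?thesis using C by (auto simp: Rad_def)
    next
      case True
      define t where "t = ln (norm x)"
      have nx: "norm x = exp t" using True by (simp add: t_def)
      have "t \<le> ln M" unfolding t_def using True M by (subst ln_le_cancel_iff) auto
      moreover have "0 \<le> ln M" using M by simp
      ultimately have "\<delta> * (t + \<bar>t\<bar>) \<le> \<delta> * (2 * ln M)" using \<delta> by (intro mult_left_mono) auto
      then have "- s * t \<le> 2 * \<delta> * ln M + (- N * t + - \<delta> * \<bar>t\<bar>)" by (simp add: \<delta>_def algebra_simps)
      then have "exp (- s * t) \<le> exp (2 * \<delta> * ln M) * (exp (- N * t) * exp (- \<delta> * \<bar>t\<bar>))"
        unfolding exp_add[symmetric] by simp
      then have "C * norm x powr (- s) \<le> C * (exp (2 * \<delta> * ln M) * Rad N (\<lambda>t. exp (- \<delta> * \<bar>t\<bar>)) x)"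
        using C by (intro mult_left_mono) (simp_all add: Rad_def nx powr_def)
      then show ?thesis using b[of x] True by (simp add: mult.assoc)
    qed
  qed
  then have "integrable lborel (\<lambda>x. indicator K x *\<^sub>R f x)"
  proof (rule integrable_cong_AE_imp)
    have "K \<in> sets borel" by (rule borel_closed[OF compact_imp_closed[OF K]])
    then show "(\<lambda>x. indicator K x *\<^sub>R f x) \<in> borel_measurable lborel" using f by simp
    have "AE x in lborel. x \<noteq> (0::real^'n)" by (rule AE_lborel_singleton)
    then show "AE x in lborel. indicator (K - {0}) x * f x = indicator K x *\<^sub>R f x"
      by eventually_elim (auto simp: indicator_def)
  qed
  then show "set_integrable lborel K f" by (simp add: set_integrable_def)
qed

text \<open>The majorant is a multiple of |x|^(d-s) |\<phi>|, integrable because s - d < N. The y k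
  will be cut-offs near the origin, which agree with z at each t from some k on.\<close>

lemma Rad_limit:
  fixes \<phi> p :: "real^'n::finite \<Rightarrow> real"
  assumes p: "hpoly d p" and s: "s - real d < real CARD('n)" and \<phi>: "continuous_on UNIV \<phi>" "\<And>x. R \<le> norm x \<Longrightarrow> \<phi> x = 0"
    and c: "\<And>k. continuous_on UNIV (y k)" "continuous_on UNIV z"
    and b: "\<And>k t. \<bar>y k t\<bar> \<le> B" and lim: "\<And>t. \<forall>\<^sub>F k in sequentially. y k t = z t"
  shows "(\<lambda>k. \<integral>x. p x * Rad s (y k) x * \<phi> x \<partial>lborel) \<longlonglongrightarrow> (\<integral>x. p x * Rad s z x * \<phi> x \<partial>lborel)"
proof -
  obtain C where C: "C \<ge> 0" "\<And>x. \<bar>p x\<bar> \<le> C * norm x ^ d" using hpoly_bound[OF p] by blast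
  have B: "B \<ge> 0" using b[of 0 0] by linarith
  have pm: "p \<in> borel_measurable borel" by (rule borel_measurable_continuous_onI[OF hpoly_continuous[OF p]])
  have \<phi>m: "\<phi> \<in> borel_measurable borel" by (rule borel_measurable_continuous_onI[OF \<phi>(1)])
  note m = Rad_measurable[OF borel_measurable_continuous_onI]
  define h where "h x = norm x powr (- (s - real d))" for x :: "real^'n"
  have lh: "locint h"
    by (rule locint_power_bound[OF s, of _ 1]) (auto simp: h_def[abs_def])
  show ?thesis
  proof (rule integral_dominated_convergence[where w="\<lambda>x. \<bar>C * B * (h x * \<phi> x)\<bar>"])
    show "(\<lambda>x. p x * Rad s z x * \<phi> x) \<in> borel_measurable lborel" by (simp, intro borel_measurable_times pm \<phi>m m[OF c(2)])
    show "(\<lambda>x. p x * Rad s (y k) x * \<phi> x) \<in> borel_measurable lborel" for k by (simp, intro borel_measurable_times pm \<phi>m m[OF c(1)])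
    show "integrable lborel (\<lambda>x. \<bar>C * B * (h x * \<phi> x)\<bar>)"
      by (intro integrable_abs integrable_mult_right locint_integrable_times[OF lh \<phi>])
    show "AE x in lborel. (\<lambda>k. p x * Rad s (y k) x * \<phi> x) \<longlonglongrightarrow> p x * Rad s z x * \<phi> x"
    proof (intro AE_I2 tendsto_eventually)
      fix x :: "real^'n"
      show "\<forall>\<^sub>F k in sequentially. p x * Rad s (y k) x * \<phi> x = p x * Rad s z x * \<phi> x"
        using lim[of "ln (norm x)"] by eventually_elim (simp add: Rad_def)
    qed
    show "AE x in lborel. norm (p x * Rad s (y k) x * \<phi> x) \<le> \<bar>C * B * (h x * \<phi> x)\<bar>" for k
    proof (intro AE_I2)
      fix x :: "real^'n"
      show "norm (p x * Rad s (y k) x * \<phi> x) \<le> \<bar>C * B * (h x * \<phi> x)\<bar>"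
      proof (cases "x = 0")
        case False
        have "\<bar>p x * Rad s (y k) x\<bar> \<le> (C * norm x ^ d) * (norm x powr (- s) * B)"
          unfolding abs_mult Rad_def using C b[of k "ln (norm x)"] by (intro mult_mono) auto
        also have "\<dots> = C * B * h x"
          using False by (simp add: h_def powr_realpow[symmetric] powr_add[symmetric] algebra_simps)
        finally have "\<bar>p x * Rad s (y k) x\<bar> * \<bar>\<phi> x\<bar> \<le> C * B * h x * \<bar>\<phi> x\<bar>" by (intro mult_right_mono) auto
        then show ?thesis using C(1) B by (simp add: abs_mult h_def mult.assoc)
      qed simp
    qed
  qed
qed

lemma Rad_zero_near:
  assumes "\<And>t. t < R \<Longrightarrow> w t = 0" "x \<in> ball (0::real^'n::finite) (exp R)"
  shows "Rad q w x = 0"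
proof (cases "x = 0")
  case False
  then have "ln (norm x) < R" using assms(2) by (metis exp_ln exp_less_cancel_iff mem_ball_0 zero_less_norm_iff)
  then show ?thesis using assms(1) by (simp add: Rad_def)
qed simp

text \<open>The hypothesis \<open>near\<close> keeps the singularity of the radial weights at the origin out of the support of the integrand.\<close>

lemma Rad_by_parts:
  fixes \<phi> p :: "real^'n::finite \<Rightarrow> real"
  assumes p: "hpoly d p" and \<phi>: "testfun S \<phi>" and w: "\<And>t. (w has_real_derivative w1 t) (at t)" and c: "continuous_on UNIV w1"
    and near: "(\<exists>\<delta>>0. \<forall>x\<in>ball 0 \<delta>. \<phi> x = 0) \<or> (\<exists>R. \<forall>t<R. w t = 0)"
  shows "(\<integral>x. (p x * Rad q w x) * pd i \<phi> x \<partial>lborel)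
    = - (\<integral>x. (pd i p x * Rad q w x + (x $ i * p x) * Rad (q + 2) (\<lambda>t. w1 t - q * w t) x) * \<phi> x \<partial>lborel)" (is ?eq)
    "integrable lborel (\<lambda>x. (p x * Rad q w x) * pd i \<phi> x)" (is ?i1)
    "integrable lborel (\<lambda>x. (pd i p x * Rad q w x + (x $ i * p x) * Rad (q + 2) (\<lambda>t. w1 t - q * w t) x) * \<phi> x)" (is ?i2)
proof -
  obtain \<delta> where d: "\<delta> > 0" "(\<forall>x\<in>ball 0 \<delta>. \<phi> x = 0) \<or> (\<forall>x\<in>ball (0::real^'n) \<delta>. p x * Rad q w x = 0)"
  proof (cases "\<exists>\<delta>>0. \<forall>x\<in>ball 0 \<delta>. \<phi> x = 0")
    case True then show ?thesis using that by blast
  next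
    case False
    then obtain R where "\<And>t. t < R \<Longrightarrow> w t = 0" using near by blast
    then have "\<forall>x\<in>ball (0::real^'n) (exp R). p x * Rad q w x = 0" by (auto intro: Rad_zero_near)
    then show ?thesis using that[of "exp R"] by simp
  qed
  have cw: "continuous_on UNIV w" using DERIV_isCont[OF w] by (auto intro!: continuous_at_imp_continuous_on)
  have cp: "continuous_on (UNIV - {0}) p" "continuous_on (UNIV - {0}) (pd i p)"
    using hpoly_continuous[OF p] hpoly_continuous[of "d - 1" "pd i p"] hpoly_pd[OF p] continuous_on_subset by blast+
  have c2: "continuous_on UNIV (\<lambda>t. w1 t - q * w t)" by (intro continuous_intros c cw)
  have cf: "continuous_on (UNIV - {0}) (\<lambda>x. p x * Rad q w x)" by (intro continuous_intros continuous_Rad cp cw)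
  have cf': "continuous_on (UNIV - {0}) (\<lambda>x. pd i p x * Rad q w x + (x $ i * p x) * Rad (q + 2) (\<lambda>t. w1 t - q * w t) x)"
    by (intro continuous_on_add continuous_on_mult continuous_Rad[OF cw] continuous_Rad[OF c2] cp continuous_intros)
  note ibp = integral_by_parts_pd[OF \<phi> cf cf' hasPD_poly_Rad[OF p w] _ _ d]
  show ?eq by (rule ibp(1)) auto
  show ?i1 by (rule ibp(2)) auto
  show ?i2 by (rule ibp(3)) auto
qed

text \<open>Summation over the coordinates turns the constant terms into N and the squares into
  |x|^2, so the divergence of x |x|^-q w has the radial factor w' + (N - q) w.\<close>

lemma Rad_divergence_by_parts:
  fixes \<phi> :: "real^'n::finite \<Rightarrow> real"
  assumes \<phi>: "testfun S \<phi>" and w: "\<And>t. (w has_real_derivative w1 t) (at t)" and c: "continuous_on UNIV w1"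
    and near: "(\<exists>\<delta>>0. \<forall>x\<in>ball 0 \<delta>. \<phi> x = 0) \<or> (\<exists>R. \<forall>t<R. w t = 0)"
  shows "(\<Sum>i\<in>UNIV. \<integral>x. (x $ i * Rad q w x) * pd i \<phi> x \<partial>lborel)
    = - (\<integral>x. Rad q (\<lambda>t. w1 t + (real CARD('n) - q) * w t) x * \<phi> x \<partial>lborel)"
    "\<And>i. integrable lborel (\<lambda>x. (x $ i * Rad q w x) * pd i \<phi> x)"
proof -
  have hp: "hpoly 1 (\<lambda>x::real^'n. x $ i)" for i using hpoly.coord[OF hpoly.const[of 1], of i] by simp
  have p1: "pd i (\<lambda>x. x $ i) x = 1" for i and x :: "real^'n" using hasPD_pd[OF hasPD_coord[of i i x]] by simp
  let ?B = "\<lambda>i x. (1 * Rad q w x + (x $ i * x $ i) * Rad (q + 2) (\<lambda>t. w1 t - q * w t) x) * \<phi> x"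
  note ibp = Rad_by_parts[OF hp \<phi> w c near, where q=q]
  have i3: "integrable lborel (?B i)" for i
    using Rad_by_parts(3)[OF hp[of i] \<phi> w c near, where q=q and i=i] by (simp only: p1)
  show "integrable lborel (\<lambda>x. (x $ i * Rad q w x) * pd i \<phi> x)" for i by (rule ibp(2))
  have "(\<Sum>i\<in>UNIV. \<integral>x. (x $ i * Rad q w x) * pd i \<phi> x \<partial>lborel) = (\<Sum>i\<in>UNIV. - (\<integral>x. ?B i x \<partial>lborel))"
    by (intro sum.cong refl) (subst ibp(1), simp only: p1)
  also have "\<dots> = - (\<integral>x. (\<Sum>i\<in>UNIV. ?B i x) \<partial>lborel)"
    unfolding sum_negf by (subst Bochner_Integration.integral_sum) (auto simp: i3[simplified])
  also have "(\<lambda>x. \<Sum>i\<in>UNIV. ?B i x) = (\<lambda>x. Rad q (\<lambda>t. w1 t + (real CARD('n) - q) * w t) x * \<phi> x)"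
  proof
    fix x :: "real^'n"
    have xx: "(\<Sum>i\<in>UNIV. x $ i * x $ i) = (norm x)\<^sup>2" by (simp add: power2_norm_eq_inner inner_vec_def)
    have "(\<Sum>i\<in>UNIV. ?B i x) = (real CARD('n) * Rad q w x + (norm x)\<^sup>2 * Rad (q + 2) (\<lambda>t. w1 t - q * w t) x) * \<phi> x"
      unfolding sum_distrib_right[symmetric] by (simp add: sum.distrib sum_distrib_right[symmetric] xx)
    also have "\<dots> = Rad q (\<lambda>t. w1 t + (real CARD('n) - q) * w t) x * \<phi> x"
      unfolding Rad_norm2 by (simp add: Rad_def algebra_simps)
    finally show "(\<Sum>i\<in>UNIV. ?B i x) = Rad q (\<lambda>t. w1 t + (real CARD('n) - q) * w t) x * \<phi> x" .
  qed
  finally show "(\<Sum>i\<in>UNIV. \<integral>x. (x $ i * Rad q w x) * pd i \<phi> x \<partial>lborel)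
    = - (\<integral>x. Rad q (\<lambda>t. w1 t + (real CARD('n) - q) * w t) x * \<phi> x \<partial>lborel)" .
qed

lemma Rad_laplacian_by_parts:
  fixes \<phi> :: "real^'n::finite \<Rightarrow> real"
  assumes \<phi>: "testfun S \<phi>" and w: "\<And>t. (w has_real_derivative w1 t) (at t)" "\<And>t. (w1 has_real_derivative w2 t) (at t)" and c: "continuous_on UNIV w2"
    and near: "(\<exists>\<delta>>0. \<forall>x\<in>ball 0 \<delta>. \<phi> x = 0) \<or> (\<exists>R. \<forall>t<R. w t = 0)"
  shows "(\<integral>x. Rad q w x * clap \<phi> x \<partial>lborel)
    = (\<integral>x. Rad (q + 2) (\<lambda>t. (w2 t - q * w1 t) + (real CARD('n) - q - 2) * (w1 t - q * w t)) x * \<phi> x \<partial>lborel)"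
proof -
  have c1: "continuous_on UNIV w1" using DERIV_isCont[OF w(2)] by (auto intro!: continuous_at_imp_continuous_on)
  have near': "(\<exists>\<delta>>0. \<forall>x\<in>ball 0 \<delta>. pd i \<phi> x = 0) \<or> (\<exists>R. \<forall>t<R. w t = 0)" for i
    using near pd_zero_near[of _ \<phi>] by metis
  \<comment> \<open>A function that vanishes on a half-line has zero derivative there, so the
    alternative carries over to the second integration by parts.\<close>
  have near'': "(\<exists>\<delta>>0. \<forall>x\<in>ball 0 \<delta>. \<phi> x = 0) \<or> (\<exists>R. \<forall>t<R. w1 t - q * w t = 0)"
  proof (cases "\<exists>\<delta>>0. \<forall>x\<in>ball 0 \<delta>. \<phi> x = 0")
    case False
    then obtain R where R: "\<And>t. t < R \<Longrightarrow> w t = 0" using near by blast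
    have "w1 t = 0" if "t < R" for t
    proof -
      have "((\<lambda>t. 0::real) has_real_derivative w1 t) (at t)"
        using R that by (intro DERIV_cong_ev[THEN iffD1, OF refl _ refl w(1)] eventually_nhds[THEN iffD2] exI[of _ "{..<R}"]) auto
      then show ?thesis using DERIV_unique DERIV_const by blast
    qed
    then have "\<forall>t<R. w1 t - q * w t = 0" using R by simp
    then show ?thesis by blast
  qed auto
  have du: "((\<lambda>t. w1 t - q * w t) has_real_derivative w2 t - q * w1 t) (at t)" for t by (auto intro!: derivative_eq_intros w)
  have cu: "continuous_on UNIV (\<lambda>t. w2 t - q * w1 t)" by (intro continuous_intros c c1)
  have h0: "hpoly 0 (\<lambda>x::real^'n. 1)" by (rule hpoly.const)
  have p0: "pd i (\<lambda>x::real^'n. 1) x = 0" for i x by (rule hasPD_pd, rule hasPD_const)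
  note ibp = Rad_by_parts[OF h0 testfun_pd[OF \<phi>] w(1) c1 near', where q=q]
  have "(\<integral>x. Rad q w x * clap \<phi> x \<partial>lborel) = (\<integral>x. (\<Sum>i\<in>UNIV. (1 * Rad q w x) * pd i (pd i \<phi>) x) \<partial>lborel)"
    by (simp add: clap_def sum_distrib_left)
  also have "\<dots> = (\<Sum>i\<in>UNIV. \<integral>x. (1 * Rad q w x) * pd i (pd i \<phi>) x \<partial>lborel)"
    by (intro Bochner_Integration.integral_sum ibp(2))
  also have "\<dots> = - (\<Sum>i\<in>UNIV. \<integral>x. (x $ i * Rad (q + 2) (\<lambda>t. w1 t - q * w t) x) * pd i \<phi> x \<partial>lborel)"
    unfolding sum_negf[symmetric] by (intro sum.cong refl) (subst ibp(1), simp add: p0)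
  also have "\<dots> = (\<integral>x. Rad (q + 2) (\<lambda>t. (w2 t - q * w1 t) + (real CARD('n) - (q + 2)) * (w1 t - q * w t)) x * \<phi> x \<partial>lborel)"
    by (subst Rad_divergence_by_parts(1)[OF \<phi> du cu near'']) simp
  finally show ?thesis by (simp add: diff_diff_eq)
qed

section \<open>A smooth step with bounded derivatives\<close>

lemma test_fun_bounded: assumes "test_fun \<psi>" obtains B where "\<And>t. \<bar>\<psi> t\<bar> \<le> B"
proof -
  obtain R where R: "R > 0" "\<And>t. R \<le> \<bar>t\<bar> \<Longrightarrow> \<psi> t = 0" using test_fun_support[OF assms] by blast
  have "compact (\<psi> ` {-R..R})" by (intro compact_continuous_image continuous_on_subset[OF test_fun_continuous[OF assms]]) auto
  then obtain B where B: "\<And>t. t \<in> {-R..R} \<Longrightarrow> \<bar>\<psi> t\<bar> \<le> B"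
    using compact_imp_bounded bounded_iff by (metis imageI real_norm_def)
  have "\<bar>\<psi> t\<bar> \<le> B" for t
  proof (cases "t \<in> {-R..R}")
    case False
    then have "\<psi> t = 0" by (intro R(2)) auto
    moreover have "0 \<le> B" using B[of 0] R(1) by auto
    ultimately show ?thesis by simp
  qed (rule B)
  then show thesis using that by blast
qed

text \<open>A normalised primitive of a bump on (-1, 0). Its translates in t = ln |x| will cut off
  the origin.\<close>

lemma smooth_step:
  obtains \<eta> \<eta>1 \<eta>2 :: "real \<Rightarrow> real" and B where "\<And>t. (\<eta> has_real_derivative \<eta>1 t) (at t)" "\<And>t. (\<eta>1 has_real_derivative \<eta>2 t) (at t)"
    "continuous_on UNIV \<eta>2" "\<And>t. t \<le> -1 \<Longrightarrow> \<eta> t = 0" "\<And>t. t \<ge> 0 \<Longrightarrow> \<eta> t = 1 \<and> \<eta>1 t = 0 \<and> \<eta>2 t = 0"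
    "\<And>t. \<bar>\<eta> t\<bar> \<le> B" "\<And>t. \<bar>\<eta>1 t\<bar> \<le> B" "\<And>t. \<bar>\<eta>2 t\<bar> \<le> B"
proof -
  obtain \<rho> where \<rho>: "test_fun \<rho>" "\<And>t. 0 \<le> \<rho> t" "\<And>t. 0 < \<rho> t \<longleftrightarrow> -1 < t \<and> t < 0"
    using bump_exists[of "-1" 0] by auto
  define h where "h t = antideriv \<rho> t - antideriv \<rho> (-1)" for t
  have dh: "(h has_real_derivative \<rho> t) (at t)" for t
    unfolding h_def by (auto intro!: derivative_eq_intros antideriv_DERIV test_fun_continuous \<rho>)
  have \<rho>0: "\<rho> t = 0" if "t \<le> -1 \<or> 0 \<le> t" for t using \<rho>(2)[of t] \<rho>(3)[of t] that by auto
  have "\<exists>z. z > -1 \<and> z < 0 \<and> h 0 - h (-1) = (0 - (-1)) * \<rho> z" using MVT2[of "-1" 0 h \<rho>] dh by auto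
  then obtain z where z: "z > -1" "z < 0" "h 0 - h (-1) = \<rho> z" by auto
  then have "0 < \<rho> z" using \<rho>(3)[of z] by simp
  then have c: "h 0 > 0" using z(3) by (simp add: h_def)
  have hz: "h t = 0" if tl: "t \<le> -1" for t
  proof (cases "t = -1")
    case False
    then obtain z where "z < -1" "h (-1) - h t = (-1 - t) * \<rho> z" using MVT2[of t "-1" h \<rho>] dh tl by force
    then show ?thesis using \<rho>0[of z] by (simp add: h_def)
  qed (simp add: h_def)
  have ht: "h t = h 0" if tl: "t \<ge> 0" for t
  proof (cases "t = 0")
    case False
    then obtain z where "z > 0" "h t - h 0 = (t - 0) * \<rho> z" using MVT2[of 0 t h \<rho>] dh tl by force
    then show ?thesis using \<rho>0[of z] by simp
  qed simp
  have ch: "continuous_on {-1..0} h" using DERIV_isCont[OF dh] by (auto intro!: continuous_at_imp_continuous_on)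
  have "compact (h ` {-1..0})" by (intro compact_continuous_image ch) auto
  then obtain B0 where B0: "\<And>t. t \<in> {-1..0} \<Longrightarrow> \<bar>h t\<bar> \<le> B0"
    using compact_imp_bounded bounded_iff by (metis imageI real_norm_def)
  have B0': "\<bar>h t\<bar> \<le> B0" for t
    using B0[of t] B0[of 0] hz[of t] ht[of t] by (cases "t \<in> {-1..0}") auto
  obtain B1 where B1: "\<And>t. \<bar>\<rho> t\<bar> \<le> B1" using test_fun_bounded[OF \<rho>(1)] by blast
  obtain B2 where B2: "\<And>t. \<bar>deriv \<rho> t\<bar> \<le> B2" using test_fun_bounded[OF test_fun_deriv[OF \<rho>(1)]] by blast
  have d0: "deriv \<rho> t = 0" if "t \<ge> 0" for t
  proof (cases "t = 0")
    case False
    have "((\<lambda>t. 0::real) has_real_derivative deriv \<rho> t) (at t)"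
      using \<rho>0 that False by (intro DERIV_cong_ev[THEN iffD1, OF refl _ refl test_fun_DERIV[OF \<rho>(1)]] eventually_nhds[THEN iffD2] exI[of _ "{0<..}"]) auto
    then show ?thesis using DERIV_unique DERIV_const by blast
  next
    case True
    \<comment> \<open>0 is the right end of the support, so \<rho> does not vanish near it; as a
      zero of a nonnegative function it is a minimum.\<close>
    have "\<forall>y. \<bar>0 - y\<bar> < 1 \<longrightarrow> \<rho> 0 \<le> \<rho> y" using \<rho>0[of 0] \<rho>(2) by simp
    then show ?thesis using DERIV_local_min[OF test_fun_DERIV[OF \<rho>(1), of 0], of 1] True by simp
  qed
  define B where "B = max B0 (max B1 B2) / h 0"
  have Bd: "\<bar>y / h 0\<bar> \<le> B" if "\<bar>y\<bar> \<le> max B0 (max B1 B2)" for y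
    unfolding B_def using that c by (simp add: divide_right_mono)
  show thesis
  proof (rule that[of "\<lambda>t. h t / h 0" "\<lambda>t. \<rho> t / h 0" "\<lambda>t. deriv \<rho> t / h 0" B])
    show "((\<lambda>t. h t / h 0) has_real_derivative \<rho> t / h 0) (at t)" for t by (rule DERIV_cdivide[OF dh])
    show "((\<lambda>t. \<rho> t / h 0) has_real_derivative deriv \<rho> t / h 0) (at t)" for t by (rule DERIV_cdivide[OF test_fun_DERIV[OF \<rho>(1)]])
    show "continuous_on UNIV (\<lambda>t. deriv \<rho> t / h 0)" using c by (intro continuous_intros test_fun_continuous test_fun_deriv \<rho>) auto
    show "h t / h 0 = 0" if "t \<le> -1" for t using hz[OF that] by simp
    show "h t / h 0 = 1 \<and> \<rho> t / h 0 = 0 \<and> deriv \<rho> t / h 0 = 0" if "t \<ge> 0" for t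
      using ht[OF that] \<rho>0[of t] d0[OF that] that c by simp
    show "\<bar>h t / h 0\<bar> \<le> B" for t by (rule Bd) (use B0'[of t] in simp)
    show "\<bar>\<rho> t / h 0\<bar> \<le> B" for t by (rule Bd) (use B1[of t] in simp)
    show "\<bar>deriv \<rho> t / h 0\<bar> \<le> B" for t by (rule Bd) (use B2[of t] in simp)
  qed
qed

section \<open>The dilation generator\<close>

lemma Rad_mult: "Rad q v x * Rad q' w x = Rad (q + q') (\<lambda>t. v t * w t) x"
proof -
  have "norm x powr (- q) * norm x powr (- q') = norm x powr (- (q + q'))"
    by (cases "x = 0") (simp_all add: powr_add[symmetric])
  moreover have "Rad q v x * Rad q' w x = (norm x powr (- q) * norm x powr (- q')) * (v (ln (norm x)) * w (ln (norm x)))"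
    unfolding Rad_def by (simp only: mult_ac)
  ultimately show ?thesis by (simp only: Rad_def)
qed

text \<open>m \<ge> 1/2 stands for N \<ge> 5. The amplitude b will be the one that the normalising
  constant of the bubble gives to its dilation generator.\<close>

locale bubble =
  fixes m \<alpha> b :: real
  assumes m: "1/2 \<le> m" and a: "0 < \<alpha>" "\<alpha> < 1" and b: "b \<noteq> 0"
begin

definition P where "P t = cosh (\<alpha> * t) powr (- m)"
definition T where "T t = tanh (\<alpha> * t)"
definition z0 where "z0 t = b * (P t * T t)"
definition z1 where "z1 t = b * \<alpha> * (P t * (1 - (m+1) * (T t)\<^sup>2))"
definition z2 where "z2 t = b * \<alpha>\<^sup>2 * (P t * ((m+1) * (m+2) * T t ^ 3 - (3*m+2) * T t))"
definition z3 where "z3 t = b * \<alpha> ^ 3 * (P t * (- ((m+1) * (m+2) * (m+3)) * T t ^ 4 + 2 * (m+1) * (3*m+4) * (T t)\<^sup>2 - (3*m+2)))"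
text \<open>Defined by the degree 0 equation, so that \<open>z3_DERIV\<close> says that the dilation
  mode z0 solves it.\<close>

definition z4 where "z4 t = Acoef \<alpha> m 0 * z2 t - Bcoef \<alpha> m 0 * z0 t + potV \<alpha> m t * z0 t"

lemma m_pos: "m > 0" using m by simp

lemma T_DERIV: "(T has_real_derivative \<alpha> * (1 - (T t)\<^sup>2)) (at t)"
  unfolding T_def[abs_def] by (rule tanh_scaled_DERIV)

lemma P_DERIV: "(P has_real_derivative - m * \<alpha> * T t * P t) (at t)"
proof -
  have "((\<lambda>t. \<alpha> * t) has_real_derivative \<alpha>) (at t)" by (auto intro!: derivative_eq_intros)
  from DERIV_chain2[OF cosh_powr_DERIV[of "-m"] this] show ?thesis
    unfolding P_def[abs_def] T_def by (simp add: mult_ac)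
qed

lemma z_DERIV: "(z0 has_real_derivative z1 t) (at t)" "(z1 has_real_derivative z2 t) (at t)" "(z2 has_real_derivative z3 t) (at t)"
  subgoal unfolding z0_def[abs_def]
    by (rule DERIV_cong, (rule P_DERIV T_DERIV derivative_intros)+, simp add: z1_def algebra_simps power2_eq_square)
  subgoal unfolding z1_def[abs_def]
    by (rule DERIV_cong, (rule P_DERIV T_DERIV derivative_intros)+, simp add: z2_def algebra_simps power2_eq_square power3_eq_cube)
  subgoal unfolding z2_def[abs_def]
    by (rule DERIV_cong, (rule P_DERIV T_DERIV derivative_intros)+, simp add: z3_def algebra_simps power2_eq_square power3_eq_cube power4_eq_xxxx)
  done

lemma z3_DERIV: "(z3 has_real_derivative z4 t) (at t)"
  unfolding z3_def[abs_def] z4_def potV_def T_def[symmetric] Acoef_alt Bcoef_alt z0_def z2_def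
  by (rule DERIV_cong, (rule P_DERIV T_DERIV derivative_intros)+, simp add: algebra_simps power2_eq_square power3_eq_cube power4_eq_xxxx)

lemma continuous_z: "continuous_on UNIV z0" "continuous_on UNIV z1" "continuous_on UNIV z2" "continuous_on UNIV z3"
  using DERIV_isCont[OF z_DERIV(1)] DERIV_isCont[OF z_DERIV(2)] DERIV_isCont[OF z_DERIV(3)] DERIV_isCont[OF z3_DERIV]
  by (auto intro!: continuous_at_imp_continuous_on)

lemma continuous_z4: "continuous_on UNIV z4"
proof -
  have "continuous_on UNIV (potV \<alpha> m)" using DERIV_isCont[OF potV_DERIV] by (auto intro!: continuous_at_imp_continuous_on)
  then show ?thesis unfolding z4_def[abs_def] by (intro continuous_intros continuous_z)
qed

lemma P_bound: "0 \<le> P t" "P t \<le> 2 powr m * exp (- (\<alpha> * m) * \<bar>t\<bar>)"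
proof -
  show "0 \<le> P t" by (simp add: P_def)
  have "exp \<bar>\<alpha> * t\<bar> / 2 \<le> cosh (\<alpha> * t)" by (cases "0 \<le> \<alpha> * t") (simp_all add: cosh_def)
  then have "P t \<le> (exp \<bar>\<alpha> * t\<bar> / 2) powr (- m)" unfolding P_def using m_pos by (intro powr_mono2') auto
  also have "\<dots> = 2 powr m * exp (- (\<alpha> * m) * \<bar>t\<bar>)"
  proof -
    have "exp \<bar>\<alpha> * t\<bar> / 2 = exp (\<bar>\<alpha> * t\<bar> - ln 2)" by (simp add: exp_diff)
    then have "(exp \<bar>\<alpha> * t\<bar> / 2) powr (- m) = exp ((\<bar>\<alpha> * t\<bar> - ln 2) * (- m))" by (simp only: exp_powr_real)
    also have "(\<bar>\<alpha> * t\<bar> - ln 2) * (- m) = m * ln 2 + (- (\<alpha> * m) * \<bar>t\<bar>)" using a by (simp add: abs_mult algebra_simps)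
    also have "exp \<dots> = 2 powr m * exp (- (\<alpha> * m) * \<bar>t\<bar>)" unfolding exp_add by (simp add: powr_def)
    finally show ?thesis .
  qed
  finally show "P t \<le> 2 powr m * exp (- (\<alpha> * m) * \<bar>t\<bar>)" .
qed

text \<open>The rate is that of sech^m(\<alpha> t). Together with continuity it is all that the
  integrability proofs use of z0, z1, z2 and their combinations.\<close>

definition decays :: "(real \<Rightarrow> real) \<Rightarrow> bool" where
  "decays y \<longleftrightarrow> continuous_on UNIV y \<and> (\<exists>C\<ge>0. \<forall>t. \<bar>y t\<bar> \<le> C * exp (- (\<alpha> * m) * \<bar>t\<bar>))"

lemma decays_linear: assumes "decays y" "decays w" shows "decays (\<lambda>t. c * y t + d * w t)"
proof -
  obtain C D where C: "C \<ge> 0" "\<And>t. \<bar>y t\<bar> \<le> C * exp (- (\<alpha> * m) * \<bar>t\<bar>)" "D \<ge> 0" "\<And>t. \<bar>w t\<bar> \<le> D * exp (- (\<alpha> * m) * \<bar>t\<bar>)"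
    using assms unfolding decays_def by blast
  have "\<bar>c * y t + d * w t\<bar> \<le> (\<bar>c\<bar> * C + \<bar>d\<bar> * D) * exp (- (\<alpha> * m) * \<bar>t\<bar>)" for t
  proof -
    have "\<bar>c * y t + d * w t\<bar> \<le> \<bar>c\<bar> * \<bar>y t\<bar> + \<bar>d\<bar> * \<bar>w t\<bar>" by (metis abs_mult abs_triangle_ineq)
    also have "\<dots> \<le> \<bar>c\<bar> * (C * exp (- (\<alpha> * m) * \<bar>t\<bar>)) + \<bar>d\<bar> * (D * exp (- (\<alpha> * m) * \<bar>t\<bar>))"
      using C by (intro add_mono mult_left_mono) auto
    finally show ?thesis by (simp add: distrib_right)
  qed
  then show ?thesis using assms C unfolding decays_def by (intro conjI continuous_intros exI[of _ "\<bar>c\<bar> * C + \<bar>d\<bar> * D"]) auto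
qed

lemma decays_P: assumes "continuous_on UNIV (\<lambda>t. c * (P t * q (T t)))" "\<And>s. \<bar>s\<bar> \<le> 1 \<Longrightarrow> \<bar>q s\<bar> \<le> B"
  shows "decays (\<lambda>t. c * (P t * q (T t)))"
  unfolding decays_def
proof (intro conjI assms(1) exI[of _ "\<bar>c\<bar> * (2 powr m * B)"] allI)
  have B: "B \<ge> 0" using assms(2)[of 0] by simp
  then show "0 \<le> \<bar>c\<bar> * (2 powr m * B)" by simp
  fix t
  have "\<bar>T t\<bar> \<le> 1" unfolding T_def by (rule abs_tanh_le_1)
  then have "P t * \<bar>q (T t)\<bar> \<le> (2 powr m * exp (- (\<alpha> * m) * \<bar>t\<bar>)) * B"
    using P_bound[of t] assms(2) by (intro mult_mono) auto
  then have "\<bar>c\<bar> * (P t * \<bar>q (T t)\<bar>) \<le> \<bar>c\<bar> * ((2 powr m * exp (- (\<alpha> * m) * \<bar>t\<bar>)) * B)" by (intro mult_left_mono) auto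
  then show "\<bar>c * (P t * q (T t))\<bar> \<le> \<bar>c\<bar> * (2 powr m * B) * exp (- (\<alpha> * m) * \<bar>t\<bar>)"
    using P_bound(1)[of t] by (simp add: abs_mult mult_ac)
qed

lemma decays_z: "decays z0" "decays z1" "decays z2"
proof -
  show "decays z0" unfolding z0_def[abs_def] by (rule decays_P[where q="\<lambda>s. s" and B=1, OF continuous_z(1)[unfolded z0_def[abs_def]]])
  show "decays z1" unfolding z1_def[abs_def]
  proof (rule decays_P[where q="\<lambda>s. 1 - (m+1) * s\<^sup>2" and B="1 + (m+1)", OF continuous_z(2)[unfolded z1_def[abs_def]]])
    fix s :: real assume s: "\<bar>s\<bar> \<le> 1"
    have "(m+1) * s\<^sup>2 \<le> (m+1) * 1" using s m_pos by (intro mult_left_mono) (auto simp: abs_square_le_1)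
    moreover have "0 \<le> (m+1) * s\<^sup>2" using m_pos by simp
    moreover have "x \<le> X * 1 \<Longrightarrow> 0 \<le> x \<Longrightarrow> \<bar>1 - x\<bar> \<le> 1 + X" for x X :: real by linarith
    ultimately show "\<bar>1 - (m+1) * s\<^sup>2\<bar> \<le> 1 + (m+1)" by blast
  qed
  show "decays z2" unfolding z2_def[abs_def]
  proof (rule decays_P[where q="\<lambda>s. (m+1) * (m+2) * s ^ 3 - (3*m+2) * s" and B="(m+1) * (m+2) + (3*m+2)", OF continuous_z(3)[unfolded z2_def[abs_def]]])
    fix s :: real assume s: "\<bar>s\<bar> \<le> 1"
    have "\<bar>s ^ 3\<bar> \<le> 1" unfolding power_abs using s by (intro power_le_one) auto
    then have "\<bar>(m+1) * (m+2) * s ^ 3\<bar> \<le> (m+1) * (m+2) * 1" unfolding abs_mult using m_pos by (intro mult_mono) auto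
    moreover have "\<bar>(3*m+2) * s\<bar> \<le> (3*m+2) * 1" unfolding abs_mult using s m_pos by (intro mult_mono) auto
    moreover have "\<bar>x\<bar> \<le> X * 1 \<Longrightarrow> \<bar>y\<bar> \<le> Y * 1 \<Longrightarrow> \<bar>x - y\<bar> \<le> X + Y" for x y X Y :: real by linarith
    ultimately show "\<bar>(m+1) * (m+2) * s ^ 3 - (3*m+2) * s\<bar> \<le> (m+1) * (m+2) + (3*m+2)" by blast
  qed
qed

lemma decays_bounded: assumes "decays y" obtains C where "C \<ge> 0" "\<And>t. \<bar>y t\<bar> \<le> C"
proof -
  obtain C where C: "C \<ge> 0" "\<And>t. \<bar>y t\<bar> \<le> C * exp (- (\<alpha> * m) * \<bar>t\<bar>)" using assms unfolding decays_def by blast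
  have "\<bar>y t\<bar> \<le> C" for t
  proof -
    have "exp (- (\<alpha> * m) * \<bar>t\<bar>) \<le> 1" using a m_pos by (simp add: mult_nonneg_nonneg)
    then have "C * exp (- (\<alpha> * m) * \<bar>t\<bar>) \<le> C * 1" using C(1) by (intro mult_left_mono) auto
    then show ?thesis using C(2)[of t] by linarith
  qed
  then show thesis using C(1) that by blast
qed

section \<open>Weak derivatives, energy and equation of the dilation mode on the whole space\<close>

context
  fixes N :: real
  assumes N: "N = real CARD('n::finite)" and Nm: "N = 2 * m + 4"
begin

lemma Rad_decays_measurable: "decays y \<Longrightarrow> (Rad q y :: real^'n \<Rightarrow> real) \<in> borel_measurable borel"
  unfolding decays_def by (intro Rad_measurable borel_measurable_continuous_onI) auto

text \<open>The condition 2 q + k = N is scale invariance: the integrand is |x|^-N y(ln |x|)^2, and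
  exponential decay of y at both ends suffices.\<close>

lemma Rad_decays_square:
  assumes y: "decays y" and q: "2 * q + real k = N"
  shows "integrable lborel (\<lambda>x::real^'n. (Rad q y x)\<^sup>2 / norm x ^ k)"
proof -
  obtain C where C: "C \<ge> 0" "\<And>t. \<bar>y t\<bar> \<le> C * exp (- (\<alpha> * m) * \<bar>t\<bar>)" using y unfolding decays_def by blast
  have e: "(Rad q y x)\<^sup>2 / norm x ^ k = Rad N (\<lambda>t. y t * y t) x" for x :: "real^'n"
    unfolding power2_eq_square Rad_mult Rad_divide_norm by (simp add: q[symmetric])
  have dd: "2 * (\<alpha> * m) > 0" using a m_pos by simp
  show ?thesis
  proof (rule integrable_Rad_dominated[OF N dd, where C="C * C"])
    show "(\<lambda>x::real^'n. (Rad q y x)\<^sup>2 / norm x ^ k) \<in> borel_measurable borel" using Rad_decays_measurable[OF y, of q] by simp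
    fix x :: "real^'n"
    define t where "t = ln (norm x)"
    have "\<bar>y t * y t\<bar> \<le> (C * exp (- (\<alpha> * m) * \<bar>t\<bar>)) * (C * exp (- (\<alpha> * m) * \<bar>t\<bar>))" unfolding abs_mult using C by (intro mult_mono) auto
    also have "\<dots> = C * C * exp (- (2 * (\<alpha> * m)) * \<bar>t\<bar>)" by (simp add: mult_ac exp_add[symmetric])
    finally have "norm x powr (-N) * \<bar>y t * y t\<bar> \<le> norm x powr (-N) * (C * C * exp (- (2 * (\<alpha> * m)) * \<bar>t\<bar>))" by (intro mult_left_mono) auto
    then show "\<bar>(Rad q y x)\<^sup>2 / norm x ^ k\<bar> \<le> C * C * Rad N (\<lambda>t. exp (- (2 * (\<alpha> * m)) * \<bar>t\<bar>)) x"
      unfolding e by (simp add: Rad_def t_def abs_mult mult_ac)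
  qed
qed

text \<open>The critical exponent is N / m, so the integrand is again |x|^-N times a function that
  decays exponentially in ln |x|.\<close>

lemma Rad_decays_Lp:
  assumes y: "decays y" shows "Lp (two_ss N) (Rad m y :: real^'n \<Rightarrow> real)"
proof -
  obtain C where C: "C \<ge> 0" "\<And>t. \<bar>y t\<bar> \<le> C * exp (- (\<alpha> * m) * \<bar>t\<bar>)" using y unfolding decays_def by blast
  have p: "two_ss N = N / m" unfolding two_ss_def Nm using m_pos by (simp add: field_simps)
  have Np: "N > 0" using Nm m_pos by simp
  have dd: "\<alpha> * N > 0" using a Np by simp
  have "integrable lborel (\<lambda>x::real^'n. \<bar>Rad m y x\<bar> powr (N / m))"
  proof (rule integrable_Rad_dominated[OF N dd, where C="C powr (N / m)"])
    show "(\<lambda>x::real^'n. \<bar>Rad m y x\<bar> powr (N / m)) \<in> borel_measurable borel" using Rad_decays_measurable[OF y, of m] by simp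
    fix x :: "real^'n"
    show "\<bar>\<bar>Rad m y x\<bar> powr (N / m)\<bar> \<le> C powr (N / m) * Rad N (\<lambda>t. exp (- (\<alpha> * N) * \<bar>t\<bar>)) x"
    proof (cases "x = 0")
      case False
      define t where "t = ln (norm x)"
      have "\<bar>y t\<bar> powr (N / m) \<le> (C * exp (- (\<alpha> * m) * \<bar>t\<bar>)) powr (N / m)" using C Np m_pos by (intro powr_mono2) auto
      also have "\<dots> = C powr (N / m) * exp (- (\<alpha> * N) * \<bar>t\<bar>)" using C(1) m_pos by (simp add: powr_mult powr_def[of "exp _"])
      finally have 1: "\<bar>y t\<bar> powr (N / m) \<le> C powr (N / m) * exp (- (\<alpha> * N) * \<bar>t\<bar>)" .
      have "\<bar>Rad m y x\<bar> powr (N / m) = (norm x powr (- m) * \<bar>y t\<bar>) powr (N / m)" by (simp add: Rad_def t_def abs_mult)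
      also have "\<dots> = norm x powr (- N) * \<bar>y t\<bar> powr (N / m)" using m_pos by (simp add: powr_mult powr_powr)
      also have "\<dots> \<le> norm x powr (- N) * (C powr (N / m) * exp (- (\<alpha> * N) * \<bar>t\<bar>))" using 1 by (intro mult_left_mono) auto
      finally show ?thesis by (simp add: Rad_def t_def mult_ac)
    qed simp
  qed
  then show ?thesis unfolding Lp_def p using Rad_decays_measurable[OF y, of m] by simp
qed

lemma locint_poly_Rad:
  fixes p :: "real^'n \<Rightarrow> real"
  assumes p: "hpoly d p" and y: "decays y" and q: "q - real d < N"
  shows "locint (\<lambda>x. p x * Rad q y x)"
proof -
  obtain C where C: "C \<ge> 0" "\<And>x. \<bar>p x\<bar> \<le> C * norm x ^ d" using hpoly_bound[OF p] by blast
  obtain D where D: "D \<ge> 0" "\<And>t. \<bar>y t\<bar> \<le> D" using decays_bounded[OF y] by blast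
  have s: "q - real d < real CARD('n)" using q N by simp
  show ?thesis
  proof (rule locint_power_bound[OF s, where C="C * D"])
    show "(\<lambda>x. p x * Rad q y x) \<in> borel_measurable borel"
      by (intro borel_measurable_times Rad_decays_measurable y borel_measurable_continuous_onI hpoly_continuous[OF p])
    fix x :: "real^'n" assume x: "x \<noteq> 0"
    have "\<bar>p x * Rad q y x\<bar> \<le> (C * norm x ^ d) * (norm x powr (- q) * D)"
      unfolding abs_mult Rad_def using C D by (intro mult_mono) auto
    also have "\<dots> = C * D * norm x powr (- (q - real d))"
      using x by (simp add: powr_realpow[symmetric] powr_add[symmetric] algebra_simps)
    finally show "\<bar>p x * Rad q y x\<bar> \<le> C * D * norm x powr (- (q - real d))" .
  qed (use C D in auto)
qed

definition Gz :: "real^'n \<Rightarrow> real^'n" where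
  "Gz x = (\<chi> i. x $ i * Rad (m + 2) (\<lambda>t. z1 t - m * z0 t) x)"

text \<open>The radial factor of the Laplacian of \<open>Rad m z0\<close>, with N - m - 2 = m +
  2.\<close>

definition lz where "lz t = (z2 t - m * z1 t) + (m + 2) * (z1 t - m * z0 t)"

lemma decays_u: "decays (\<lambda>t. z1 t - m * z0 t)" using decays_linear[OF decays_z(2,1), of 1 "-m"] by simp

lemma decays_l: "decays lz"
proof -
  have "decays (\<lambda>t. 1 * (1 * z2 t + (-m) * z1 t) + (m + 2) * (z1 t - m * z0 t))"
    by (intro decays_linear decays_z decays_u)
  then show ?thesis by (simp add: lz_def[abs_def])
qed

lemma hpoly_coord: "hpoly 1 (\<lambda>x::real^'n. x $ i)" using hpoly.coord[OF hpoly.const[of 1], of i] by simp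

lemma locint_Z: "locint (Rad m z0 :: real^'n \<Rightarrow> real)"
proof -
  have "m - real 0 < N" using Nm m_pos by simp
  from locint_poly_Rad[OF hpoly.const[of 1] decays_z(1) this] show ?thesis by simp
qed

lemma locint_L: "locint (Rad (m + 2) lz :: real^'n \<Rightarrow> real)"
proof -
  have "m + 2 - real 0 < N" using Nm m_pos by simp
  from locint_poly_Rad[OF hpoly.const[of 1] decays_l this] show ?thesis by simp
qed

lemma locint_Gz_component: "locint (\<lambda>x. Gz x $ i)"
proof -
  have "m + 2 - real 1 < N" using Nm m_pos by simp
  from locint_poly_Rad[OF hpoly_coord[of i] decays_u this] show ?thesis by (simp add: Gz_def)
qed

lemma locint_Gz: "locint Gz"
  unfolding locint_def
proof (intro conjI allI impI)
  have e: "Gz x = (\<Sum>i\<in>UNIV. Gz x $ i *\<^sub>R axis i 1)" for x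
    using basis_expansion[of "Gz x"] by (simp add: scalar_mult_eq_scaleR)
  have cm: "(\<lambda>x. Gz x $ i) \<in> borel_measurable lborel" for i using locint_Gz_component[of i] by (simp add: locint_def)
  have "(\<lambda>x. \<Sum>i\<in>UNIV. Gz x $ i *\<^sub>R (axis i 1 :: real^'n)) \<in> borel_measurable lborel"
    by (intro borel_measurable_sum borel_measurable_scaleR cm) auto
  moreover have "(\<lambda>x. \<Sum>i\<in>UNIV. Gz x $ i *\<^sub>R (axis i 1 :: real^'n)) = Gz" by (rule ext, rule e[symmetric])
  ultimately show "Gz \<in> borel_measurable lborel" by (simp only:)
  fix K :: "(real^'n) set" assume K: "compact K"
  have "integrable lborel (\<lambda>x. \<Sum>i\<in>UNIV. (indicator K x *\<^sub>R (Gz x $ i)) *\<^sub>R (axis i 1 :: real^'n))"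
    using locint_Gz_component K unfolding locint_def set_integrable_def by (intro Bochner_Integration.integrable_sum integrable_scaleR_left) auto
  moreover have "(\<Sum>i\<in>UNIV. (indicator K x *\<^sub>R (Gz x $ i)) *\<^sub>R (axis i 1 :: real^'n)) = indicator K x *\<^sub>R Gz x" for x

  proof -
    have "indicator K x *\<^sub>R Gz x = indicator K x *\<^sub>R (\<Sum>i\<in>UNIV. Gz x $ i *\<^sub>R (axis i 1 :: real^'n))" by (rule arg_cong[OF e])
    also have "\<dots> = (\<Sum>i\<in>UNIV. (indicator K x *\<^sub>R (Gz x $ i)) *\<^sub>R (axis i 1 :: real^'n))" by (simp only: scaleR_sum_right scaleR_scaleR real_scaleR_def)
    finally show ?thesis by (rule sym)
  qed
  ultimately show "set_integrable lborel K Gz" by (simp add: set_integrable_def)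
qed

text \<open>In logarithmic coordinates cutting off the origin is multiplication by a translated
  step, so derivatives stay bounded uniformly in k. The powers of |x| are left to local
  integrability.\<close>

lemma near_cut:
  obtains y y1 y2 :: "nat \<Rightarrow> real \<Rightarrow> real" and B where
    "\<And>k t. (y k has_real_derivative y1 k t) (at t)" "\<And>k t. (y1 k has_real_derivative y2 k t) (at t)" "\<And>k. continuous_on UNIV (y2 k)"
    "\<And>k. \<exists>R. \<forall>t<R. y k t = 0"
    "\<And>k t. \<bar>y k t\<bar> \<le> B" "\<And>k t. \<bar>y1 k t\<bar> \<le> B" "\<And>k t. \<bar>y2 k t\<bar> \<le> B"
    "\<And>t. \<forall>\<^sub>F k in sequentially. y k t = z0 t \<and> y1 k t = z1 t \<and> y2 k t = z2 t"
proof -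
  obtain \<eta> \<eta>1 \<eta>2 :: "real \<Rightarrow> real" and E where \<eta>: "\<And>t. (\<eta> has_real_derivative \<eta>1 t) (at t)" "\<And>t. (\<eta>1 has_real_derivative \<eta>2 t) (at t)"
    "continuous_on UNIV \<eta>2" "\<And>t. t \<le> -1 \<Longrightarrow> \<eta> t = 0" "\<And>t. t \<ge> 0 \<Longrightarrow> \<eta> t = 1 \<and> \<eta>1 t = 0 \<and> \<eta>2 t = 0"
    "\<And>t. \<bar>\<eta> t\<bar> \<le> E" "\<And>t. \<bar>\<eta>1 t\<bar> \<le> E" "\<And>t. \<bar>\<eta>2 t\<bar> \<le> E" using smooth_step by metis
  obtain C0 where C0: "C0 \<ge> 0" "\<And>t. \<bar>z0 t\<bar> \<le> C0" using decays_bounded[OF decays_z(1)] by blast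
  obtain C1 where C1: "C1 \<ge> 0" "\<And>t. \<bar>z1 t\<bar> \<le> C1" using decays_bounded[OF decays_z(2)] by blast
  obtain C2 where C2: "C2 \<ge> 0" "\<And>t. \<bar>z2 t\<bar> \<le> C2" using decays_bounded[OF decays_z(3)] by blast
  have E: "E \<ge> 0" using \<eta>(6)[of 0] by linarith
  define y where "y k t = \<eta> (t + real k) * z0 t" for k :: nat and t
  define y1 where "y1 k t = \<eta>1 (t + real k) * z0 t + \<eta> (t + real k) * z1 t" for k :: nat and t
  define y2 where "y2 k t = \<eta>2 (t + real k) * z0 t + 2 * (\<eta>1 (t + real k) * z1 t) + \<eta> (t + real k) * z2 t" for k :: nat and t
  have sh: "((\<lambda>t. \<eta> (t + real k)) has_real_derivative \<eta>1 (t + real k)) (at t)" "((\<lambda>t. \<eta>1 (t + real k)) has_real_derivative \<eta>2 (t + real k)) (at t)" for k t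
    using \<eta>(1)[of "t + real k"] \<eta>(2)[of "t + real k"] by (simp_all add: DERIV_shift)
  have bd: "\<bar>x * y\<bar> \<le> E * C" if "\<bar>x\<bar> \<le> E" "\<bar>y\<bar> \<le> C" for x y C :: real
    unfolding abs_mult using that E by (intro mult_mono) auto
  note bds = bd[OF \<eta>(6) C0(2)] bd[OF \<eta>(7) C0(2)] bd[OF \<eta>(8) C0(2)] bd[OF \<eta>(6) C1(2)] bd[OF \<eta>(7) C1(2)] bd[OF \<eta>(6) C2(2)]
  have EC: "0 \<le> E * C0" "0 \<le> E * C1" "0 \<le> E * C2" using E C0 C1 C2 by auto
  define B where "B = E * C0 + 2 * (E * C1) + E * C2"
  show thesis
  proof (rule that[of y y1 y2 B])
    show "(y k has_real_derivative y1 k t) (at t)" for k t unfolding y_def[abs_def] y1_def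
      by (rule DERIV_cong[OF DERIV_mult[OF sh(1) z_DERIV(1)]]) simp
    show "(y1 k has_real_derivative y2 k t) (at t)" for k t unfolding y1_def[abs_def] y2_def
      by (rule DERIV_cong[OF DERIV_add[OF DERIV_mult[OF sh(2) z_DERIV(1)] DERIV_mult[OF sh(1) z_DERIV(2)]]]) simp
    have ce: "continuous_on UNIV \<eta>" "continuous_on UNIV \<eta>1"
      using DERIV_isCont[OF \<eta>(1)] DERIV_isCont[OF \<eta>(2)] by (auto intro!: continuous_at_imp_continuous_on)
    have cs: "continuous_on UNIV (\<lambda>t. f (t + real k))" if "continuous_on UNIV f" for f :: "real \<Rightarrow> real" and k :: nat
      by (rule continuous_on_compose2[OF that]) (auto intro!: continuous_intros)
    show "continuous_on UNIV (y2 k)" for k unfolding y2_def[abs_def]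
      by (intro continuous_on_add continuous_on_mult continuous_on_const cs ce \<eta>(3) continuous_z)
    show "\<exists>R. \<forall>t<R. y k t = 0" for k by (rule exI[of _ "-1 - real k"]) (auto simp: y_def intro!: \<eta>(4))
    show "\<bar>y k t\<bar> \<le> B" for k t unfolding y_def B_def using bds(1)[of "t + real k" t] EC by linarith
    show "\<bar>y1 k t\<bar> \<le> B" for k t unfolding y1_def B_def using bds(2,4)[of "t + real k" t] EC by linarith
    show "\<bar>y2 k t\<bar> \<le> B" for k t unfolding y2_def B_def using bds(3,5,6)[of "t + real k" t] EC by linarith
    show "\<forall>\<^sub>F k in sequentially. y k t = z0 t \<and> y1 k t = z1 t \<and> y2 k t = z2 t" for t
    proof -
      obtain K :: nat where K: "- t < real K" using reals_Archimedean2 by blast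
      have "y k t = z0 t \<and> y1 k t = z1 t \<and> y2 k t = z2 t" if "k \<ge> K" for k
      proof -
        have "t + real k \<ge> 0" using K that by simp
        then show ?thesis using \<eta>(5)[of "t + real k"] by (simp add: y_def y1_def y2_def)
      qed
      then show ?thesis by (auto simp: eventually_sequentially)
    qed
  qed
qed

text \<open>The cut modes vanish near the origin and can be integrated by parts against any \<phi>.
  The limit leaves no boundary term because the gradient is of order at most |x|^(-m-1) and m + 1 <
  N.\<close>

lemma weak_grad_Z: "weak_grad (Rad m z0 :: real^'n \<Rightarrow> real) Gz"
  unfolding weak_grad_def
proof (intro conjI locint_Z locint_Gz allI impI)
  fix \<phi> :: "real^'n \<Rightarrow> real" and i assume \<phi>: "testfun UNIV \<phi>"
  obtain y y1 y2 B where y: "\<And>k t. (y k has_real_derivative y1 k t) (at t)" "\<And>k t. (y1 k has_real_derivative y2 k t) (at t)" "\<And>k::nat. continuous_on UNIV (y2 k)"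
    "\<And>k. \<exists>R. \<forall>t<R. y k t = 0" "\<And>k t. \<bar>y k t\<bar> \<le> B" "\<And>k t. \<bar>y1 k t\<bar> \<le> B" "\<And>k t. \<bar>y2 k t\<bar> \<le> B"
    "\<And>t. \<forall>\<^sub>F k in sequentially. y k t = z0 t \<and> y1 k t = z1 t \<and> y2 k t = z2 t" using near_cut by blast
  have c1: "continuous_on UNIV (y1 k)" "continuous_on UNIV (y k)" for k
    using DERIV_isCont[OF y(2)] DERIV_isCont[OF y(1)] by (auto intro!: continuous_at_imp_continuous_on)
  have h0: "hpoly 0 (\<lambda>x::real^'n. 1)" by (rule hpoly.const)
  have p0: "pd i (\<lambda>x::real^'n. 1) x = 0" for i x by (rule hasPD_pd, rule hasPD_const)
  have eq: "(\<integral>x. 1 * Rad m (y k) x * pd i \<phi> x \<partial>lborel) = - (\<integral>x. x $ i * Rad (m + 2) (\<lambda>t. y1 k t - m * y k t) x * \<phi> x \<partial>lborel)" for k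
    using Rad_by_parts(1)[OF h0 \<phi> y(1)[of k] c1(1)[of k] disjI2[OF y(4)[of k]], where i=i and q=m] by (simp add: p0)
  obtain R where R: "\<And>x. R \<le> norm x \<Longrightarrow> \<phi> x = 0" using testfun_bounded_support[OF \<phi>] by blast
  obtain R' where R': "\<And>x. R' \<le> norm x \<Longrightarrow> pd i \<phi> x = 0" using testfun_bounded_support[OF testfun_pd[OF \<phi>]] by blast
  have b1: "\<bar>y1 k t - m * y k t\<bar> \<le> B + m * B" for k t
  proof -
    have "\<bar>m * y k t\<bar> \<le> m * B" unfolding abs_mult using y(5) m_pos by (intro mult_mono) auto
    then show ?thesis using y(6)[of k t] by linarith
  qed
  have ev0: "\<forall>\<^sub>F k in sequentially. y k t = z0 t" for t using y(8)[of t] by eventually_elim simp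
  have mN: "m - real 0 < real CARD('n)" using N Nm m_pos by simp
  have l1: "(\<lambda>k. \<integral>x. 1 * Rad m (y k) x * pd i \<phi> x \<partial>lborel) \<longlonglongrightarrow> (\<integral>x. 1 * Rad m z0 x * pd i \<phi> x \<partial>lborel)"
    by (rule Rad_limit[OF h0 mN testfun_continuous[OF testfun_pd[OF \<phi>]] R' c1(2) continuous_z(1) y(5) ev0])
  have l2: "(\<lambda>k. \<integral>x. x $ i * Rad (m + 2) (\<lambda>t. y1 k t - m * y k t) x * \<phi> x \<partial>lborel) \<longlonglongrightarrow> (\<integral>x. x $ i * Rad (m + 2) (\<lambda>t. z1 t - m * z0 t) x * \<phi> x \<partial>lborel)"

  proof (rule Rad_limit[OF hpoly_coord _ testfun_continuous[OF \<phi>] R _ _ b1])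
    show "m + 2 - real 1 < real CARD('n)" using N Nm m_pos by simp
    show "\<forall>\<^sub>F k in sequentially. y1 k t - m * y k t = z1 t - m * z0 t" for t using y(8)[of t] by eventually_elim simp
  qed (assumption | intro continuous_intros c1 continuous_z)+
  from LIMSEQ_unique[OF l1[unfolded eq] tendsto_minus[OF l2]]
  show "(\<integral>x. Rad m z0 x * pd i \<phi> x \<partial>lborel) = - (\<integral>x. Gz x $ i * \<phi> x \<partial>lborel)"
    by (simp add: Gz_def)
qed

text \<open>As for the gradient; the Laplacian is of order at most |x|^(-m-2) at the origin and m +
  2 < N.\<close>

lemma weak_lap_Z: "weak_lap (Rad m z0 :: real^'n \<Rightarrow> real) (Rad (m + 2) lz)"
  unfolding weak_lap_def
proof (intro conjI locint_Z locint_L allI impI)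
  fix \<phi> :: "real^'n \<Rightarrow> real" assume \<phi>: "testfun UNIV \<phi>"
  obtain y y1 y2 B where y: "\<And>k t. (y k has_real_derivative y1 k t) (at t)" "\<And>k t. (y1 k has_real_derivative y2 k t) (at t)" "\<And>k::nat. continuous_on UNIV (y2 k)"
    "\<And>k. \<exists>R. \<forall>t<R. y k t = 0" "\<And>k t. \<bar>y k t\<bar> \<le> B" "\<And>k t. \<bar>y1 k t\<bar> \<le> B" "\<And>k t. \<bar>y2 k t\<bar> \<le> B"
    "\<And>t. \<forall>\<^sub>F k in sequentially. y k t = z0 t \<and> y1 k t = z1 t \<and> y2 k t = z2 t" using near_cut by blast
  have c1: "continuous_on UNIV (y1 k)" "continuous_on UNIV (y k)" for k
    using DERIV_isCont[OF y(2)] DERIV_isCont[OF y(1)] by (auto intro!: continuous_at_imp_continuous_on)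
  have h0: "hpoly 0 (\<lambda>x::real^'n. 1)" by (rule hpoly.const)
  define l where "l k t = (y2 k t - m * y1 k t) + (m + 2) * (y1 k t - m * y k t)" for k t
  have CN: "real CARD('n) - m - 2 = m + 2" using N Nm by simp
  have eq: "(\<integral>x. 1 * Rad m (y k) x * clap \<phi> x \<partial>lborel) = (\<integral>x. 1 * Rad (m + 2) (l k) x * \<phi> x \<partial>lborel)" for k
    using Rad_laplacian_by_parts[OF \<phi> y(1)[of k] y(2)[of k] y(3)[of k] disjI2[OF y(4)[of k]], where q=m] unfolding CN l_def[abs_def] by simp
  obtain R where R: "\<And>x. R \<le> norm x \<Longrightarrow> \<phi> x = 0" using testfun_bounded_support[OF \<phi>] by blast
  have "\<exists>R. \<forall>x. R \<le> norm x \<longrightarrow> pd i (pd i \<phi>) x = 0" for i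
    using testfun_bounded_support[OF testfun_pd[OF testfun_pd[OF \<phi>]]] by metis
  then obtain Q where Q: "\<And>i x. Q i \<le> norm x \<Longrightarrow> pd i (pd i \<phi>) x = 0" by metis
  have R': "clap \<phi> x = 0" if "Max (range Q) \<le> norm x" for x
  proof -
    have "pd i (pd i \<phi>) x = 0" for i by (rule Q) (use that Max_ge[of "range Q" "Q i"] in simp)
    then show ?thesis by (simp add: clap_def)
  qed
  have cc: "continuous_on UNIV (clap \<phi>)" unfolding clap_def[abs_def]
    by (intro continuous_intros testfun_continuous testfun_pd) (rule \<phi>)
  have bl: "\<bar>l k t\<bar> \<le> (B + m * B) + (m + 2) * (B + m * B)" for k t
  proof -
    have 1: "\<bar>m * y k t\<bar> \<le> m * B" "\<bar>m * y1 k t\<bar> \<le> m * B" unfolding abs_mult using y(5,6) m_pos by (intro mult_mono; auto)+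
    then have "\<bar>y1 k t - m * y k t\<bar> \<le> B + m * B" using y(6)[of k t] by linarith
    then have "\<bar>(m + 2) * (y1 k t - m * y k t)\<bar> \<le> (m + 2) * (B + m * B)" unfolding abs_mult using m_pos by (intro mult_mono) auto
    moreover have "\<bar>y2 k t - m * y1 k t\<bar> \<le> B + m * B" using 1 y(7)[of k t] by linarith
    ultimately show ?thesis unfolding l_def using abs_triangle_ineq[of "y2 k t - m * y1 k t" "(m + 2) * (y1 k t - m * y k t)"] by linarith
  qed
  have cl: "continuous_on UNIV (l k)" for k unfolding l_def[abs_def] by (intro continuous_intros y(3) c1)
  have clz: "continuous_on UNIV lz" using decays_l by (simp add: decays_def)
  have ev0: "\<forall>\<^sub>F k in sequentially. y k t = z0 t" for t using y(8)[of t] by eventually_elim simp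
  have mN: "m - real 0 < real CARD('n)" using N Nm m_pos by simp
  have l1: "(\<lambda>k. \<integral>x. 1 * Rad m (y k) x * clap \<phi> x \<partial>lborel) \<longlonglongrightarrow> (\<integral>x. 1 * Rad m z0 x * clap \<phi> x \<partial>lborel)"
    by (rule Rad_limit[OF h0 mN cc R' c1(2) continuous_z(1) y(5) ev0])
  have l2: "(\<lambda>k. \<integral>x. 1 * Rad (m + 2) (l k) x * \<phi> x \<partial>lborel) \<longlonglongrightarrow> (\<integral>x. 1 * Rad (m + 2) lz x * \<phi> x \<partial>lborel)"
  proof (rule Rad_limit[OF h0 _ testfun_continuous[OF \<phi>] R cl clz bl])
    show "\<forall>\<^sub>F k in sequentially. l k t = lz t" for t using y(8)[of t] by eventually_elim (simp add: l_def lz_def)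
  qed (use Nm N m_pos in auto)
  from LIMSEQ_unique[OF l1[unfolded eq] l2]
  show "(\<integral>x. Rad m z0 x * clap \<phi> x \<partial>lborel) = (\<integral>x. Rad (m + 2) lz x * \<phi> x \<partial>lborel)" by simp
qed

lemma Emu_Z: "Emu N \<mu> (Rad m z0 :: real^'n \<Rightarrow> real)"
  unfolding Emu_def D22_def
proof (intro conjI Rad_decays_Lp decays_z exI)
  show "weak_lap (Rad m z0 :: real^'n \<Rightarrow> real) (Rad (m + 2) lz)" by (rule weak_lap_Z)
  have "integrable lborel (\<lambda>x::real^'n. (Rad (m + 2) lz x)\<^sup>2 / norm x ^ 0)"
    by (rule Rad_decays_square[OF decays_l]) (simp add: Nm)
  moreover have "\<bar>r\<bar> powr 2 = r\<^sup>2" for r :: real by (cases "r = 0") auto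
  ultimately show "Lp 2 (Rad (m + 2) lz :: real^'n \<Rightarrow> real)"
    unfolding Lp_def using Rad_decays_measurable[OF decays_l, of "m + 2"] by simp
  show "weak_grad (Rad m z0 :: real^'n \<Rightarrow> real) Gz" by (rule weak_grad_Z)
  \<comment> \<open>Gz x is a multiple of x, so the weight |x|^-2 cancels |x|^2 and the scale
    invariant exponent 2 (m + 2) = N appears.\<close>
  have "(norm (Gz x))\<^sup>2 / (norm x)\<^sup>2 = (Rad (m + 2) (\<lambda>t. z1 t - m * z0 t) x)\<^sup>2 / norm x ^ 0" for x
  proof (cases "x = 0")
    case True then show ?thesis by (simp add: Gz_def)
  next
    case False
    have "Gz x = Rad (m + 2) (\<lambda>t. z1 t - m * z0 t) x *\<^sub>R x" by (simp add: Gz_def vec_eq_iff mult.commute)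
    then show ?thesis using False by (simp add: power_mult_distrib)
  qed
  then show "integrable lborel (\<lambda>x. (norm (Gz x))\<^sup>2 / (norm x)\<^sup>2)"
    using Rad_decays_square[OF decays_u, of "m + 2" 0] by (simp add: Nm)
  show "integrable lborel (\<lambda>x::real^'n. (Rad m z0 x)\<^sup>2 / norm x ^ 4)"
    by (rule Rad_decays_square[OF decays_z(1)]) (simp add: Nm)
qed

text \<open>Here \<phi> vanishes near the origin, so derivatives move back onto the mode without
  cut-off and every term becomes an integral of \<open>Rad (m + 4)\<close> against \<phi>.\<close>

lemma linear_form_Z:
  fixes \<phi> :: "real^'n \<Rightarrow> real"
  assumes \<phi>: "testfun (UNIV - {0}) \<phi>"
  shows "(\<integral>x. Rad (m + 2) lz x * clap \<phi> x \<partial>lborel)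
     - (2 * ((m+1)\<^sup>2 + 1) * (1 - \<alpha>\<^sup>2)) * (\<integral>x. (Gz x \<bullet> cgrad \<phi> x) / norm x ^ 2 \<partial>lborel)
     + ((m+2)\<^sup>2 * m\<^sup>2 * (1 - \<alpha>\<^sup>2)\<^sup>2 - 4 * m\<^sup>2 * (m+1) * (1 - \<alpha>\<^sup>2)) * (\<integral>x. Rad m z0 x * \<phi> x / norm x ^ 4 \<partial>lborel)
     = (\<integral>x. Rad 4 (potV \<alpha> m) x * Rad m z0 x * \<phi> x \<partial>lborel)"
proof -
  obtain \<delta> where \<delta>: "\<delta> > 0" "\<And>x. x \<in> ball 0 \<delta> \<Longrightarrow> \<phi> x = 0" using testfun_zero_near[OF \<phi>] by blast
  then have near: "(\<exists>\<delta>>0. \<forall>x\<in>ball 0 \<delta>. \<phi> x = 0) \<or> (\<exists>R. \<forall>t<R. f t = 0)" for f :: "real \<Rightarrow> real" by blast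
  obtain R where R: "\<And>x. R \<le> norm x \<Longrightarrow> \<phi> x = 0" using testfun_bounded_support[OF \<phi>] by blast
  define I where "I f = (\<integral>x. Rad (m + 4) f x * \<phi> x \<partial>lborel)" for f
  have int: "integrable lborel (\<lambda>x. Rad (m + 4) f x * \<phi> x)" if "continuous_on UNIV f" for f
  proof (rule integrable_continuous_compact_support[where R=R])
    have "continuous_on (UNIV - {0}) \<phi>" using testfun_continuous[OF \<phi>] continuous_on_subset by blast
    then show "continuous_on UNIV (\<lambda>x. Rad (m + 4) f x * \<phi> x)"
      by (intro continuous_off_zero[OF continuous_on_mult[OF continuous_Rad[OF that]] \<delta>(1)]) (simp_all add: \<delta>(2))
  qed (simp add: R)
  define l1 where "l1 t = (z3 t - m * z2 t) + (m + 2) * (z2 t - m * z1 t)" for t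
  define l2 where "l2 t = (z4 t - m * z3 t) + (m + 2) * (z3 t - m * z2 t)" for t
  have dl: "(lz has_real_derivative l1 t) (at t)" "(l1 has_real_derivative l2 t) (at t)" for t
    unfolding lz_def[abs_def] l1_def[abs_def] l2_def by (auto intro!: derivative_eq_intros z_DERIV z3_DERIV)
  have cl2: "continuous_on UNIV l2" unfolding l2_def[abs_def] by (intro continuous_intros continuous_z continuous_z4)
  have CN: "real CARD('n) = 2 * m + 4" using N Nm by simp
  define f1 where "f1 t = z4 t - (2 * (m * (m + 2)) + 4) * z2 t + (m * (m + 2))\<^sup>2 * z0 t" for t
  define f2 where "f2 t = z2 t - m\<^sup>2 * z0 t" for t
  have e1: "(\<integral>x. Rad (m + 2) lz x * clap \<phi> x \<partial>lborel) = I f1"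
  proof -
    have "(\<lambda>t. (l2 t - (m + 2) * l1 t) + (real CARD('n) - (m + 2) - 2) * (l1 t - (m + 2) * lz t)) = f1"
      by (rule ext) (simp add: CN l2_def l1_def lz_def f1_def algebra_simps power2_eq_square)
    moreover have "m + 2 + 2 = m + 4" by simp
    ultimately show ?thesis using Rad_laplacian_by_parts[OF \<phi> dl cl2 near, where q="m + 2"] unfolding I_def by (simp only:)
  qed
  have du: "((\<lambda>t. z1 t - m * z0 t) has_real_derivative z2 t - m * z1 t) (at t)" for t by (auto intro!: derivative_eq_intros z_DERIV)
  have cu: "continuous_on UNIV (\<lambda>t. z2 t - m * z1 t)" by (intro continuous_intros continuous_z)
  note dv = Rad_divergence_by_parts[OF \<phi> du cu near, where q="m + 4"]
  have e2: "(\<integral>x. (Gz x \<bullet> cgrad \<phi> x) / norm x ^ 2 \<partial>lborel) = - I f2"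
  proof -
    have r2: "Rad (m + 2) w x / norm x ^ 2 = Rad (m + 4) w x" for w and x :: "real^'n" using Rad_divide_norm[of "m + 2" w x 2] by (simp add: add.assoc)
    have "(Gz x \<bullet> cgrad \<phi> x) / norm x ^ 2 = (\<Sum>i\<in>UNIV. (x $ i * Rad (m + 4) (\<lambda>t. z1 t - m * z0 t) x) * pd i \<phi> x)" for x
      unfolding r2[symmetric] by (simp add: inner_vec_def cgrad_def Gz_def sum_divide_distrib)
    then have "(\<integral>x. (Gz x \<bullet> cgrad \<phi> x) / norm x ^ 2 \<partial>lborel) = (\<Sum>i\<in>UNIV. \<integral>x. (x $ i * Rad (m + 4) (\<lambda>t. z1 t - m * z0 t) x) * pd i \<phi> x \<partial>lborel)"
      using dv(2) by (simp add: Bochner_Integration.integral_sum)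
    moreover have "(\<lambda>t. (z2 t - m * z1 t) + (real CARD('n) - (m + 4)) * (z1 t - m * z0 t)) = f2"
      by (rule ext) (simp add: CN f2_def algebra_simps power2_eq_square)
    ultimately show ?thesis using dv(1) unfolding I_def by (simp only:)
  qed
  have e3: "(\<integral>x. Rad m z0 x * \<phi> x / norm x ^ 4 \<partial>lborel) = I z0"
  proof -
    have "Rad m z0 x * \<phi> x / norm x ^ 4 = Rad (m + 4) z0 x * \<phi> x" for x 
    proof -
      have "Rad m z0 x * \<phi> x / norm x ^ 4 = Rad m z0 x / norm x ^ 4 * \<phi> x" by simp
      also have "\<dots> = Rad (m + 4) z0 x * \<phi> x" unfolding Rad_divide_norm by simp
      finally show ?thesis .
    qed
    then show ?thesis by (simp add: I_def)
  qed
  have e4: "(\<integral>x. Rad 4 (potV \<alpha> m) x * Rad m z0 x * \<phi> x \<partial>lborel) = I (\<lambda>t. potV \<alpha> m t * z0 t)"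
    unfolding Rad_mult I_def by (simp add: add.commute)
  have cV: "continuous_on UNIV (potV \<alpha> m)" using DERIV_isCont[OF potV_DERIV] by (auto intro!: continuous_at_imp_continuous_on)
  have c: "continuous_on UNIV f1" "continuous_on UNIV f2" "continuous_on UNIV (\<lambda>t. potV \<alpha> m t * z0 t)"
    unfolding f1_def[abs_def] f2_def[abs_def] by (intro continuous_intros continuous_z continuous_z4 cV)+
  let ?C1 = "2 * ((m+1)\<^sup>2 + 1) * (1 - \<alpha>\<^sup>2)" and ?C2 = "(m+2)\<^sup>2 * m\<^sup>2 * (1 - \<alpha>\<^sup>2)\<^sup>2 - 4 * m\<^sup>2 * (m+1) * (1 - \<alpha>\<^sup>2)"
  \<comment> \<open>This pointwise identity is the definition of z4 with the two coefficients
    expanded.\<close>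
  have z: "f1 t + ?C1 * f2 t + ?C2 * z0 t - potV \<alpha> m t * z0 t = 0" for t
    unfolding f1_def f2_def z4_def Acoef_def Bcoef_def by (simp add: algebra_simps)
  have "I f1 + ?C1 * I f2 + ?C2 * I z0 - I (\<lambda>t. potV \<alpha> m t * z0 t)
    = (\<integral>x. Rad (m + 4) f1 x * \<phi> x + ?C1 * (Rad (m + 4) f2 x * \<phi> x) + ?C2 * (Rad (m + 4) z0 x * \<phi> x) - Rad (m + 4) (\<lambda>t. potV \<alpha> m t * z0 t) x * \<phi> x \<partial>lborel)"
    unfolding I_def using int[OF c(1)] int[OF c(2)] int[OF continuous_z(1)] int[OF c(3)] by simp
  also have "\<dots> = (\<integral>x. 0 \<partial>(lborel :: (real^'n) measure))"
  proof (intro Bochner_Integration.integral_cong refl)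
    fix x :: "real^'n"
    have "Rad (m + 4) f1 x * \<phi> x + ?C1 * (Rad (m + 4) f2 x * \<phi> x) + ?C2 * (Rad (m + 4) z0 x * \<phi> x) - Rad (m + 4) (\<lambda>t. potV \<alpha> m t * z0 t) x * \<phi> x
      = norm x powr (- (m + 4)) * \<phi> x * (f1 (ln (norm x)) + ?C1 * f2 (ln (norm x)) + ?C2 * z0 (ln (norm x)) - potV \<alpha> m (ln (norm x)) * z0 (ln (norm x)))"
      unfolding Rad_def by (simp only: distrib_left right_diff_distrib mult_ac)
    then show "Rad (m + 4) f1 x * \<phi> x + ?C1 * (Rad (m + 4) f2 x * \<phi> x) + ?C2 * (Rad (m + 4) z0 x * \<phi> x) - Rad (m + 4) (\<lambda>t. potV \<alpha> m t * z0 t) x * \<phi> x = 0"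
      unfolding z by simp
  qed
  finally have "I f1 + ?C1 * I f2 + ?C2 * I z0 - I (\<lambda>t. potV \<alpha> m t * z0 t) = 0" by simp
  then show ?thesis unfolding e1 e2 e3 e4 by simp
qed

text \<open>A bump on (1, 2), where tanh(\<alpha> t) is positive, sees the mode with one sign. The
  moment shows both that the mode is not null and that its radial coefficient is nonzero.\<close>

lemma moment_Z:
  obtains \<psi> where "test_fun \<psi>" "(integral\<^sup>L lborel (\<lambda>x::real^'n. Rad m z0 x * Rad (m + 4) \<psi> x)) \<noteq> 0"
proof -
  obtain \<psi> where \<psi>: "test_fun \<psi>" "\<And>t. 0 \<le> \<psi> t" "\<And>t. 0 < \<psi> t \<longleftrightarrow> 1 < t \<and> t < 2"
    using bump_exists[of 1 2] by auto
  obtain \<delta> where d: "\<delta> > 0" "\<And>q x. x \<in> ball (0::real^'n) \<delta> \<Longrightarrow> Rad q \<psi> x = 0" using Rad_test_fun_zero_near[OF \<psi>(1)] by metis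
  obtain R where R: "\<And>q x. R \<le> norm (x::real^'n) \<Longrightarrow> Rad q \<psi> x = 0" using Rad_test_fun_zero_far[OF \<psi>(1)] by metis
  \<comment> \<open>The factor b settles the sign, since b z0 = b^2 P T.\<close>
  define f where "f x = b * (Rad m z0 x * Rad (m + 4) \<psi> x)" for x :: "real^'n"
  have cf: "continuous_on UNIV f" unfolding f_def
    by (rule continuous_off_zero[OF _ d(1)], intro continuous_intros continuous_Rad continuous_z test_fun_continuous \<psi>(1), simp add: d)
  have fi: "integrable lborel f" by (rule integrable_continuous_compact_support[OF cf, where R=R]) (simp add: f_def R)
  have Pp: "P t > 0" for t unfolding P_def using cosh_real_pos[of "\<alpha> * t"] by simp
  have e: "f x = norm x powr (- m) * norm x powr (- (m + 4)) * (b * b) * P (ln (norm x)) * (T (ln (norm x)) * \<psi> (ln (norm x)))" for x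
    by (simp add: f_def Rad_def z0_def)
  have Tp: "0 \<le> T t * \<psi> t" for t
  proof (cases "1 < t \<and> t < 2")
    case True
    then have "0 \<le> T t" unfolding T_def using a by simp
    then show ?thesis using \<psi>(2)[of t] by simp
  next
    case False
    then have "\<psi> t = 0" using \<psi>(2)[of t] \<psi>(3)[of t] by auto
    then show ?thesis by simp
  qed
  obtain i :: 'n where True by auto
  define x0 :: "real^'n" where "x0 = exp (3/2) *\<^sub>R axis i 1"
  have x0: "ln (norm x0) = 3/2" "norm x0 > 0" by (simp_all add: x0_def)
  have "0 < integral\<^sup>L lborel f"
  proof (rule integral_pos_continuous[OF cf fi, where a=x0])
    have bb: "0 < b * b" using b by (simp add: zero_less_power2 flip: power2_eq_square)
    show "0 \<le> f x" for x unfolding e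
      by (rule mult_nonneg_nonneg[OF _ Tp], intro mult_nonneg_nonneg less_imp_le[OF Pp] less_imp_le[OF bb]) auto
    have "0 < T (3/2)" unfolding T_def using a by simp
    then have "0 < T (3/2) * \<psi> (3/2)" using \<psi>(3)[of "3/2"] by simp
    then show "0 < f x0" unfolding e x0(1)
      by (rule mult_pos_pos[rotated], intro mult_pos_pos Pp bb) (use x0(2) in auto)
  qed
  then have "(integral\<^sup>L lborel (\<lambda>x::real^'n. Rad m z0 x * Rad (m + 4) \<psi> x)) \<noteq> 0" unfolding f_def[abs_def] by auto
  then show thesis using that \<psi>(1) by blast
qed

end

end

section \<open>Bubbles in logarithmic coordinates\<close>

text \<open>With r = |x|, 1 + r^(2 \<alpha>) = 2 r^\<alpha> cosh(\<alpha> ln r); the power r^(-m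
  \<alpha>) split off in this way completes r^(-m (1 - \<alpha>)) to r^-m.\<close>

lemma Umu_Rad:
  fixes x :: "real^'n::finite"
  assumes N: "N = 2 * m + 4" "\<mu> = 2 * m * (1 - \<alpha>)" and m: "m > 0"
  shows "Umu N \<mu> x = Rad m (\<lambda>t. KNmu N \<mu> * 2 powr (- m) * cosh (\<alpha> * t) powr (- m)) x"
proof (cases "x = 0")
  case True then show ?thesis by (simp add: Umu_def)
next
  case False
  define t where "t = ln (norm x)"
  have nx: "norm x = exp t" using False by (simp add: t_def)
  have al: "2 * (1 - \<mu> / (N - 4)) = 2 * \<alpha>" using N m by (simp add: field_simps)
  have mm: "- (N - 4) / 2 = - m" using N by simp
  have mu: "- \<mu> / 2 = - m * (1 - \<alpha>)" using N by simp
  have "1 + norm x powr (2 * \<alpha>) = exp (\<alpha> * t) * (2 * cosh (\<alpha> * t))"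
    by (simp add: nx powr_def cosh_def exp_minus distrib_left exp_add[symmetric] mult.commute field_simps)
  then have "(1 + norm x powr (2 * \<alpha>)) powr (- m) = exp (\<alpha> * t) powr (- m) * (2 powr (- m) * cosh (\<alpha> * t) powr (- m))"
    by (simp add: powr_mult)
  moreover have "norm x powr (- m * (1 - \<alpha>)) * exp (\<alpha> * t) powr (- m) = norm x powr (- m)"
    by (simp add: nx exp_powr_real exp_add[symmetric] algebra_simps)
  ultimately have "norm x powr (- m * (1 - \<alpha>)) * (1 + norm x powr (2 * \<alpha>)) powr (- m) = norm x powr (- m) * (2 powr (- m) * cosh (\<alpha> * t) powr (- m))"
    by (simp add: mult.assoc[symmetric])
  then show ?thesis unfolding Umu_def al mm mu Rad_def t_def[symmetric] by (simp add: mult_ac)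
qed

text \<open>The constant in U is made for this: its power 4/m is 16 \<alpha>^4 m (m+1)(m+2)(m+3),
  the factor 2^(-m) becomes 1/16, and \<open>two_ss N - 1\<close> = (m+4)/m exchanges m for m +
  4.\<close>

lemma nonlinearity_Rad:
  fixes x :: "real^'n::finite"
  assumes N: "N = 2 * m + 4" "\<mu> = 2 * m * (1 - \<alpha>)" and m: "m > 0" and a: "\<alpha> > 0"
  shows "(two_ss N - 1) * Umu N \<mu> x powr (two_ss N - 2) = Rad 4 (potV \<alpha> m) x"
proof (cases "x = 0")
  case True then show ?thesis by (simp add: Umu_Rad[OF N m])
next
  case False
  define t where "t = ln (norm x)"
  define K where "K = \<alpha> ^ 4 * (N - 4) * (N - 2) * N * (N + 2)"
  have K: "K = 16 * (\<alpha> ^ 4 * (m * (m+1) * (m+2) * (m+3)))" by (simp add: K_def N(1) algebra_simps)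
  have Kp: "K > 0" unfolding K using m a by (intro mult_pos_pos) auto
  have al: "1 - \<mu> / (N - 4) = \<alpha>" using N m by (simp add: field_simps)
  have KN: "KNmu N \<mu> = K powr (m / 4)" unfolding KNmu_def al K_def using N by simp
  have p2: "two_ss N - 2 = 4 / m" and p1: "two_ss N - 1 = (m + 4) / m" using N m by (simp_all add: two_ss_def field_simps)
  have "Umu N \<mu> x powr (4 / m) = (norm x powr (- m) * (K powr (m / 4) * 2 powr (- m) * cosh (\<alpha> * t) powr (- m))) powr (4 / m)"
    unfolding Umu_Rad[OF N m] Rad_def t_def[symmetric] KN ..
  also have "\<dots> = norm x powr (- 4) * (K * 2 powr (- 4) * cosh (\<alpha> * t) powr (- 4))"
    using m Kp by (simp add: powr_mult powr_powr)
  also have "cosh (\<alpha> * t) powr (- 4) = (1 - (tanh (\<alpha> * t))\<^sup>2)\<^sup>2"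
    unfolding one_minus_tanh_sq using cosh_real_pos[of "\<alpha> * t"] by (simp add: powr_minus power2_eq_square power4_eq_xxxx divide_inverse)
  also have "2 powr (- 4 :: real) = 1 / 16" by (simp add: powr_minus)
  finally have f: "Umu N \<mu> x powr (4 / m) = norm x powr (- 4) * (K * (1/16) * (1 - (tanh (\<alpha> * t))\<^sup>2)\<^sup>2)" .
  have "(two_ss N - 1) * Umu N \<mu> x powr (two_ss N - 2) = norm x powr (- 4) * ((m + 4) / m * (K * (1/16)) * (1 - (tanh (\<alpha> * t))\<^sup>2)\<^sup>2)"
    unfolding p1 p2 f by (simp only: mult_ac)
  also have "(m + 4) / m * (K * (1/16)) = \<alpha> ^ 4 * ((m+1) * (m+2) * (m+3) * (m+4))" using m unfolding K by (simp add: mult_ac)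
  finally show ?thesis unfolding Rad_def potV_def t_def .
qed

text \<open>The field x . grad is d/dt for t = ln |x|. On |x|^-m w it gives |x|^-m (w' - m w), and
  (N - 4)/2 = m cancels the second term.\<close>

lemma dilation_generator_Rad:
  fixes x :: "real^'n::finite"
  assumes N: "N = 2 * m + 4" "\<mu> = 2 * m * (1 - \<alpha>)" and m: "m > 0"
  shows "(N - 4) / 2 * Umu N \<mu> x + x \<bullet> cgrad (Umu N \<mu>) x
    = Rad m (\<lambda>t. - (KNmu N \<mu> * 2 powr (- m) * m * \<alpha>) * (cosh (\<alpha> * t) powr (- m) * tanh (\<alpha> * t))) x"
proof (cases "x = 0")
  case True then show ?thesis by (simp add: Umu_Rad[OF N m])
next
  case False
  let ?k = "KNmu N \<mu> * 2 powr (- m)"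
  define w where "w t = ?k * cosh (\<alpha> * t) powr (- m)" for t
  define w1 where "w1 t = - (?k * m * \<alpha>) * (cosh (\<alpha> * t) powr (- m) * tanh (\<alpha> * t))" for t
  have U: "Umu N \<mu> = (Rad m w :: real^'n \<Rightarrow> real)" by (rule ext) (simp add: Umu_Rad[OF N m] w_def[abs_def])
  have dw: "(w has_real_derivative w1 t) (at t)" for t
  proof -
    have "((\<lambda>t. \<alpha> * t) has_real_derivative \<alpha>) (at t)" by (auto intro!: derivative_eq_intros)
    from DERIV_cmult[OF DERIV_chain2[OF cosh_powr_DERIV[of "-m"] this], of ?k]
    show ?thesis unfolding w_def[abs_def] w1_def by (simp add: mult_ac)
  qed
  have "pd i (Umu N \<mu>) x = x $ i * Rad (m + 2) (\<lambda>t. w1 t - m * w t) x" for i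
    unfolding U by (rule hasPD_pd[OF hasPD_Rad[OF False dw]])
  then have "x \<bullet> cgrad (Umu N \<mu>) x = (\<Sum>i\<in>UNIV. x $ i * x $ i) * Rad (m + 2) (\<lambda>t. w1 t - m * w t) x"
    by (simp add: inner_vec_def cgrad_def sum_distrib_right mult.assoc)
  also have "(\<Sum>i\<in>UNIV. x $ i * x $ i) = (norm x)\<^sup>2" by (simp add: power2_norm_eq_inner inner_vec_def)
  also have "(norm x)\<^sup>2 * Rad (m + 2) (\<lambda>t. w1 t - m * w t) x = Rad m (\<lambda>t. w1 t - m * w t) x" by (rule Rad_norm2)
  finally have xg: "x \<bullet> cgrad (Umu N \<mu>) x = Rad m (\<lambda>t. w1 t - m * w t) x" .
  have "(N - 4) / 2 = m" using N(1) by simp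
  then have "(N - 4) / 2 * Umu N \<mu> x + x \<bullet> cgrad (Umu N \<mu>) x = m * Rad m w x + Rad m (\<lambda>t. w1 t - m * w t) x"
    unfolding xg by (simp only: U)
  also have "\<dots> = Rad m w1 x" by (simp add: Rad_def algebra_simps)
  finally show ?thesis by (simp add: w1_def[abs_def])
qed

lemma solution_very_weak:
  fixes v :: "real^'n::finite \<Rightarrow> real"
  assumes N: "N = 2 * m + 4" "\<mu> = 2 * m * (1 - \<alpha>)" and m: "m > 0" and a: "\<alpha> > 0"
    and v: "Emu N \<mu> v" "lin_sol N \<mu> v"
  shows "very_weak m \<alpha> v"
proof -
  obtain G L where GL: "weak_grad v G" "weak_lap v L" and eq: "\<And>\<phi>. testfun (UNIV - {0}) \<phi> \<Longrightarrow>
        (\<integral>x. L x * clap \<phi> x \<partial>lborel)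
        - Cmu1 N \<mu> * (\<integral>x. (G x \<bullet> cgrad \<phi> x) / norm x^2 \<partial>lborel)
        + Cmu2 N \<mu> * (\<integral>x. v x * \<phi> x / norm x^4 \<partial>lborel)
        = (two_ss N - 1) * (\<integral>x. Umu N \<mu> x powr (two_ss N - 2) * v x * \<phi> x \<partial>lborel)"
    using v(2) unfolding lin_sol_def by blast
  show ?thesis unfolding very_weak_def
  proof (intro conjI allI impI)
    show "locint v" using GL(1) by (simp add: weak_grad_def)
    show "integrable lborel (\<lambda>x. (v x)\<^sup>2 / norm x ^ 4)" using v(1) by (simp add: Emu_def)
    fix \<phi> :: "real^'n \<Rightarrow> real" assume \<phi>: "radial_test \<phi>"
    have "(two_ss N - 1) * (\<integral>x. v x * (Umu N \<mu> x powr (two_ss N - 2) * \<phi> x) \<partial>lborel)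
      = (\<integral>x. v x * (((two_ss N - 1) * Umu N \<mu> x powr (two_ss N - 2)) * \<phi> x) \<partial>lborel)"
      unfolding integral_mult_right_zero[symmetric] by (simp only: mult_ac)
    then show "(\<integral>x. v x * clap (clap \<phi>) x \<partial>lborel) + 2 * ((m+1)\<^sup>2 + 1) * (1 - \<alpha>\<^sup>2) * (\<integral>x. v x * wdiv \<phi> x \<partial>lborel)
      + ((m+2)\<^sup>2 * m\<^sup>2 * (1 - \<alpha>\<^sup>2)\<^sup>2 - 4 * m\<^sup>2 * (m+1) * (1 - \<alpha>\<^sup>2)) * (\<integral>x. v x * (\<phi> x / norm x ^ 4) \<partial>lborel)
      = (\<integral>x. v x * (Rad 4 (potV \<alpha> m) x * \<phi> x) \<partial>lborel)"
      using weak_to_very_weak[OF GL \<phi> eq[OF radial_test_testfun[OF \<phi>]]]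
      unfolding nonlinearity_Rad[OF N m a] Cmu1_eq[OF N m] Cmu2_eq[OF N m] by simp
  qed
qed

text \<open>u enters the identity only through integrals against compactly supported functions. Each
  splitting must come with integrability, because the integral of a non-integrable function is 0 by
  convention.\<close>

lemma very_weak_diff:
  fixes u v :: "real^'n::finite \<Rightarrow> real"
  assumes u: "very_weak m \<alpha> u" and v: "very_weak m \<alpha> v"
  shows "very_weak m \<alpha> (\<lambda>x. u x - c * v x)"
proof -
  have l: "locint u" "locint v" using u v by (auto simp: very_weak_def)
  have um: "u \<in> borel_measurable lborel" "v \<in> borel_measurable lborel" using l by (auto simp: locint_def)
  have ld: "locint (\<lambda>x. u x - c * v x)" unfolding locint_def
  proof (intro conjI allI impI)
    show "(\<lambda>x. u x - c * v x) \<in> borel_measurable lborel" using um by simp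
    fix K :: "(real^'n) set" assume "compact K"
    then have "set_integrable lborel K u" "set_integrable lborel K v" using l by (auto simp: locint_def)
    then show "set_integrable lborel K (\<lambda>x. u x - c * v x)" by (intro set_integral_diff set_integrable_mult_right)
  qed
  have i: "integrable lborel (\<lambda>x. (u x)\<^sup>2 / norm x ^ 4)" "integrable lborel (\<lambda>x. (v x)\<^sup>2 / norm x ^ 4)"
    using u v by (auto simp: very_weak_def)
  have "integrable lborel (\<lambda>x. (u x - c * v x)\<^sup>2 / norm x ^ 4)"
  proof (rule Bochner_Integration.integrable_bound)
    show "integrable lborel (\<lambda>x. 2 * ((u x)\<^sup>2 / norm x ^ 4) + 2 * c\<^sup>2 * ((v x)\<^sup>2 / norm x ^ 4))"
      using i by (intro Bochner_Integration.integrable_add integrable_mult_right)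
    show "(\<lambda>x. (u x - c * v x)\<^sup>2 / norm x ^ 4) \<in> borel_measurable lborel" using um by simp
    show "AE x in lborel. norm ((u x - c * v x)\<^sup>2 / norm x ^ 4) \<le> norm (2 * ((u x)\<^sup>2 / norm x ^ 4) + 2 * c\<^sup>2 * ((v x)\<^sup>2 / norm x ^ 4))"
    proof (intro AE_I2)
      fix x
      have "(u x - c * v x)\<^sup>2 + (u x + c * v x)\<^sup>2 = 2 * (u x)\<^sup>2 + 2 * c\<^sup>2 * (v x)\<^sup>2" by (simp add: power2_eq_square algebra_simps)
      then have "(u x - c * v x)\<^sup>2 \<le> 2 * (u x)\<^sup>2 + 2 * c\<^sup>2 * (v x)\<^sup>2" using zero_le_power2[of "u x + c * v x"] by linarith
      then have "(u x - c * v x)\<^sup>2 / norm x ^ 4 \<le> (2 * (u x)\<^sup>2 + 2 * c\<^sup>2 * (v x)\<^sup>2) / norm x ^ 4" by (intro divide_right_mono) auto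
      then show "norm ((u x - c * v x)\<^sup>2 / norm x ^ 4) \<le> norm (2 * ((u x)\<^sup>2 / norm x ^ 4) + 2 * c\<^sup>2 * ((v x)\<^sup>2 / norm x ^ 4))"
        by (simp add: add_divide_distrib)
    qed
  qed
  moreover have "(\<integral>x. (u x - c * v x) * g x \<partial>lborel) = (\<integral>x. u x * g x \<partial>lborel) - c * (\<integral>x. v x * g x \<partial>lborel)"
    if "continuous_on UNIV g" "\<And>x. R \<le> norm x \<Longrightarrow> g x = 0" for g R
  proof -
    have "(\<integral>x. (u x - c * v x) * g x \<partial>lborel) = (\<integral>x. u x * g x - c * (v x * g x) \<partial>lborel)"
      by (intro Bochner_Integration.integral_cong refl) (simp add: algebra_simps)
    then show ?thesis using locint_integrable_times[OF l(1) that] locint_integrable_times[OF l(2) that] by simp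
  qed
  note split = this
  have split_radial: "(\<integral>x. (u x - c * v x) * g x \<partial>lborel) = (\<integral>x. u x * g x \<partial>lborel) - c * (\<integral>x. v x * g x \<partial>lborel)" if g: "radial_test g" for g
  proof -
    obtain r R where "\<And>x. g x \<noteq> 0 \<Longrightarrow> r \<le> norm x \<and> norm x \<le> R" using radial_test_support[OF g] by blast
    then have "g x = 0" if "R + 1 \<le> norm x" for x using that by (metis add_le_same_cancel1 not_one_le_zero order_trans)
    then show ?thesis using radial_test_pd[OF g] by (intro split) auto
  qed
  have cV: "continuous_on UNIV (potV \<alpha> m)" using DERIV_isCont[OF potV_DERIV] by (auto intro!: continuous_at_imp_continuous_on)
  show ?thesis unfolding very_weak_def
  proof (intro conjI allI impI ld)
    show "integrable lborel (\<lambda>x. (u x - c * v x)\<^sup>2 / norm x ^ 4)" by fact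
    fix \<phi> :: "real^'n \<Rightarrow> real" assume \<phi>: "radial_test \<phi>"
    obtain r R where "\<And>x. \<phi> x \<noteq> 0 \<Longrightarrow> r \<le> norm x \<and> norm x \<le> R" using radial_test_support[OF \<phi>] by blast
    then have R: "\<phi> x = 0" if "R + 1 \<le> norm x" for x using that by (metis add_le_same_cancel1 not_one_le_zero order_trans)
    obtain \<delta> where \<delta>: "\<delta> > 0" "\<And>x. x \<in> ball 0 \<delta> \<Longrightarrow> \<phi> x = 0" using radial_test_zero_near[OF \<phi>] by blast
    have c\<phi>: "continuous_on (UNIV - {0}) \<phi>" using radial_test_pd[OF \<phi>] continuous_on_subset by blast
    have "radial_test (wdiv \<phi>)" unfolding wdiv_def[abs_def]
    proof (intro radial_test_sum)
      fix i
      have "radial_test (\<lambda>x. pd i \<phi> x / norm x ^ 2)" using radial_test_pd[OF \<phi>] by (intro radial_test_divide_norm) auto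
      then show "radial_test (pd i (\<lambda>x. pd i \<phi> x / norm x ^ 2))" using radial_test_pd by blast
    qed auto
    note s3 = split_radial[OF this]
    have s4: "(\<integral>x. (u x - c * v x) * (Rad 4 (potV \<alpha> m) x * \<phi> x) \<partial>lborel) = (\<integral>x. u x * (Rad 4 (potV \<alpha> m) x * \<phi> x) \<partial>lborel) - c * (\<integral>x. v x * (Rad 4 (potV \<alpha> m) x * \<phi> x) \<partial>lborel)"
    proof (rule split)
      show "continuous_on UNIV (\<lambda>x. Rad 4 (potV \<alpha> m) x * \<phi> x)"
        by (rule continuous_off_zero[OF continuous_on_mult[OF continuous_Rad[OF cV] c\<phi>] \<delta>(1)]) (simp add: \<delta>(2))
      show "Rad 4 (potV \<alpha> m) x * \<phi> x = 0" if "R + 1 \<le> norm x" for x using R[OF that] by simp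
    qed
    have lin: "A1 + C1 * B1 + C2 * D1 = E1 \<Longrightarrow> A2 + C1 * B2 + C2 * D2 = E2 \<Longrightarrow>
      (A1 - c * A2) + C1 * (B1 - c * B2) + C2 * (D1 - c * D2) = E1 - c * E2" for A1 A2 B1 B2 C1 C2 D1 D2 E1 E2 :: real
      by (auto simp: algebra_simps)
    show "(\<integral>x. (u x - c * v x) * clap (clap \<phi>) x \<partial>lborel) + 2 * ((m+1)\<^sup>2 + 1) * (1 - \<alpha>\<^sup>2) * (\<integral>x. (u x - c * v x) * wdiv \<phi> x \<partial>lborel)
      + ((m+2)\<^sup>2 * m\<^sup>2 * (1 - \<alpha>\<^sup>2)\<^sup>2 - 4 * m\<^sup>2 * (m+1) * (1 - \<alpha>\<^sup>2)) * (\<integral>x. (u x - c * v x) * (\<phi> x / norm x ^ 4) \<partial>lborel)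
      = (\<integral>x. (u x - c * v x) * (Rad 4 (potV \<alpha> m) x * \<phi> x) \<partial>lborel)"
      unfolding split_radial[OF radial_test_clap[OF radial_test_clap[OF \<phi>]]] split_radial[OF radial_test_divide_norm[OF \<phi>, of 4]] s3 s4
      by (rule lin[OF u[unfolded very_weak_def, THEN conjunct2, THEN conjunct2, rule_format, OF \<phi>]
          v[unfolded very_weak_def, THEN conjunct2, THEN conjunct2, rule_format, OF \<phi>]])
  qed
qed

theorem theorem1p2:
  fixes \<mu> N :: real
  assumes "CARD('n::finite) \<ge> 5"
    and "N = real CARD('n)"
    and "0 < \<mu>" and "\<mu> < N - 4"
  defines "Z \<equiv> (\<lambda>x::real^'n. (N - 4) / 2 * Umu N \<mu> x + x \<bullet> cgrad (Umu N \<mu>) x)"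
  shows "Emu N \<mu> Z \<and> lin_sol N \<mu> Z \<and> \<not> (AE x in lborel. Z x = 0) \<and>
         (\<forall>v :: real^'n \<Rightarrow> real. Emu N \<mu> v \<and> lin_sol N \<mu> v \<longrightarrow>
            (\<exists>c::real. AE x in lborel. v x = c * Z x))"
proof -
  define m where "m = (N - 4) / 2"
  define \<alpha> where "\<alpha> = 1 - \<mu> / (N - 4)"
  \<comment> \<open>The amplitude found in \<open>dilation_generator_Rad\<close>; with it Z is
    exactly \<open>Rad m z0\<close>.\<close>
  define b where "b = - (KNmu N \<mu> * 2 powr (- m) * m * \<alpha>)"
  have N5: "N \<ge> 5" using assms(1,2) by simp
  have N: "N = 2 * m + 4" by (simp add: m_def field_simps)
  have hm: "1/2 \<le> m" "m > 0" using N5 by (auto simp: m_def)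
  have mu: "\<mu> = 2 * m * (1 - \<alpha>)" using N5 by (simp add: m_def \<alpha>_def)
  have ha: "0 < \<alpha>" "\<alpha> < 1" using assms(3,4) N5 by (auto simp: \<alpha>_def field_simps)
  have "KNmu N \<mu> > 0"
    unfolding KNmu_def \<alpha>_def[symmetric] using ha N5 by (simp add: powr_gt_zero)
  then have b0: "b \<noteq> 0" using hm ha by (simp add: b_def)
  interpret bubble m \<alpha> b using hm ha b0 by unfold_locales auto
  have CN: "real CARD('n) = 2 * m + 4" using N assms(2) by simp
  have "z0 = (\<lambda>t. - (KNmu N \<mu> * 2 powr (- m) * m * \<alpha>) * (cosh (\<alpha> * t) powr (- m) * tanh (\<alpha> * t)))"
    by (rule ext) (simp only: z0_def P_def T_def, simp only: b_def)
  then have Z: "Z = Rad m z0" unfolding Z_def by (simp only: dilation_generator_Rad[OF N mu hm(2)])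
  have EZ: "Emu N \<mu> Z" unfolding Z by (rule Emu_Z[OF assms(2) N])
  have LZ: "lin_sol N \<mu> Z" unfolding lin_sol_def
  proof (intro exI conjI allI impI)
    show "weak_grad Z (Gz :: real^'n \<Rightarrow> real^'n)" unfolding Z by (rule weak_grad_Z[OF assms(2) N])
    show "weak_lap Z (Rad (m + 2) lz)" unfolding Z by (rule weak_lap_Z[OF assms(2) N])
    fix \<phi> :: "real^'n \<Rightarrow> real" assume \<phi>: "testfun (UNIV - {0}) \<phi>"
    have "(two_ss N - 1) * (\<integral>x. Umu N \<mu> x powr (two_ss N - 2) * Rad m z0 x * \<phi> x \<partial>lborel)
      = (\<integral>x. ((two_ss N - 1) * Umu N \<mu> x powr (two_ss N - 2)) * Rad m z0 x * \<phi> x \<partial>lborel)"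
      unfolding integral_mult_right_zero[symmetric] by (simp only: mult_ac)
    then show "(\<integral>x. Rad (m + 2) lz x * clap \<phi> x \<partial>lborel) - Cmu1 N \<mu> * (\<integral>x. (Gz x \<bullet> cgrad \<phi> x) / norm x^2 \<partial>lborel)
        + Cmu2 N \<mu> * (\<integral>x. Z x * \<phi> x / norm x^4 \<partial>lborel)
        = (two_ss N - 1) * (\<integral>x. Umu N \<mu> x powr (two_ss N - 2) * Z x * \<phi> x \<partial>lborel)"
      using linear_form_Z[OF assms(2) N \<phi>]
      unfolding Z nonlinearity_Rad[OF N mu hm(2) ha(1)] Cmu1_eq[OF N mu hm(2)] Cmu2_eq[OF N mu hm(2)] by simp
  qed
  have wZ: "very_weak m \<alpha> Z" by (rule solution_very_weak[OF N mu hm(2) ha(1) EZ LZ])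
  obtain \<psi>0 where \<psi>0: "test_fun \<psi>0" "(\<integral>x. Z x * Rad (m + 4) \<psi>0 x \<partial>lborel) \<noteq> 0"
    unfolding Z using moment_Z[OF assms(2) N] by blast
  have nZ: "\<not> (AE x in lborel. Z x = 0)"
  proof
    assume "AE x in lborel. Z x = 0"
    then have "AE x in lborel. Z x * Rad (m + 4) \<psi>0 x = 0" by eventually_elim simp
    then have "(\<integral>x. Z x * Rad (m + 4) \<psi>0 x \<partial>lborel) = 0" by (rule integral_eq_zero_AE)
    then show False using \<psi>0(2) by simp
  qed
  obtain cZ where cZ: "\<And>\<psi>. test_fun \<psi> \<Longrightarrow> (\<integral>x. Z x * Rad (m + 4) \<psi> x \<partial>lborel) = cZ * (\<integral>t. (cosh (\<alpha> * t) powr (- m) * tanh (\<alpha> * t)) * \<psi> t \<partial>lborel)"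
    using radial_mode[OF CN hm(2) ha(1) wZ] by blast
  have cZ0: "cZ \<noteq> 0" using cZ[OF \<psi>0(1)] \<psi>0(2) by auto
  have "\<exists>c::real. AE x in lborel. v x = c * Z x" if v: "Emu N \<mu> v" "lin_sol N \<mu> v" for v :: "real^'n \<Rightarrow> real"
  proof -
    have wv: "very_weak m \<alpha> v" by (rule solution_very_weak[OF N mu hm(2) ha(1) v])
    obtain cv where cv: "\<And>\<psi>. test_fun \<psi> \<Longrightarrow> (\<integral>x. v x * Rad (m + 4) \<psi> x \<partial>lborel) = cv * (\<integral>t. (cosh (\<alpha> * t) powr (- m) * tanh (\<alpha> * t)) * \<psi> t \<partial>lborel)"
      using radial_mode[OF CN hm(2) ha(1) wv] by blast
    \<comment> \<open>This c cancels the radial moments of v - c Z. The modes of positive degree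
      then vanish by \<open>all_modes_vanish\<close>, and all modes together determine the
      function.\<close>
    define c where "c = cv / cZ"
    define u where "u x = v x - c * Z x" for x
    have wu: "very_weak m \<alpha> u" unfolding u_def by (rule very_weak_diff[OF wv wZ])
    have lo: "locint v" "locint Z" "locint u" using wv wZ wu by (auto simp: very_weak_def)
    have int: "integrable lborel (\<lambda>x. w x * Rad (m + 4) \<psi> x)" if "locint w" "test_fun \<psi>" for w :: "real^'n \<Rightarrow> real" and \<psi>
      using locint_integrable_testfun[OF that(1) radial_test_testfun[OF radial_test.gen[OF hpoly.const[of 1] that(2)]], of "m + 4"] by simp
    have r: "(\<integral>x. u x * Rad (m + 4) \<psi> x \<partial>lborel) = 0" if \<psi>: "test_fun \<psi>" for \<psi>
    proof -
      have "(\<integral>x. u x * Rad (m + 4) \<psi> x \<partial>lborel) = (\<integral>x. v x * Rad (m + 4) \<psi> x - c * (Z x * Rad (m + 4) \<psi> x) \<partial>lborel)"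
        by (intro Bochner_Integration.integral_cong refl) (simp add: u_def algebra_simps)
      also have "\<dots> = 0" using int[OF lo(1) \<psi>] int[OF lo(2) \<psi>] cv[OF \<psi>] cZ[OF \<psi>] cZ0 by (simp add: c_def)
      finally show ?thesis .
    qed
    have "AE x in lborel. u x = 0"
      by (rule modes_determine[OF lo(3) all_modes_vanish[OF CN hm(1) ha wu r]])
    then have "AE x in lborel. v x = c * Z x" by eventually_elim (simp add: u_def)
    then show ?thesis by blast
  qed
  then show ?thesis using EZ LZ nZ by blast
qed

end
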